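(* Let $N\ge 1$, let $\phi\in C^1((0,+\infty);(0,+\infty))$ satisfy $(\phi(s)s)'>0$ and $l-1\le \frac{(\phi(s)s)'}{\phi(s)}\le m-1$ for all $s>0$, where $1<l\le m$ are real constants. Let $V\in C^1(\mathbb R^N;\mathbb R)$ be such that $V(0)=0$ and, for some $r_0>0$, $V(x)>0$ for all $x\in B_{4r_0}(0)\setminus\{0\}$; and such that the set $C_0=\{x\in\mathbb R^N: V(x)>0\}\cup\{0\}$ is bounded and $\nabla V(x)\ne0$ for every $x\in\partial C_0$. Let $\bar r=\frac12\operatorname{dist}(0,\mathbb R^N\setminus C_0)$ and $$c^*=\inf\{V(x): x\in C_0,\ |x|\ge\bar r,\ \operatorname{dist}(x,\mathbb R^N\setminus C_0)\ge\bar r\}.$$ Then for every $c\in[0,c^* )$ there exist $I=(\alpha,\omega)$ with $-\infty\le\alpha<\omega\le+\infty$ and a minimal $c$-connection $q:\bar I\to\mathbb R^N$ between $\mathcal V_c^-=\mathcal V_c\cap B_{\bar r}(0)$ and $\mathcal V_c^+=\mathcal V_c\cap\{x:\operatorname{dist}(x,\mathbb R^N\setminus C_0)<\bar r\}$, where $\mathcal V_c=\{x: V(x)\le c\}$. In particular $q\in C^2(I;\mathbb R^N)\cap C^1(\bar I;\mathbb R^N)$, $q$ solves $(\phi(|\dot q|)\dot q)'=\nabla V(q)$ on $I$, and $E_q(t)=-c$ for all $t\in I$.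
   Context: Set $\Phi(s)=\int_0^{|s|}\phi(r)r\,dr$ and $G(s)=\phi(s)s^2-\Phi(s)$ for $s>0$, $G(0)=0$; $\phi(|v|)v$ is read as $0$ when $v=0$. $\operatorname{dist}$ is Euclidean distance; $B_r(x)$ is the open ball. The energy is $E_q(t)=G(|\dot q(t)|)-V(q(t))$. For an interval $I$, $L^\Phi(I;\mathbb R^N)$ is the set of $q\in L^1_{loc}(I;\mathbb R^N)$ with $\int_I\Phi(|q|/\lambda)\,dt<\infty$ for some $\lambda>0$; $W^{1,\Phi}(I;\mathbb R^N)$ is the set of $q\in L^\Phi$ with weak derivative in $L^\Phi$; $W^{1,\Phi}_{loc}(\mathbb R;\mathbb R^N)$ consists of functions whose restriction to every compact interval $I$ lies in $W^{1,\Phi}(I;\mathbb R^N)$ (identified with continuous representatives). $J_{c,I}(q)=\int_I(\Phi(|\dot q|)+V(q)-c)\,dt$, $J_c=J_{c,\mathbb R}$; $\Gamma_c$ is the set of $q\in W^{1,\Phi}_{loc}(\mathbb R;\mathbb R^N)$ with $V(q(t))\ge c$ for all $t$ and $\liminf_{t\to-\infty}\operatorname{dist}(q(t),\mathcal V_c^-)=\liminf_{t\to+\infty}\operatorname{dist}(q(t),\mathcal V_c^+)=0$; $m_c=\inf_{\Gamma_c}J_c$. Let $I=(\alpha,\omega)$, $-\infty\le\alpha<\omega\le+\infty$, with closure $\bar I$ in $\mathbb R$. A function $q:\bar I\to\mathbb R^N$ is a minimal $c$-connection between $\mathcal V_c^-$ and $\mathcal V_c^+$ if $q\in L^\infty(I;\mathbb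 R^N)$ and: (i) $q\in C^1(\bar I;\mathbb R^N)\cap C^2(I;\mathbb R^N)$ and $(\phi(|\dot q|)\dot q)'=\nabla V(q)$ on $I$; (ii) $V(q(t))>c$ and $E_q(t)=-c$ for all $t\in I$; (iii) $\lim_{t\to\alpha^+}\operatorname{dist}(q(t),\mathcal V_c^-)=\lim_{t\to\omega^-}\operatorname{dist}(q(t),\mathcal V_c^+)=0$; (iv) $J_{c,I}(q)=m_c$. *)

theory Defs
  imports "HOL-Analysis.Analysis"
begin

section \<open>Regularity\<close>

definition grad :: "('a::real_inner \<Rightarrow> real) \<Rightarrow> 'a \<Rightarrow> 'a" where
  "grad V x = (THE D. GDERIV V x :> D)"

definition C1_scalar_field :: "('a::real_inner \<Rightarrow> real) \<Rightarrow> bool" where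
  "C1_scalar_field V \<longleftrightarrow> (\<forall>x. \<exists>D. GDERIV V x :> D) \<and> continuous_on UNIV (grad V)"

text \<open>The library's \<open>C1_differentiable_on\<close> uses two-sided derivatives.  For an interval that may
  contain its endpoints we need derivatives relative to the interval.\<close>

definition C1_within :: "real set \<Rightarrow> (real \<Rightarrow> 'a::real_normed_vector) \<Rightarrow> bool" where
  "C1_within S q \<longleftrightarrow>
     (\<exists>D. (\<forall>t\<in>S. (q has_vector_derivative D t) (at t within S)) \<and> continuous_on S D)"

definition C2_on :: "real set \<Rightarrow> (real \<Rightarrow> 'a::real_normed_vector) \<Rightarrow> bool" where
  "C2_on S q \<longleftrightarrow>
     (\<exists>D. (\<forall>t\<in>S. (q has_vector_derivative D t) (at t)) \<and> D C1_differentiable_on S)"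

section \<open>Weak derivatives and Orlicz--Sobolev spaces on intervals\<close>

text \<open>Functions are representatives rather than almost-everywhere classes; only their values on
  the set \<open>I\<close> matter.\<close>

definition L1_loc :: "real set \<Rightarrow> (real \<Rightarrow> 'a::euclidean_space) set" where
  "L1_loc I = {q. \<forall>K. compact K \<and> K \<subseteq> I \<longrightarrow> set_integrable lebesgue K q}"

definition Linfty :: "real set \<Rightarrow> (real \<Rightarrow> 'a::euclidean_space) set" where
  "Linfty I = {q. set_borel_measurable lebesgue I q \<and>
                  (\<exists>M. AE t in lebesgue. t \<in> I \<longrightarrow> norm (q t) \<le> M)}"

text \<open>Test functions: smooth real functions with compact support in the interior of \<open>I\<close>.\<close>

definition test_functions :: "real set \<Rightarrow> (real \<Rightarrow> real) set" where
  "test_functions I =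
     {\<eta>. (\<forall>k. (deriv ^^ k) \<eta> differentiable_on UNIV) \<and>
         compact (closure {t. \<eta> t \<noteq> 0}) \<and> closure {t. \<eta> t \<noteq> 0} \<subseteq> interior I}"

definition has_weak_derivative ::
  "real set \<Rightarrow> (real \<Rightarrow> 'a::euclidean_space) \<Rightarrow> (real \<Rightarrow> 'a) \<Rightarrow> bool" where
  "has_weak_derivative I q g \<longleftrightarrow>
     q \<in> L1_loc (interior I) \<and> g \<in> L1_loc (interior I) \<and>
     (\<forall>\<eta>\<in>test_functions I.
        (LINT t:I|lebesgue. deriv \<eta> t *\<^sub>R q t) = - (LINT t:I|lebesgue. \<eta> t *\<^sub>R g t))"

text \<open>A weak derivative is determined only up to a null set, which is immaterial under
  the integrals below.\<close>

definition weak_derivative ::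
  "real set \<Rightarrow> (real \<Rightarrow> 'a::euclidean_space) \<Rightarrow> real \<Rightarrow> 'a" where
  "weak_derivative I q = (SOME g. has_weak_derivative I q g)"

definition Phi :: "(real \<Rightarrow> real) \<Rightarrow> real \<Rightarrow> real" where
  "Phi \<phi> s = integral {0..\<bar>s\<bar>} (\<lambda>r. \<phi> r * r)"

definition LPhi :: "(real \<Rightarrow> real) \<Rightarrow> real set \<Rightarrow> (real \<Rightarrow> 'a::euclidean_space) set" where
  "LPhi \<phi> I = {q \<in> L1_loc I.
     \<exists>\<mu>>0. (\<integral>\<^sup>+t\<in>I. ennreal (Phi \<phi> (norm (q t) / \<mu>)) \<partial>lebesgue) < \<infinity>}"

definition W1Phi :: "(real \<Rightarrow> real) \<Rightarrow> real set \<Rightarrow> (real \<Rightarrow> 'a::euclidean_space) set" where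
  "W1Phi \<phi> I = {q \<in> LPhi \<phi> I. \<exists>g\<in>LPhi \<phi> I. has_weak_derivative I q g}"

text \<open>Elements are identified with their continuous representatives.\<close>

definition W1Phi_loc :: "(real \<Rightarrow> real) \<Rightarrow> (real \<Rightarrow> 'a::euclidean_space) set" where
  "W1Phi_loc \<phi> = {q. continuous_on UNIV q \<and> (\<forall>a b. q \<in> W1Phi \<phi> {a..b})}"

section \<open>Energy, action and minimal connections\<close>

definition Gfun :: "(real \<Rightarrow> real) \<Rightarrow> real \<Rightarrow> real" where
  "Gfun \<phi> s = (if s > 0 then \<phi> s * s\<^sup>2 - Phi \<phi> s else 0)"

abbreviation velocity :: "(real \<Rightarrow> 'a::real_normed_vector) \<Rightarrow> real \<Rightarrow> 'a" where
  "velocity q t \<equiv> vector_derivative q (at t)"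

definition energy ::
  "(real \<Rightarrow> real) \<Rightarrow> ('a::euclidean_space \<Rightarrow> real) \<Rightarrow> (real \<Rightarrow> 'a) \<Rightarrow> real \<Rightarrow> real" where
  "energy \<phi> V q t = Gfun \<phi> (norm (velocity q t)) - V (q t)"

text \<open>The product \<open>\<phi> (norm v) *\<^sub>R v\<close> is \<open>0\<close> at \<open>v = 0\<close> whatever the value of \<open>\<phi> 0\<close>.\<close>

definition solves_EL ::
  "(real \<Rightarrow> real) \<Rightarrow> ('a::euclidean_space \<Rightarrow> real) \<Rightarrow> real set \<Rightarrow> (real \<Rightarrow> 'a) \<Rightarrow> bool" where
  "solves_EL \<phi> V I q \<longleftrightarrow>
     (\<forall>t\<in>I. ((\<lambda>s. \<phi> (norm (velocity q s)) *\<^sub>R velocity q s)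
               has_vector_derivative grad V (q t)) (at t))"

text \<open>The action takes values in \<open>[0,\<infinity>]\<close>.  It is only ever applied to curves with
  \<open>V (q t) \<ge> c\<close> on \<open>I\<close>, so the integrand is nonnegative and nothing is truncated by
  \<open>ennreal\<close>.\<close>

definition action ::
  "(real \<Rightarrow> real) \<Rightarrow> ('a::euclidean_space \<Rightarrow> real) \<Rightarrow> real \<Rightarrow> real set \<Rightarrow> (real \<Rightarrow> 'a) \<Rightarrow> ennreal" where
  "action \<phi> V c I q =
     (\<integral>\<^sup>+t\<in>I. ennreal (Phi \<phi> (norm (weak_derivative I q t)) + V (q t) - c) \<partial>lebesgue)"

text \<open>The target sets \<open>A\<close> (at \<open>-\<infinity>\<close>) and \<open>B\<close> (at \<open>+\<infinity>\<close>) are meant to be nonempty: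
  \<open>infdist\<close> to the empty set is \<open>0\<close>.\<close>

definition Gamma_c ::
  "(real \<Rightarrow> real) \<Rightarrow> ('a::euclidean_space \<Rightarrow> real) \<Rightarrow> real \<Rightarrow> 'a set \<Rightarrow> 'a set \<Rightarrow> (real \<Rightarrow> 'a) set" where
  "Gamma_c \<phi> V c A B = {q \<in> W1Phi_loc \<phi>.
     (\<forall>t. V (q t) \<ge> c) \<and>
     Liminf at_bot (\<lambda>t. ereal (infdist (q t) A)) = 0 \<and>
     Liminf at_top (\<lambda>t. ereal (infdist (q t) B)) = 0}"

definition min_action ::
  "(real \<Rightarrow> real) \<Rightarrow> ('a::euclidean_space \<Rightarrow> real) \<Rightarrow> real \<Rightarrow> 'a set \<Rightarrow> 'a set \<Rightarrow> ennreal" where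
  "min_action \<phi> V c A B = (INF q\<in>Gamma_c \<phi> V c A B. action \<phi> V c UNIV q)"

text \<open>Only the values of \<open>q\<close> on \<open>closure I\<close> matter, where \<open>I\<close> is the open interval \<open>einterval \<alpha> \<omega>\<close>.
  The one-sided limits are taken in the extended reals: \<open>at_right (-\<infinity>)\<close> and \<open>at_left \<infinity>\<close> correspond
  to \<open>at_bot\<close> and \<open>at_top\<close>.\<close>

definition minimal_connection ::
  "(real \<Rightarrow> real) \<Rightarrow> ('a::euclidean_space \<Rightarrow> real) \<Rightarrow> real \<Rightarrow> 'a set \<Rightarrow> 'a set \<Rightarrow>
    ereal \<Rightarrow> ereal \<Rightarrow> (real \<Rightarrow> 'a) \<Rightarrow> bool" where
  "minimal_connection \<phi> V c A B \<alpha> \<omega> q \<longleftrightarrow>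
     (let I = einterval \<alpha> \<omega> in
        q \<in> Linfty I \<and>
        C1_within (closure I) q \<and> C2_on I q \<and> solves_EL \<phi> V I q \<and>
        (\<forall>t\<in>I. V (q t) > c \<and> energy \<phi> V q t = - c) \<and>
        (((\<lambda>t. infdist (q t) A) \<circ> real_of_ereal) \<longlongrightarrow> 0) (at_right \<alpha>) \<and>
        (((\<lambda>t. infdist (q t) B) \<circ> real_of_ereal) \<longlongrightarrow> 0) (at_left \<omega>) \<and>
        action \<phi> V c I q = min_action \<phi> V c A B)"

section \<open>The potential well\<close>

definition C0 :: "('a::euclidean_space \<Rightarrow> real) \<Rightarrow> 'a set" where
  "C0 V = {x. V x > 0} \<union> {0}"

definition rbar :: "('a::euclidean_space \<Rightarrow> real) \<Rightarrow> real" where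
  "rbar V = infdist 0 (- C0 V) / 2"

definition cstar :: "('a::euclidean_space \<Rightarrow> real) \<Rightarrow> real" where
  "cstar V = (INF x\<in>{x \<in> C0 V. norm x \<ge> rbar V \<and> infdist x (- C0 V) \<ge> rbar V}. V x)"

definition sublevel :: "('a \<Rightarrow> real) \<Rightarrow> real \<Rightarrow> 'a set" where
  "sublevel V c = {x. V x \<le> c}"

definition Vminus :: "('a::euclidean_space \<Rightarrow> real) \<Rightarrow> real \<Rightarrow> 'a set" where
  "Vminus V c = sublevel V c \<inter> ball 0 (rbar V)"

definition Vplus :: "('a::euclidean_space \<Rightarrow> real) \<Rightarrow> real \<Rightarrow> 'a set" where
  "Vplus V c = sublevel V c \<inter> {x. infdist x (- C0 V) < rbar V}"

end

(*
  Minimize the time-discretized action over polygons in the closure of {V > c} that lead from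
  {V <= c} near 0 to {V <= c} near the complement of C0.  These are finite-dimensional compact
  problems, and an optimal polygon with the fewest steps satisfies a discrete Euler-Lagrange
  equation, which makes its momentum phi(|v|) v equi-Lipschitz as the step size tends to 0.
  Positions, momenta and partial actions therefore converge to a C^1 solution of the
  Euler-Lagrange equation, without any compactness theorem in Orlicz-Sobolev spaces.  Minimality
  keeps the polygons from returning to their starting set, so that the limit does connect the two
  sets.  By Jensen's inequality, sampling a competitor in Gamma_c does not increase its kinetic
  part, hence the action of the limit is at most m_c.  Being a competitor itself, the limit is
  minimal, and comparing it with its rescalings q(k t) shows that its constant energy is -c.
*)
theory Submission
  imports Defs "HOL-Analysis.Function_Metric"
begin

section \<open>The Orlicz function and its Legendre transform\<close>

text \<open>Three choices shape the argument. The duration of a connection is not known in advance,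
  so the number of steps is left free: an optimal polygon competes with all polygons having at most
  as many steps, and every comparison polygon must be built without adding steps. Compactness is
  carried by the momentum and not by the velocity: \<open>\<phi>\<close> may degenerate or blow up
  at 0, so the velocity is only a continuous function of the momentum, whereas the discrete equation
  bounds increments of the momentum directly. Finally, translates in time could drift away; each
  polygon is shifted so that time 0 is its first vertex at distance at least \<open>gap / 2\<close>
  from \<open>A\<close>, which keeps the limit at time 0 inside the open set where V > c. The end
  points need care because the two sets may be reached in finite or in infinite time. The
  Euler-Lagrange equation is available only in between, and the vanishing of the velocity at a
  finite end point is read off from the energy identity; hence the energy is determined before C^1
  regularity up to the boundary is proved.\<close>

locale orlicz =
  fixes \<phi> :: "real \<Rightarrow> real" and l m :: real
  assumes phi_pos: "\<And>s. s > 0 \<Longrightarrow> \<phi> s > 0"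
    and phi_C1: "\<phi> C1_differentiable_on {0<..}"
    and lm: "1 < l" "l \<le> m"
    and phi_incr: "\<And>s. s > 0 \<Longrightarrow> deriv (\<lambda>r. \<phi> r * r) s > 0"
    and phi_growth: "\<And>s. s > 0 \<Longrightarrow> l - 1 \<le> deriv (\<lambda>r. \<phi> r * r) s / \<phi> s \<and>
                                    deriv (\<lambda>r. \<phi> r * r) s / \<phi> s \<le> m - 1"
begin

text \<open>The derivative of \<open>Phi \<phi>\<close>, and the norm of the momentum at speed
  s.\<close>

definition flux :: "real \<Rightarrow> real" where "flux s = \<phi> s * s"

lemma flux_0 [simp]: "flux 0 = 0"
  by (simp add: flux_def)

lemma flux_pos: "s > 0 \<Longrightarrow> flux s > 0"
  by (simp add: flux_def phi_pos)

lemma flux_nonneg: "s \<ge> 0 \<Longrightarrow> flux s \<ge> 0"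
  using flux_pos[of s] by (cases "s = 0") auto

lemma flux_C1:
  obtains g' where "\<And>s. s > 0 \<Longrightarrow> (flux has_real_derivative g' s) (at s)"
    "\<And>s. s > 0 \<Longrightarrow> g' s > 0" "continuous_on {0<..} g'"
    "\<And>s. s > 0 \<Longrightarrow> (l - 1) * \<phi> s \<le> g' s" "\<And>s. s > 0 \<Longrightarrow> g' s \<le> (m - 1) * \<phi> s"
proof -
  obtain D where D: "\<And>s. s > 0 \<Longrightarrow> (\<phi> has_vector_derivative D s) (at s)" "continuous_on {0<..} D"
    using phi_C1 by (auto simp: C1_differentiable_on_def)
  have d: "(flux has_real_derivative (D s * s + \<phi> s)) (at s)" if "s > 0" for s
    unfolding flux_def
    by (rule derivative_eq_intros refl D(1)[OF that, folded has_real_derivative_iff_has_vector_derivative])+ simp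
  have e: "deriv (\<lambda>r. \<phi> r * r) s = D s * s + \<phi> s" if "s > 0" for s
    using DERIV_imp_deriv[OF d[OF that]] by (simp add: flux_def[abs_def])
  have cphi: "continuous_on {0<..} \<phi>"
    using D(1) by (intro continuous_at_imp_continuous_on ballI) (metis greaterThan_iff has_vector_derivative_continuous)
  show ?thesis
  proof
    show "(flux has_real_derivative (\<lambda>s. D s * s + \<phi> s) s) (at s)" if "s > 0" for s
      using d[OF that] .
    show "D s * s + \<phi> s > 0" if "s > 0" for s
      using phi_incr[OF that] e[OF that] by simp
    show "continuous_on {0<..} (\<lambda>s. D s * s + \<phi> s)"
      by (intro continuous_intros D cphi)
    show "(l - 1) * \<phi> s \<le> D s * s + \<phi> s" "D s * s + \<phi> s \<le> (m - 1) * \<phi> s" if "s > 0" for s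
      using phi_growth[OF that] e[OF that] phi_pos[OF that] by (auto simp: field_simps)
  qed
qed

lemma flux_strict_mono:
  assumes "0 \<le> a" "a < b" shows "flux a < flux b"
proof (cases "a = 0")
  case True then show ?thesis using flux_pos[of b] assms by simp
next
  case False
  obtain g' where g': "\<And>s. s > 0 \<Longrightarrow> (flux has_real_derivative g' s) (at s)"
    "\<And>s. s > 0 \<Longrightarrow> g' s > 0" using flux_C1 by metis
  show ?thesis
  proof (rule DERIV_pos_imp_increasing[OF assms(2)])
    fix x assume "a \<le> x" "x \<le> b"
    then have "x > 0" using False assms by simp
    then show "\<exists>y. (flux has_real_derivative y) (at x) \<and> 0 < y" using g' by blast
  qed
qed

lemma flux_mono: "0 \<le> a \<Longrightarrow> a \<le> b \<Longrightarrow> flux a \<le> flux b"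
  using flux_strict_mono[of a b] by (cases "a = b") auto

text \<open>The lower growth bound says that the logarithmic derivative of \<open>flux\<close> is at
  least (l - 1) / s, so flux(s) / s^(l - 1) does not decrease. As l > 1, this yields both continuity
  at 0 and growth to infinity.\<close>

lemma flux_powr_mono:
  assumes "0 < a" "a \<le> b"
  shows "flux a * a powr (1 - l) \<le> flux b * b powr (1 - l)"
proof -
  obtain g' where g': "\<And>s. s > 0 \<Longrightarrow> (flux has_real_derivative g' s) (at s)"
    "\<And>s. s > 0 \<Longrightarrow> (l - 1) * \<phi> s \<le> g' s" using flux_C1 by metis
  show ?thesis
  proof (rule DERIV_nonneg_imp_nondecreasing[OF assms(2)])
    fix x assume "a \<le> x" "x \<le> b"
    then have x: "x > 0" using assms by simp
    have "((\<lambda>x. flux x * x powr (1 - l)) has_real_derivative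
        (g' x * x powr (1 - l) + (1 - l) * x powr (1 - l - 1) * flux x)) (at x)"
      using x by (auto intro!: derivative_eq_intros g'(1))
    moreover have "x powr (1 - l - 1) * flux x = x powr (1 - l) * \<phi> x"
      using x powr_mult_base[of x "- l"] by (simp add: flux_def mult.commute mult.left_commute)
    then have "g' x * x powr (1 - l) + (1 - l) * x powr (1 - l - 1) * flux x
        = x powr (1 - l) * (g' x - (l - 1) * \<phi> x)"
      by (simp add: algebra_simps)
    then have "g' x * x powr (1 - l) + (1 - l) * x powr (1 - l - 1) * flux x \<ge> 0"
      using g'(2)[OF x] by simp
    ultimately show "\<exists>y. ((\<lambda>x. flux x * x powr (1 - l)) has_real_derivative y) (at x) \<and> 0 \<le> y"
      by blast
  qed
qed

lemma flux_le_powr: "0 < s \<Longrightarrow> s \<le> 1 \<Longrightarrow> flux s \<le> flux 1 * s powr (l - 1)"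
  using flux_powr_mono[of s 1] by (simp add: powr_diff powr_minus field_simps)

lemma flux_ge_powr: "1 \<le> s \<Longrightarrow> flux 1 * s powr (l - 1) \<le> flux s"
  using flux_powr_mono[of 1 s] by (simp add: powr_diff powr_minus field_simps)

lemma flux_unbounded: "\<exists>s>0. flux s \<ge> y"
proof -
  \<comment> \<open>The summand 1 keeps s \<ge> 1, where \<open>flux_ge_powr\<close> applies; then
    flux s is at least flux 1 + |y|.\<close>
  define s where "s = (1 + \<bar>y\<bar> / flux 1) powr (1 / (l - 1))"
  have f1: "flux 1 > 0" by (simp add: flux_pos)
  have s1: "s \<ge> 1" unfolding s_def by (rule ge_one_powr_ge_zero) (use lm f1 in auto)
  have "s powr (l - 1) = 1 + \<bar>y\<bar> / flux 1"
    unfolding s_def using lm f1 by (simp add: powr_powr add_nonneg_nonneg)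
  then have "flux s \<ge> flux 1 * (1 + \<bar>y\<bar> / flux 1)" using flux_ge_powr[OF s1] by simp
  also have "flux 1 * (1 + \<bar>y\<bar> / flux 1) = flux 1 + \<bar>y\<bar>" using f1 by (simp add: field_simps)
  finally show ?thesis using s1 f1 by (intro exI[of _ s]) auto
qed

lemma continuous_on_flux: "continuous_on {0..} flux"
proof -
  obtain g' where g': "\<And>s. s > 0 \<Longrightarrow> (flux has_real_derivative g' s) (at s)"
    using flux_C1 by metis
  have "continuous (at x within {0..}) flux" if "x \<ge> 0" for x
  proof (cases "x = 0")
    case True
    \<comment> \<open>Nothing is known of \<open>\<phi>\<close> near 0; the power bound with
      positive exponent l - 1 squeezes \<open>flux\<close> to 0.\<close>
    have "((\<lambda>s. flux 1 * s powr (l - 1)) \<longlongrightarrow> flux 1 * 0 powr (l - 1)) (at 0 within {0..})"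
      using lm by (intro tendsto_intros tendsto_powr2) (auto simp: eventually_at_filter)
    then have *: "((\<lambda>s. flux 1 * s powr (l - 1)) \<longlongrightarrow> 0) (at 0 within {0..})" by simp
    have "(flux \<longlongrightarrow> 0) (at 0 within {0..})"
    proof (rule tendsto_sandwich[OF _ _ tendsto_const *])
      show "\<forall>\<^sub>F x in at 0 within {0..}. 0 \<le> flux x"
        by (auto simp: eventually_at_filter flux_nonneg)
      show "\<forall>\<^sub>F x in at 0 within {0..}. flux x \<le> flux 1 * x powr (l - 1)"
        unfolding eventually_at by (intro exI[of _ 1]) (auto intro!: flux_le_powr simp: dist_real_def)
    qed
    then show ?thesis by (simp add: True continuous_within)
  next
    case False
    then show ?thesis
      using that DERIV_isCont[OF g'[of x]] by (auto intro!: continuous_at_imp_continuous_at_within[where s="{0..}"])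
  qed
  then show ?thesis by (simp add: continuous_on_eq_continuous_within)
qed

lemma flux_integrable: "flux integrable_on {0..b}"
  by (rule integrable_continuous_real) (rule continuous_on_subset[OF continuous_on_flux], auto)

section \<open>Convexity and growth of the Orlicz function\<close>

lemma Phi_eq: "s \<ge> 0 \<Longrightarrow> Phi \<phi> s = integral {0..s} flux"
  by (simp add: Phi_def flux_def[abs_def])

lemma Phi_0 [simp]: "Phi \<phi> 0 = 0" by (simp add: Phi_def)

lemma Phi_derivative:
  assumes "s > 0" shows "(Phi \<phi> has_real_derivative flux s) (at s)"
proof -
  have "((\<lambda>u. integral {0..u} flux) has_real_derivative flux s) (at s within {0..s+1})"
    by (rule integral_has_real_derivative)
      (use assms in \<open>auto intro: continuous_on_subset[OF continuous_on_flux]\<close>)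
  then have "((\<lambda>u. integral {0..u} flux) has_real_derivative flux s) (at s within {0<..<s+1})"
    by (rule DERIV_subset) auto
  then have "(Phi \<phi> has_real_derivative flux s) (at s within {0<..<s+1})"
    by (rule has_field_derivative_transform_within[of _ _ _ _ 1]) (use assms in \<open>auto simp: Phi_eq\<close>)
  then show ?thesis using assms by (simp add: at_within_open[of s "{0<..<s+1}"])
qed

lemma continuous_on_Phi: "continuous_on {0..} (Phi \<phi>)"
proof -
  have "continuous_on {0..b} (Phi \<phi>)" for b
  proof -
    have "continuous_on {0..b} (\<lambda>u. integral {0..u} flux)"
      by (rule indefinite_integral_continuous_1) (rule flux_integrable)
    then show ?thesis by (rule continuous_on_eq) (auto simp: Phi_eq)
  qed
  note c = this
  have "continuous (at x within {0..}) (Phi \<phi>)" if "x \<ge> 0" for x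
  proof -
    have "at x within {0..} = at x within {0..x+1}"
      by (rule at_within_nhd[of _ "{..<x+1}"]) auto
    then show ?thesis using c[of "x+1"] that by (auto simp: continuous_on_eq_continuous_within)
  qed
  then show ?thesis by (simp add: continuous_on_eq_continuous_within)
qed

lemma Phi_mvt:
  assumes "0 \<le> a" "a < b"
  obtains z where "a < z" "z < b" "Phi \<phi> b - Phi \<phi> a = (b - a) * flux z"
proof -
  have c: "continuous_on {a..b} (Phi \<phi>)"
    by (rule continuous_on_subset[OF continuous_on_Phi]) (use assms in auto)
  have "\<exists>l z. a < z \<and> z < b \<and> (Phi \<phi> has_real_derivative l) (at z) \<and> Phi \<phi> b - Phi \<phi> a = (b - a) * l"
  proof (rule MVT[OF assms(2) c])
    fix x assume "a < x" "x < b"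
    then show "Phi \<phi> differentiable (at x)"
      using assms Phi_derivative[of x] by (auto simp: real_differentiable_def)
  qed
  then obtain L z where z: "a < z" "z < b" "(Phi \<phi> has_real_derivative L) (at z)"
    "Phi \<phi> b - Phi \<phi> a = (b - a) * L" by blast
  moreover have "L = flux z" using DERIV_unique[OF z(3) Phi_derivative] z assms by simp
  ultimately show ?thesis using that by blast
qed

text \<open>Convexity in tangent form, from the mean value theorem and the monotonicity of
  \<open>flux\<close>.\<close>

lemma Phi_tangent:
  assumes "0 \<le> a" "0 \<le> b"
  shows "Phi \<phi> a + flux a * (b - a) \<le> Phi \<phi> b"
proof -
  consider "a = b" | "a < b" | "b < a" by linarith
  then show ?thesis
  proof cases
    case 2
    obtain z where z: "a < z" "z < b" "Phi \<phi> b - Phi \<phi> a = (b - a) * flux z"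
      using Phi_mvt[OF assms(1) 2] .
    have "(b - a) * flux a \<le> (b - a) * flux z"
      using z assms by (intro mult_left_mono flux_mono) auto
    then show ?thesis using z by (simp add: algebra_simps)
  next
    case 3
    obtain z where z: "b < z" "z < a" "Phi \<phi> a - Phi \<phi> b = (a - b) * flux z"
      using Phi_mvt[OF assms(2) 3] .
    have "(a - b) * flux z \<le> (a - b) * flux a"
      using z assms by (intro mult_left_mono flux_mono) auto
    then show ?thesis using z by (simp add: algebra_simps)
  qed auto
qed

lemma Phi_nonneg: "s \<ge> 0 \<Longrightarrow> Phi \<phi> s \<ge> 0"
  using Phi_tangent[of 0 s] by simp

lemma Phi_mono: assumes "0 \<le> a" "a \<le> b" shows "Phi \<phi> a \<le> Phi \<phi> b"
  using Phi_tangent[of a b] assms mult_nonneg_nonneg[OF flux_nonneg[OF assms(1)], of "b - a"] by simp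

lemma Phi_pos: assumes "s > 0" shows "Phi \<phi> s > 0"
  using Phi_tangent[of "s/2" s] assms Phi_nonneg[of "s/2"]
    mult_pos_pos[OF flux_pos[of "s/2"], of "s - s/2"] by linarith

text \<open>Since \<open>flux a\<close> can be made arbitrarily large, this expresses superlinear
  growth of \<open>Phi \<phi>\<close>.\<close>

lemma Phi_ge_linear: "0 \<le> a \<Longrightarrow> 0 \<le> s \<Longrightarrow> flux a * s - flux a * a \<le> Phi \<phi> s"
  using Phi_tangent[of a s] Phi_nonneg[of a] by (simp add: algebra_simps)

text \<open>The Delta_2 condition: the difference of the two sides vanishes at 0, and its derivative
  is nonnegative by the upper growth bound.\<close>

lemma flux_le_Phi:
  assumes "s \<ge> 0" shows "flux s * s \<le> m * Phi \<phi> s"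
proof (cases "s = 0")
  case False
  obtain g' where g': "\<And>s. s > 0 \<Longrightarrow> (flux has_real_derivative g' s) (at s)"
    "\<And>s. s > 0 \<Longrightarrow> g' s \<le> (m - 1) * \<phi> s" using flux_C1 by metis
  let ?h = "\<lambda>s. m * Phi \<phi> s - flux s * s"
  have "?h 0 \<le> ?h s"
  proof (rule DERIV_nonneg_imp_increasing_open[OF assms])
    show "continuous_on {0..s} ?h"
      by (intro continuous_intros continuous_on_subset[OF continuous_on_Phi]
          continuous_on_subset[OF continuous_on_flux]) auto
    fix x assume x: "0 < x" "x < s"
    have "(?h has_real_derivative (m * flux x - (g' x * x + flux x))) (at x)"
      using x by (auto intro!: derivative_eq_intros g'(1) Phi_derivative)
    moreover have "g' x * x \<le> (m - 1) * \<phi> x * x" using g'(2)[of x] x by simp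
    then have "m * flux x - (g' x * x + flux x) \<ge> 0" by (simp add: flux_def algebra_simps)
    ultimately show "\<exists>y. (?h has_real_derivative y) (at x) \<and> 0 \<le> y" by blast
  qed
  then show ?thesis by simp
qed simp

lemma Gfun_eq: "s \<ge> 0 \<Longrightarrow> Gfun \<phi> s = flux s * s - Phi \<phi> s"
  by (auto simp: Gfun_def flux_def power2_eq_square)

text \<open>The tangent at b evaluated at a bounds G(b) below by flux(b) a - Phi(a), and
  \<open>flux\<close> increases.\<close>

lemma Gfun_mono:
  assumes "0 \<le> a" "a \<le> b" shows "Gfun \<phi> a \<le> Gfun \<phi> b"
proof -
  have "flux a * a \<le> flux b * a" using flux_mono[OF assms] assms by (intro mult_right_mono) auto
  then show ?thesis
    using Phi_tangent[of b a] assms by (simp add: Gfun_eq algebra_simps)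
qed

lemma Gfun_pos: assumes "s > 0" shows "Gfun \<phi> s > 0"
proof -
  \<comment> \<open>Halving s makes the estimate strict: the tangent at s evaluated at s/2 makes the
    last bracket nonnegative, and Phi(s/2) \<le> flux(s/2) s/2 < flux(s) s/2.\<close>
  have "Gfun \<phi> s = flux s * s / 2 - Phi \<phi> (s/2) + (Phi \<phi> (s/2) + flux s * s / 2 - Phi \<phi> s)"
    using assms by (simp add: Gfun_eq)
  moreover have "Phi \<phi> (s/2) + flux s * s / 2 - Phi \<phi> s \<ge> 0"
    using Phi_tangent[of s "s/2"] assms by (simp add: algebra_simps)
  moreover have "Phi \<phi> (s/2) \<le> flux (s/2) * (s/2)"
    using Phi_tangent[of "s/2" 0] assms by simp
  moreover have "flux (s/2) * (s/2) < flux s * (s/2)"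
    using flux_strict_mono[of "s/2" s] assms by simp
  ultimately show ?thesis by (simp add: algebra_simps)
qed

lemma Gfun_nonneg: "s \<ge> 0 \<Longrightarrow> Gfun \<phi> s \<ge> 0"
  using Gfun_pos[of s] by (cases "s = 0") (auto simp: Gfun_def)

lemma Gfun_le: "s \<ge> 0 \<Longrightarrow> Gfun \<phi> s \<le> (m - 1) * Phi \<phi> s"
  using flux_le_Phi[of s] by (simp add: Gfun_eq algebra_simps)


section \<open>The momentum map, its inverse and the Legendre transform\<close>

definition mom :: "'a::euclidean_space \<Rightarrow> 'a" where "mom v = \<phi> (norm v) *\<^sub>R v"

lemma norm_mom: "norm (mom v) = flux (norm v)"
  using flux_nonneg[of "norm v"] flux_pos[of "norm v"] phi_pos[of "norm v"]
  by (cases "v = 0") (auto simp: mom_def flux_def)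

lemma mom_0 [simp]: "mom 0 = 0" by (simp add: mom_def)

lemma mom_inner_self: "mom v \<bullet> v = flux (norm v) * norm v"
  by (simp add: mom_def flux_def dot_square_norm power2_eq_square)

lemma Phi_norm_tangent:
  fixes v w :: "'a::euclidean_space"
  shows "Phi \<phi> (norm w) + mom w \<bullet> (v - w) \<le> Phi \<phi> (norm v)"
proof -
  have "mom w \<bullet> v \<le> flux (norm w) * norm v"
    using Cauchy_Schwarz_ineq2[of "mom w" v] by (simp add: norm_mom)
  then show ?thesis
    using Phi_tangent[of "norm w" "norm v"] by (simp add: inner_diff_right mom_inner_self algebra_simps)
qed

text \<open>At 0 the factor \<open>\<phi> (norm v)\<close> may blow up, but the norm
  \<open>flux (norm v)\<close> of the product still tends to 0.\<close>

lemma isCont_mom: "isCont (mom :: 'a::euclidean_space \<Rightarrow> 'a) v"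
proof (cases "v = 0")
  case True
  have "((\<lambda>v::'a. norm (mom v)) \<longlongrightarrow> flux (norm (0::'a))) (at 0)"
    unfolding norm_mom
    by (rule continuous_within_tendsto_compose[of "norm (0::'a)" "{0..}" flux])
       (use continuous_on_flux in \<open>auto intro!: tendsto_eq_intros simp: continuous_on_eq_continuous_within\<close>)
  then have "((mom :: 'a \<Rightarrow> 'a) \<longlongrightarrow> 0) (at 0)" by (auto intro: tendsto_norm_zero_cancel)
  then show ?thesis by (simp add: True isCont_def)
next
  case False
  have "isCont \<phi> (norm v)"
    using phi_C1 False unfolding C1_differentiable_on_def
    by (auto intro: has_vector_derivative_continuous)
  then have "isCont (\<lambda>v. \<phi> (norm v)) v"
    by (intro isCont_o2[where f=norm and g=\<phi>] continuous_intros)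
  then show ?thesis unfolding mom_def[abs_def] by (intro continuous_intros)
qed

text \<open>The tangent inequalities at v and at y squeeze the remainder between 0 and the inner
  product of mom y - mom v with y - v, so continuity of \<open>mom\<close> is enough, also at v =
  0.\<close>

lemma Phi_norm_has_derivative:
  fixes v :: "'a::euclidean_space"
  shows "((\<lambda>v. Phi \<phi> (norm v)) has_derivative (\<lambda>h. mom v \<bullet> h)) (at v)"
proof (rule has_derivativeI_sandwich[where e=1 and H="\<lambda>y. norm (mom y - mom v)"])
  show "bounded_linear (\<lambda>h. mom v \<bullet> h)" by (rule bounded_linear_inner_right)
  have "((\<lambda>y. norm (mom y - mom v)) \<longlongrightarrow> norm (mom v - mom v)) (at v)"
    by (intro tendsto_intros isCont_mom[unfolded isCont_def])
  then show "((\<lambda>y. norm (mom y - mom v)) \<longlongrightarrow> 0) (at v)" by simp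
  fix y assume "y \<noteq> v" "dist y v < 1"
  have a: "Phi \<phi> (norm y) - Phi \<phi> (norm v) - mom v \<bullet> (y - v) \<ge> 0"
    using Phi_norm_tangent[of v y] by simp
  have "Phi \<phi> (norm y) - Phi \<phi> (norm v) - mom v \<bullet> (y - v) \<le> (mom y - mom v) \<bullet> (y - v)"
    using Phi_norm_tangent[of y v] by (simp add: inner_diff_right inner_diff_left)
  also have "\<dots> \<le> norm (mom y - mom v) * norm (y - v)" by (rule norm_cauchy_schwarz)
  finally show "norm (Phi \<phi> (norm y) - Phi \<phi> (norm v) - mom v \<bullet> (y - v)) / norm (y - v)
      \<le> norm (mom y - mom v)"
    using a \<open>y \<noteq> v\<close> by (simp add: field_simps)
qed simp

lemma continuous_on_Phi_norm: "continuous_on S (\<lambda>v::'a::euclidean_space. Phi \<phi> (norm v))"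
  using Phi_norm_has_derivative has_derivative_continuous
  by (intro continuous_at_imp_continuous_on ballI) blast

text \<open>On the reals \<open>mom\<close> is the odd extension of \<open>flux\<close>, a bijection
  of the whole line; inverting it avoids domain conditions.\<close>

definition flux_inv :: "real \<Rightarrow> real" where "flux_inv = inv (mom :: real \<Rightarrow> real)"

lemma mom_real_nonneg: "s \<ge> 0 \<Longrightarrow> mom (s::real) = flux s"
  by (simp add: mom_def flux_def)

lemma mom_real_minus: "mom (- s::real) = - mom s"
  by (simp add: mom_def)

lemma mom_real_strict_mono: "strict_mono (mom :: real \<Rightarrow> real)"
proof (rule strict_monoI)
  fix x y :: real assume "x < y"
  consider "0 \<le> x" | "x < 0" "0 \<le> y" | "y < 0" by linarith
  then show "mom x < mom y"
  proof cases
    case 1 then show ?thesis using flux_strict_mono[of x y] \<open>x < y\<close> by (simp add: mom_real_nonneg)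
  next
    case 2 then show ?thesis
      using flux_pos[of "- x"] flux_nonneg[of y] mom_real_minus[of "-x"] by (simp add: mom_real_nonneg)
  next
    case 3 then show ?thesis
      using flux_strict_mono[of "-y" "-x"] \<open>x < y\<close> mom_real_minus[of "-x"] mom_real_minus[of "-y"]
      by (simp add: mom_real_nonneg)
  qed
qed

lemma bij_mom_real: "bij (mom :: real \<Rightarrow> real)"
proof -
  have "\<exists>x. mom x = y" for y :: real
  proof -
    obtain s where s: "s > 0" "flux s \<ge> \<bar>y\<bar>" using flux_unbounded by blast
    have "\<exists>x\<ge>-s. x \<le> s \<and> mom x = y"
      by (rule IVT) (use s in \<open>auto simp: isCont_mom mom_real_minus mom_real_nonneg\<close>)
    then show ?thesis by blast
  qed
  then have "surj (mom :: real \<Rightarrow> real)" by (metis surjI)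
  moreover have "inj (mom :: real \<Rightarrow> real)"
    using mom_real_strict_mono strict_mono_imp_inj_on by blast
  ultimately show ?thesis by (simp add: bij_def)
qed

lemma flux_inv_mom [simp]: "flux_inv (mom s) = s"
  using bij_mom_real by (simp add: flux_inv_def bij_is_inj)

lemma mom_flux_inv [simp]: "mom (flux_inv y) = y"
  using bij_mom_real by (simp add: flux_inv_def bij_is_surj surj_f_inv_f)

lemma flux_inv_strict_mono: "x < y \<Longrightarrow> flux_inv x < flux_inv y"
  using mom_real_strict_mono by (metis mom_flux_inv strict_mono_less)

lemma flux_inv_mono: "x \<le> y \<Longrightarrow> flux_inv x \<le> flux_inv y"
  using flux_inv_strict_mono[of x y] by (cases "x = y") auto

lemma flux_inv_0 [simp]: "flux_inv 0 = 0"
  using flux_inv_mom[of 0] by simp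

lemma flux_inv_nonneg: "y \<ge> 0 \<Longrightarrow> flux_inv y \<ge> 0"
  using flux_inv_mono[of 0 y] by simp

lemma flux_inv_pos: "y > 0 \<Longrightarrow> flux_inv y > 0"
  using flux_inv_strict_mono[of 0 y] by simp

lemma flux_flux_inv: "y \<ge> 0 \<Longrightarrow> flux (flux_inv y) = y"
  by (metis mom_flux_inv mom_real_nonneg flux_inv_nonneg)

lemma flux_inv_flux: "s \<ge> 0 \<Longrightarrow> flux_inv (flux s) = s"
  using flux_inv_mom[of s] by (simp add: mom_real_nonneg)

lemma isCont_flux_inv: "isCont flux_inv y"
proof -
  have "flux_inv ` UNIV = UNIV" by (metis flux_inv_mom surjI)
  then have "continuous_on UNIV flux_inv"
    by (intro continuous_onI_mono) (auto intro: flux_inv_mono)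
  then show ?thesis by (simp add: continuous_on_eq_continuous_at)
qed

text \<open>The inverse of \<open>mom\<close> (see \<open>mom_vel\<close> and
  \<open>vel_mom\<close>): velocity as a function of momentum.\<close>

definition vel :: "'a::euclidean_space \<Rightarrow> 'a" where
  "vel p = (flux_inv (norm p) / norm p) *\<^sub>R p"

lemma vel_0 [simp]: "vel 0 = 0" by (simp add: vel_def)

lemma norm_vel: "norm (vel p) = flux_inv (norm p)"
  using flux_inv_nonneg[of "norm p"] by (cases "p = 0") (auto simp: vel_def)

lemma mom_vel [simp]: "mom (vel p) = p"
proof (cases "p = 0")
  case False
  have s: "flux_inv (norm p) > 0" using False flux_inv_pos by simp
  have "mom (vel p) = (flux (flux_inv (norm p)) / norm p) *\<^sub>R p"
    using False by (simp add: mom_def norm_vel flux_def) (simp add: vel_def)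
  then show ?thesis using False by (simp add: flux_flux_inv)
qed simp

lemma vel_mom [simp]: "vel (mom v) = v"
proof (cases "v = 0")
  case False
  then have "\<phi> (norm v) > 0" by (simp add: phi_pos)
  then show ?thesis using False
    by (simp add: vel_def norm_mom flux_inv_flux) (simp add: mom_def flux_def)
qed simp

lemma isCont_vel: "isCont (vel :: 'a::euclidean_space \<Rightarrow> 'a) p"
proof (cases "p = 0")
  case True
  have "((\<lambda>p::'a. norm (vel p)) \<longlongrightarrow> flux_inv (norm (0::'a))) (at 0)"
    unfolding norm_vel by (intro isCont_tendsto_compose[OF isCont_flux_inv] tendsto_norm tendsto_ident_at)
  then have "((vel :: 'a \<Rightarrow> 'a) \<longlongrightarrow> 0) (at 0)" by (auto intro: tendsto_norm_zero_cancel)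
  then show ?thesis by (simp add: True isCont_def)
next
  case False
  have "isCont (\<lambda>p::'a. flux_inv (norm p)) p"
    by (rule isCont_o2[OF _ isCont_flux_inv]) (intro continuous_intros)
  then show ?thesis unfolding vel_def[abs_def] using False by (intro continuous_intros) auto
qed

text \<open>\<open>p \<mapsto> Gfun \<phi> (norm (vel p))\<close> is the Legendre transform of \<open>v \<mapsto> Phi \<phi> (norm v)\<close>.\<close>

lemma Gfun_norm_vel: "Gfun \<phi> (norm (vel p)) = p \<bullet> vel p - Phi \<phi> (norm (vel p))"
  using mom_inner_self[of "vel p"] by (simp add: Gfun_eq)

lemma Gfun_vel_has_derivative:
  fixes p :: "'a::euclidean_space"
  shows "((\<lambda>p. Gfun \<phi> (norm (vel p))) has_derivative (\<lambda>h. vel p \<bullet> h)) (at p)"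
proof (rule has_derivativeI_sandwich[where e=1 and H="\<lambda>y. norm (vel y - vel p)"])
  \<comment> \<open>The tangent inequality of the Legendre transform is that of Phi at
    \<open>vel y\<close>, evaluated at \<open>vel p\<close>.\<close>
  have conv: "Gfun \<phi> (norm (vel y)) - Gfun \<phi> (norm (vel p)) \<ge> vel p \<bullet> (y - p)" for y p :: 'a
    using Phi_norm_tangent[of "vel y" "vel p"] unfolding Gfun_norm_vel
    by (simp add: inner_diff_right inner_diff_left inner_commute)
  show "bounded_linear (\<lambda>h. vel p \<bullet> h)" by (rule bounded_linear_inner_right)
  have "((\<lambda>y. norm (vel y - vel p)) \<longlongrightarrow> norm (vel p - vel p)) (at p)"
    by (intro tendsto_intros isCont_vel[unfolded isCont_def])
  then show "((\<lambda>y. norm (vel y - vel p)) \<longlongrightarrow> 0) (at p)" by simp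
  fix y assume "y \<noteq> p" "dist y p < 1"
  have a: "Gfun \<phi> (norm (vel y)) - Gfun \<phi> (norm (vel p)) - vel p \<bullet> (y - p) \<ge> 0"
    using conv[of p y] by simp
  have "Gfun \<phi> (norm (vel y)) - Gfun \<phi> (norm (vel p)) - vel p \<bullet> (y - p) \<le> (vel y - vel p) \<bullet> (y - p)"
    using conv[of y p] by (simp add: inner_diff_right inner_diff_left)
  also have "\<dots> \<le> norm (vel y - vel p) * norm (y - p)" by (rule norm_cauchy_schwarz)
  finally show "norm (Gfun \<phi> (norm (vel y)) - Gfun \<phi> (norm (vel p)) - vel p \<bullet> (y - p)) / norm (y - p)
      \<le> norm (vel y - vel p)"
    using a \<open>y \<noteq> p\<close> by (simp add: field_simps)
qed simp

text \<open>Only positive arguments: at 0 the derivative of \<open>flux\<close> may vanish or fail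
  to exist. This is the source of the second derivative of the extremal.\<close>

lemma flux_inv_derivative:
  obtains g' where "\<And>y. y > 0 \<Longrightarrow> (flux_inv has_real_derivative g' y) (at y)" "continuous_on {0<..} g'"
proof -
  obtain g' where g': "\<And>s. s > 0 \<Longrightarrow> (flux has_real_derivative g' s) (at s)"
    "\<And>s. s > 0 \<Longrightarrow> g' s > 0" "continuous_on {0<..} g'" using flux_C1 by metis
  show ?thesis
  proof
    fix y :: real assume y: "y > 0"
    show "(flux_inv has_real_derivative inverse (g' (flux_inv y))) (at y)"
    proof (rule DERIV_inverse_function[where f=flux and a=0 and b="y+1"])
      show "(flux has_real_derivative g' (flux_inv y)) (at (flux_inv y))"
        by (rule g') (simp add: flux_inv_pos y)
      show "g' (flux_inv y) \<noteq> 0" using g'(2)[OF flux_inv_pos[OF y]] by simp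
    qed (use y isCont_flux_inv in \<open>auto simp: flux_flux_inv\<close>)
  next
    have "continuous_on {0<..} flux_inv" by (intro continuous_at_imp_continuous_on ballI isCont_flux_inv)
    then have "continuous_on {0<..} (\<lambda>y. g' (flux_inv y))"
      by (intro continuous_on_compose2[OF g'(3)]) (auto simp: flux_inv_pos)
    then show "continuous_on {0<..} (\<lambda>y. inverse (g' (flux_inv y)))"
      by (rule continuous_on_inverse) (use g'(2) flux_inv_pos in force)
  qed
qed

end

section \<open>Smooth cutoff functions\<close>

text \<open>The derivatives of exp(-1/x) of every order are combinations of these functions.\<close>

definition flat_exp :: "nat \<Rightarrow> real \<Rightarrow> real" where
  "flat_exp k x = (if x > 0 then (1 / x) ^ k * exp (- (1 / x)) else 0)"

lemma flat_exp_tendsto_0: "(flat_exp k \<longlongrightarrow> 0) (at_right 0)"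
proof -
  have "((\<lambda>x::real. inverse x ^ k / exp (inverse x)) \<longlongrightarrow> 0) (at_right 0)"
    by (rule filterlim_compose[OF tendsto_power_div_exp_0 filterlim_inverse_at_top_right])
  moreover have "\<forall>\<^sub>F x in at_right (0::real). inverse x ^ k / exp (inverse x) = flat_exp k x"
    by (auto simp: eventually_at_filter flat_exp_def exp_minus field_simps)
  ultimately show ?thesis by (rule Lim_transform_eventually)
qed

lemma flat_exp_derivative:
  "(flat_exp k has_real_derivative (flat_exp (k + 2) x - real k * flat_exp (k + 1) x)) (at x)"
proof -
  consider "x > 0" | "x < 0" | "x = 0" by linarith
  then show ?thesis
  proof cases
    case 1
    have i: "((\<lambda>x. 1 / x) has_real_derivative (- ((1 / x) ^ 2))) (at x)"
      using 1 by (auto intro!: derivative_eq_intros simp: power2_eq_square)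
    have p: "((\<lambda>x. (1 / x) ^ k) has_real_derivative (- (real k * (1 / x) ^ (k + 1)))) (at x)"
    proof (cases k)
      case (Suc n)
      show ?thesis unfolding Suc
        by (rule DERIV_power_Suc[OF i, THEN DERIV_cong]) (simp add: power2_eq_square algebra_simps)
    qed simp
    have "((\<lambda>x. exp (- (1 / x))) has_real_derivative exp (- (1 / x)) * (1 / x) ^ 2) (at x)"
      by (rule DERIV_chain2[OF DERIV_exp, THEN DERIV_cong, OF DERIV_minus[OF i]]) simp
    then have "((\<lambda>x. (1 / x) ^ k * exp (- (1 / x))) has_real_derivative
        (flat_exp (k + 2) x - real k * flat_exp (k + 1) x)) (at x)"
      by (rule DERIV_mult[OF p, THEN DERIV_cong]) (use 1 in \<open>simp add: flat_exp_def power2_eq_square algebra_simps\<close>)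
    then show ?thesis
      by (rule has_field_derivative_transform_within_open[of _ _ _ "{0<..}"]) (use 1 in \<open>auto simp: flat_exp_def\<close>)
  next
    case 2
    have "((\<lambda>x. 0) has_real_derivative (flat_exp (k + 2) x - real k * flat_exp (k + 1) x)) (at x)"
      using 2 by (simp add: flat_exp_def)
    then show ?thesis
      by (rule has_field_derivative_transform_within_open[of _ _ _ "{..<0}"]) (use 2 in \<open>auto simp: flat_exp_def\<close>)
  next
    case 3
    have "((\<lambda>h. (flat_exp k (0 + h) - flat_exp k 0) / h) \<longlongrightarrow> 0) (at 0)"
    proof (rule filterlim_split_at)
      have "\<forall>\<^sub>F h in at_left (0::real). 0 = (flat_exp k (0 + h) - flat_exp k 0) / h"
        by (auto simp: eventually_at_filter flat_exp_def)
      then show "((\<lambda>h. (flat_exp k (0 + h) - flat_exp k 0) / h) \<longlongrightarrow> 0) (at_left 0)"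
        by (rule Lim_transform_eventually[OF tendsto_const])
      \<comment> \<open>Dividing by h raises the index by one, so the right difference quotient at 0
        again tends to 0.\<close>
      have "\<forall>\<^sub>F h in at_right (0::real). flat_exp (k + 1) h = (flat_exp k (0 + h) - flat_exp k 0) / h"
        by (auto simp: eventually_at_filter flat_exp_def)
      then show "((\<lambda>h. (flat_exp k (0 + h) - flat_exp k 0) / h) \<longlongrightarrow> 0) (at_right 0)"
        by (rule Lim_transform_eventually[OF flat_exp_tendsto_0])
    qed
    then show ?thesis by (simp add: DERIV_def 3 flat_exp_def)
  qed
qed

text \<open>A space of functions supported in compact intervals that is closed under differentiation, so
  that its members are smooth.\<close>

inductive_set bump_space :: "(real \<Rightarrow> real) set" where
  base: "e > 0 \<Longrightarrow> (\<lambda>x. flat_exp i ((x - a) / e) * flat_exp j (1 - (x - a) / e)) \<in> bump_space"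
| add: "f \<in> bump_space \<Longrightarrow> g \<in> bump_space \<Longrightarrow> (\<lambda>x. f x + g x) \<in> bump_space"
| scale: "f \<in> bump_space \<Longrightarrow> (\<lambda>x. c * f x) \<in> bump_space"

lemma bump_space_derivative:
  assumes "f \<in> bump_space"
  shows "\<exists>f'\<in>bump_space. \<forall>x. (f has_real_derivative f' x) (at x)"
  using assms
proof induction
  case (base e i a j)
  let ?u = "\<lambda>i j x. flat_exp i ((x - a) / e) * flat_exp j (1 - (x - a) / e)"
  \<comment> \<open>The product rule raises one index at a time, by 1 or 2; the inner derivative
    -1/e accounts for the reversed signs of the second factor.\<close>
  let ?d = "\<lambda>x. (1/e) * (?u (i+2) j x + (- real i) * ?u (i+1) j x)
      + (1/e) * ((- 1) * ?u i (j+2) x + real j * ?u i (j+1) x)"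
  have mem: "?d \<in> bump_space"
    by (intro bump_space.intros base)
  have der: "(?u i j has_real_derivative ?d x) (at x)" for x
  proof -
    have "((\<lambda>x. flat_exp i ((x - a) / e)) has_real_derivative
        (flat_exp (i+2) ((x - a) / e) - real i * flat_exp (i+1) ((x - a) / e)) * (1/e)) (at x)"
      by (rule DERIV_chain2[OF flat_exp_derivative]) (use base in \<open>auto intro!: derivative_eq_intros\<close>)
    moreover have "((\<lambda>x. flat_exp j (1 - (x - a) / e)) has_real_derivative
        (flat_exp (j+2) (1 - (x - a) / e) - real j * flat_exp (j+1) (1 - (x - a) / e)) * (- 1/e)) (at x)"
      by (rule DERIV_chain2[OF flat_exp_derivative]) (use base in \<open>auto intro!: derivative_eq_intros\<close>)
    ultimately show ?thesis
      by (rule DERIV_mult[THEN DERIV_cong]) (use base in \<open>simp add: field_simps\<close>)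
  qed
  show ?case by (rule bexI[where x="?d"]) (use mem der in blast)+
next
  case (add f g)
  then obtain f' g' where *: "f' \<in> bump_space" "g' \<in> bump_space"
    "\<And>x. (f has_real_derivative f' x) (at x)" "\<And>x. (g has_real_derivative g' x) (at x)" by blast
  show ?case
    by (rule bexI[of _ "\<lambda>x. f' x + g' x"]) (auto intro!: DERIV_add * bump_space.add)
next
  case (scale f c)
  then obtain f' where *: "f' \<in> bump_space" "\<And>x. (f has_real_derivative f' x) (at x)" by blast
  show ?case
    by (rule bexI[of _ "\<lambda>x. c * f' x"]) (auto intro!: DERIV_cmult * bump_space.scale)
qed

lemma bump_space_smooth:
  assumes "f \<in> bump_space" shows "(deriv ^^ k) f \<in> bump_space" "(deriv ^^ k) f differentiable_on UNIV"
proof -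
  have d: "deriv f \<in> bump_space" if f: "f \<in> bump_space" for f
  proof -
    obtain f' where f': "f' \<in> bump_space" "\<And>x. (f has_real_derivative f' x) (at x)"
      using bump_space_derivative[OF f] by blast
    then have "deriv f = f'" by (auto intro: DERIV_imp_deriv)
    then show ?thesis using f' by simp
  qed
  show *: "(deriv ^^ k) f \<in> bump_space" by (induction k) (auto intro: d assms)
  show "(deriv ^^ k) f differentiable_on UNIV"
    using bump_space_derivative[OF *]
    by (auto simp: differentiable_on_def real_differentiable_def)
qed

text \<open>A smooth plateau is built as an antiderivative, of which only the derivatives are known
  to lie in \<open>bump_space\<close>.\<close>

lemma smooth_antiderivative_bump_space:
  assumes "\<And>x. (f has_real_derivative f' x) (at x)" "f' \<in> bump_space"
  shows "(deriv ^^ k) f differentiable_on UNIV"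
proof (cases k)
  case 0
  then show ?thesis using assms(1) by (auto simp: differentiable_on_def real_differentiable_def)
next
  case (Suc j)
  have "deriv f = f'" using assms(1) by (auto intro: DERIV_imp_deriv)
  then show ?thesis
    using bump_space_smooth(2)[OF assms(2), of j] unfolding Suc by (simp only: funpow_Suc_right o_apply)
qed

text \<open>\<open>\<psi>\<close> is a normalized bump on the unit interval and
  \<open>\<sigma>\<close> its primitive, a smooth step from 0 to 1.\<close>

lemma exists_bump:
  obtains \<psi> \<sigma> :: "real \<Rightarrow> real" where
    "\<And>a e. e > 0 \<Longrightarrow> (\<lambda>x. \<psi> ((x - a) / e)) \<in> bump_space"
    "\<And>x. \<psi> x \<ge> 0" "\<And>x. x \<le> 0 \<or> x \<ge> 1 \<Longrightarrow> \<psi> x = 0"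
    "\<And>x. (\<sigma> has_real_derivative \<psi> x) (at x)"
    "\<And>x. x \<le> 0 \<Longrightarrow> \<sigma> x = 0" "\<And>x. x \<ge> 1 \<Longrightarrow> \<sigma> x = 1"
proof -
  define u where "u x = flat_exp 0 x * flat_exp 0 (1 - x)" for x
  have cf: "continuous_on S (flat_exp k)" for k S
    using flat_exp_derivative DERIV_isCont by (blast intro: continuous_at_imp_continuous_on)
  have cu: "continuous_on S u" for S
    unfolding u_def by (intro continuous_intros continuous_on_compose2[OF cf[of UNIV]]) auto
  have u0: "u x \<ge> 0" for x by (simp add: u_def flat_exp_def)
  have uz: "u x = 0" if "x \<le> 0 \<or> x \<ge> 1" for x using that by (auto simp: u_def flat_exp_def)
  have ui: "u integrable_on {a..b}" for a b by (rule integrable_continuous_real[OF cu])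
  define C where "C = integral {0..1} u"
  have "C \<ge> 0" unfolding C_def by (rule integral_nonneg[OF ui u0])
  moreover have "C \<noteq> 0"
  proof
    assume "C = 0"
    then have "u (1/2) = 0"
      using integral_eq_0_iff[of 0 1 u] cu u0 unfolding C_def by auto
    then show False by (simp add: u_def flat_exp_def)
  qed
  ultimately have C: "C > 0" by simp
  define s where "s x = integral {0..x} u" for x
  have sd: "(s has_real_derivative u x) (at x)" for x
  proof -
    \<comment> \<open>A base point left of both 0 and x makes the primitive differentiable on both
      sides of x; moving it back to 0 changes nothing because u vanishes on the negative
      axis.\<close>
    define M where "M = \<bar>x\<bar> + 1"
    have "((\<lambda>y. integral {-M..y} u) has_real_derivative u x) (at x within {-M..M})"
      by (rule integral_has_real_derivative[OF cu]) (auto simp: M_def)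
    then have "((\<lambda>y. integral {-M..y} u) has_real_derivative u x) (at x within {-M<..<M})"
      by (rule DERIV_subset) auto
    then have "((\<lambda>y. integral {-M..y} u) has_real_derivative u x) (at x)"
      by (subst (asm) at_within_open) (auto simp: M_def)
    moreover have "integral {-M..y} u = s y" if y: "y \<in> {-M<..<M}" for y
    proof (cases "y \<ge> 0")
      case True
      have "integral {-M..0} u = integral {-M..0} (\<lambda>_. 0)"
        by (rule integral_cong) (use uz in auto)
      then show ?thesis
        using Henstock_Kurzweil_Integration.integral_combine[where a="-M" and c=0 and b=y and f=u] ui True by (simp add: s_def M_def)
    next
      case False
      have "integral {-M..y} u = integral {-M..y} (\<lambda>_. 0)"
        by (rule integral_cong) (use uz False in auto)
      then show ?thesis using False by (simp add: s_def)
    qed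
    moreover have "x \<in> {-M<..<M}" by (auto simp: M_def)
    ultimately show ?thesis
      by (intro has_field_derivative_transform_within_open[where f="\<lambda>y. integral {-M..y} u" and S="{-M<..<M}" and g=s]) auto
  qed
  have s1: "s x = C" if "x \<ge> 1" for x
  proof -
    have "integral {1..x} u = integral {1..x} (\<lambda>_. 0)"
      by (rule integral_cong) (use uz in auto)
    then show ?thesis
      using Henstock_Kurzweil_Integration.integral_combine[where a=0 and c=1 and b=x and f=u] ui that by (simp add: s_def C_def)
  qed
  have s0: "s x = 0" if "x \<le> 0" for x using that by (cases "x = 0") (auto simp: s_def)
  show ?thesis
  proof (rule that[of "\<lambda>x. (1/C) * u x" "\<lambda>x. (1/C) * s x"])
    show "(\<lambda>x. 1 / C * u ((x - a) / e)) \<in> bump_space" if "e > 0" for a e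
      unfolding u_def by (intro bump_space.intros that)
    show "((\<lambda>x. 1 / C * s x) has_real_derivative 1 / C * u x) (at x)" for x
      by (intro DERIV_cmult sd)
  qed (use C u0 uz s0 s1 in auto)
qed

text \<open>A smooth approximation of the indicator function of \<open>{a..b}\<close>, whose derivative is the
  difference of approximate Dirac masses at \<open>a\<close> and \<open>b\<close>.\<close>

lemma exists_cutoff:
  fixes a b e :: real
  assumes "e > 0" "2 * e \<le> b - a"
  obtains \<eta> \<eta>1 \<eta>2 where
    "\<And>I. {a..b} \<subseteq> interior I \<Longrightarrow> \<eta> \<in> test_functions I"
    "\<And>t. (\<eta> has_real_derivative \<eta>1 t - \<eta>2 t) (at t)"
    "\<And>S. continuous_on S \<eta>1" "\<And>S. continuous_on S \<eta>2" "\<And>t. \<eta>1 t \<ge> 0" "\<And>t. \<eta>2 t \<ge> 0"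
    "\<And>t. \<eta>1 t \<noteq> 0 \<Longrightarrow> a \<le> t \<and> t \<le> a + e" "\<And>t. \<eta>2 t \<noteq> 0 \<Longrightarrow> b - e \<le> t \<and> t \<le> b"
    "(\<eta>1 has_integral 1) {a..b}" "(\<eta>2 has_integral 1) {a..b}"
    "\<And>t. \<bar>\<eta> t\<bar> \<le> 1" "\<And>t. a + e \<le> t \<Longrightarrow> t \<le> b - e \<Longrightarrow> \<eta> t = 1"
    "\<And>t. t \<notin> {a..b} \<Longrightarrow> \<eta> t = 0"
proof -
  obtain \<psi> \<sigma> :: "real \<Rightarrow> real" where psi:
    "\<And>a e. e > 0 \<Longrightarrow> (\<lambda>x. \<psi> ((x - a) / e)) \<in> bump_space"
    "\<And>x. \<psi> x \<ge> 0" "\<And>x. x \<le> 0 \<or> x \<ge> 1 \<Longrightarrow> \<psi> x = 0"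
    "\<And>x. (\<sigma> has_real_derivative \<psi> x) (at x)"
    "\<And>x. x \<le> 0 \<Longrightarrow> \<sigma> x = 0" "\<And>x. x \<ge> 1 \<Longrightarrow> \<sigma> x = 1"
    by (rule exists_bump) blast
  have sm: "\<sigma> x \<le> \<sigma> y" if "x \<le> y" for x y
    by (rule DERIV_nonneg_imp_nondecreasing[OF that]) (use psi in blast)
  have s01: "0 \<le> \<sigma> x" "\<sigma> x \<le> 1" for x
    using sm[of 0 x] sm[of x 1] psi(5)[of x] psi(5)[of 0] psi(6)[of x] psi(6)[of 1] by linarith+
  define f1 where "f1 a t = \<psi> ((t - a) / e) / e" for a t
  have d: "((\<lambda>t. \<sigma> ((t - a) / e)) has_real_derivative f1 a t) (at t)" for a t
    unfolding f1_def
    by (rule DERIV_chain2[OF psi(4), THEN DERIV_cong]) (use assms in \<open>auto intro!: derivative_eq_intros\<close>)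
  have bs: "f1 a \<in> bump_space" for a
    using bump_space.scale[OF psi(1)[OF assms(1)], of "1/e" a] by (simp add: f1_def[abs_def])
  have c: "continuous_on S (f1 a)" for S a
    using bump_space_derivative[OF bs[of a]] DERIV_isCont by (blast intro: continuous_at_imp_continuous_on)
  have nz: "a \<le> t \<and> t \<le> a + e" if "f1 a t \<noteq> 0" for a t
    using that psi(3)[of "(t - a) / e"] assms(1) by (force simp: f1_def field_simps)
  \<comment> \<open>The difference of a step rising on [a, a + e] and one rising on [b - e, b]; the
    hypothesis 2 e \<le> b - a keeps the two ramps apart.\<close>
  define \<eta> where "\<eta> t = \<sigma> ((t - a) / e) - \<sigma> ((t - (b - e)) / e)" for t
  have dn: "(\<eta> has_real_derivative f1 a t - f1 (b - e) t) (at t)" for t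
    unfolding \<eta>_def by (intro DERIV_diff d)
  have bs2: "(\<lambda>t. f1 a t - f1 (b - e) t) \<in> bump_space"
    using bump_space.add[OF bs[of a] bump_space.scale[OF bs[of "b - e"], of "-1"]] by simp
  have z: "\<eta> t = 0" if "t \<notin> {a..b}" for t
  proof -
    have "t < a \<or> b < t" using that by auto
    then show ?thesis
    proof
      assume "t < a"
      then have "(t - a) / e \<le> 0" "(t - (b - e)) / e \<le> 0" using assms by (auto simp: field_simps)
      then show ?thesis using psi(5) by (simp add: \<eta>_def)
    next
      assume "b < t"
      then have "(t - a) / e \<ge> 1" "(t - (b - e)) / e \<ge> 1" using assms by (auto simp: field_simps)
      then show ?thesis using psi(6) by (simp add: \<eta>_def)
    qed
  qed
  show ?thesis
  proof (rule that[of \<eta> "f1 a" "f1 (b - e)"])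
    show "\<eta> \<in> test_functions I" if "{a..b} \<subseteq> interior I" for I
    proof -
      have sub: "closure {t. \<eta> t \<noteq> 0} \<subseteq> {a..b}" by (rule closure_minimal) (use z in blast, simp)
      have "bounded {t. \<eta> t \<noteq> 0}" by (rule bounded_subset[OF bounded_closed_interval[of a b]]) (use z in blast)
      then have "compact (closure {t. \<eta> t \<noteq> 0})" by simp
      then show ?thesis
        using smooth_antiderivative_bump_space[OF dn bs2] sub that by (auto simp: test_functions_def)
    qed
    show "(\<eta> has_real_derivative f1 a t - f1 (b - e) t) (at t)" for t by (rule dn)
    have "(f1 a has_integral \<sigma> ((b - a) / e) - \<sigma> ((a - a) / e)) {a..b}"
      by (rule fundamental_theorem_of_calculus)
        (use assms d in \<open>auto simp: has_real_derivative_iff_has_vector_derivative intro: has_vector_derivative_at_within\<close>)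
    moreover have "\<sigma> ((b - a) / e) = 1" by (rule psi(6)) (use assms in \<open>auto simp: field_simps\<close>)
    ultimately show "(f1 a has_integral 1) {a..b}" using psi(5)[of 0] by simp
    have "(f1 (b-e) has_integral \<sigma> ((b - (b-e)) / e) - \<sigma> ((a - (b-e)) / e)) {a..b}"
      by (rule fundamental_theorem_of_calculus)
        (use assms d in \<open>auto simp: has_real_derivative_iff_has_vector_derivative intro: has_vector_derivative_at_within\<close>)
    moreover have "\<sigma> ((a - (b - e)) / e) = 0" by (rule psi(5)) (use assms in \<open>auto simp: field_simps\<close>)
    ultimately show "(f1 (b-e) has_integral 1) {a..b}" using psi(6)[of 1] assms by simp
    show "\<bar>\<eta> t\<bar> \<le> 1" for t
      using s01[of "(t - a) / e"] s01[of "(t - (b - e)) / e"] by (simp add: \<eta>_def)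
    show "\<eta> t = 1" if "a + e \<le> t" "t \<le> b - e" for t
    proof -
      have "(t - a) / e \<ge> 1" "(t - (b - e)) / e \<le> 0" using assms that by (auto simp: field_simps)
      then show ?thesis using psi(5,6) by (simp add: \<eta>_def)
    qed
    show "b - e \<le> t \<and> t \<le> b" if "f1 (b - e) t \<noteq> 0" for t using nz[OF that] by simp
  qed (use c nz z assms psi(2) in \<open>auto simp: f1_def\<close>)
qed

section \<open>Weak derivatives\<close>

lemma continuous_set_integrable_lebesgue:
  fixes f :: "real \<Rightarrow> 'a::euclidean_space"
  assumes "compact K" "continuous_on K f"
  shows "set_integrable lebesgue K f"
  using borel_integrable_compact[OF assms]
  by (simp add: set_integrable_def indicator_scaleR_eq_if integrable_completion borel_measurable_integrable)

lemma set_integral_zero_outside: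
  fixes f :: "'a \<Rightarrow> 'b::{banach, second_countable_topology}"
  assumes "\<And>t. t \<notin> S \<Longrightarrow> f t = 0" "S \<subseteq> I"
  shows "(LINT t:I|M. f t) = (LINT t:S|M. f t)"
proof -
  have "indicator I t *\<^sub>R f t = (indicator S t :: real) *\<^sub>R f t" for t
    using assms by (cases "t \<in> S") auto
  then show ?thesis
    unfolding set_lebesgue_integral_def by (intro Bochner_Integration.integral_cong refl)
qed

text \<open>As w has mass 1, the difference is the integral of w (q - v), to which only points with
  w nonzero contribute.\<close>

lemma approximate_Dirac:
  fixes q :: "real \<Rightarrow> 'a::euclidean_space"
  assumes q: "continuous_on {a..b} q" and w: "continuous_on {a..b} w" "\<And>t. w t \<ge> 0"
    and i: "(w has_integral 1) {a..b}" and near: "\<And>t. t \<in> {a..b} \<Longrightarrow> w t \<noteq> 0 \<Longrightarrow> norm (q t - v) \<le> K"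
  shows "norm (integral {a..b} (\<lambda>t. w t *\<^sub>R q t) - v) \<le> K"
proof -
  have "((\<lambda>t. w t *\<^sub>R v) has_integral 1 *\<^sub>R v) {a..b}" by (rule has_integral_scaleR_left[OF i])
  moreover have wi: "(\<lambda>t. w t *\<^sub>R q t) integrable_on {a..b}"
    by (intro integrable_continuous_real continuous_intros q w)
  ultimately have "((\<lambda>t. w t *\<^sub>R q t - w t *\<^sub>R v) has_integral integral {a..b} (\<lambda>t. w t *\<^sub>R q t) - v) {a..b}"
    using has_integral_diff[OF integrable_integral[OF wi]] by fastforce
  then have e: "integral {a..b} (\<lambda>t. w t *\<^sub>R q t) - v = integral {a..b} (\<lambda>t. w t *\<^sub>R (q t - v))"
    by (simp add: scaleR_diff_right integral_unique)
  have "norm (integral {a..b} (\<lambda>t. w t *\<^sub>R (q t - v))) \<le> integral {a..b} (\<lambda>t. w t * K)"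
  proof (rule integral_norm_bound_integral)
    show "(\<lambda>t. w t *\<^sub>R (q t - v)) integrable_on {a..b}" "(\<lambda>t. w t * K) integrable_on {a..b}"
      by (intro integrable_continuous_real continuous_intros q w)+
    fix t assume "t \<in> {a..b}"
    then show "norm (w t *\<^sub>R (q t - v)) \<le> w t * K"
      using near[of t] w(2)[of t] by (cases "w t = 0") (auto intro: mult_left_mono)
  qed
  also have "integral {a..b} (\<lambda>t. w t * K) = K" using integral_unique[OF has_integral_mult_left[OF i, of K]] by simp
  finally show ?thesis using e by simp
qed

text \<open>Test the weak derivative against smooth approximations of the indicator of \<open>{a..b}\<close>.\<close>

lemma weak_derivative_increment:
  fixes q g :: "real \<Rightarrow> 'a::euclidean_space"
  assumes wd: "has_weak_derivative I q g" and ab: "a < b" "{a..b} \<subseteq> interior I"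
    and q: "continuous_on {a..b} q"
  shows "set_integrable lebesgue {a..b} g" "(LINT t:{a..b}|lebesgue. g t) = q b - q a"
proof -
  show gi: "set_integrable lebesgue {a..b} g"
    using wd ab by (auto simp: has_weak_derivative_def L1_loc_def)
  define e where "e n = (b - a) / (2 * (real n + 1))" for n :: nat
  have e: "e n > 0" "2 * e n \<le> b - a" for n
    using ab mult_right_mono[of a b "real n"] by (auto simp: e_def field_simps)
  have e0: "e \<longlonglongrightarrow> 0" unfolding e_def by real_asymp
  have "\<forall>n. \<exists>\<eta> \<eta>1 \<eta>2. \<eta> \<in> test_functions I \<and>
    (\<forall>t. (\<eta> has_real_derivative \<eta>1 t - \<eta>2 t) (at t)) \<and>
    continuous_on {a..b} \<eta>1 \<and> continuous_on {a..b} \<eta>2 \<and> (\<forall>t. \<eta>1 t \<ge> 0) \<and> (\<forall>t. \<eta>2 t \<ge> 0) \<and>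
    (\<forall>t. \<eta>1 t \<noteq> 0 \<longrightarrow> a \<le> t \<and> t \<le> a + e n) \<and> (\<forall>t. \<eta>2 t \<noteq> 0 \<longrightarrow> b - e n \<le> t \<and> t \<le> b) \<and>
    (\<eta>1 has_integral 1) {a..b} \<and> (\<eta>2 has_integral 1) {a..b} \<and>
    (\<forall>t. \<bar>\<eta> t\<bar> \<le> 1) \<and> (\<forall>t. a + e n \<le> t \<and> t \<le> b - e n \<longrightarrow> \<eta> t = 1) \<and>
    (\<forall>t. t \<notin> {a..b} \<longrightarrow> \<eta> t = 0)" (is "\<forall>n. ?P n")
  proof
    fix n show "?P n"
      by (rule exists_cutoff[OF e(1)[of n] e(2)[of n]]) (use ab in blast)
  qed
  then obtain \<eta> \<eta>1 \<eta>2 where eta: "\<And>n. \<eta> n \<in> test_functions I"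
    "\<And>n t. (\<eta> n has_real_derivative \<eta>1 n t - \<eta>2 n t) (at t)"
    "\<And>n. continuous_on {a..b} (\<eta>1 n)" "\<And>n. continuous_on {a..b} (\<eta>2 n)"
    "\<And>n t. \<eta>1 n t \<ge> 0" "\<And>n t. \<eta>2 n t \<ge> 0"
    "\<And>n t. \<eta>1 n t \<noteq> 0 \<Longrightarrow> a \<le> t \<and> t \<le> a + e n" "\<And>n t. \<eta>2 n t \<noteq> 0 \<Longrightarrow> b - e n \<le> t \<and> t \<le> b"
    "\<And>n. (\<eta>1 n has_integral 1) {a..b}" "\<And>n. (\<eta>2 n has_integral 1) {a..b}"
    "\<And>n t. \<bar>\<eta> n t\<bar> \<le> 1" "\<And>n t. a + e n \<le> t \<Longrightarrow> t \<le> b - e n \<Longrightarrow> \<eta> n t = 1"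
    "\<And>n t. t \<notin> {a..b} \<Longrightarrow> \<eta> n t = 0"
    by metis
  define L where "L n = (LINT t:I|lebesgue. deriv (\<eta> n) t *\<^sub>R q t)" for n
  define R where "R n = (LINT t:I|lebesgue. \<eta> n t *\<^sub>R g t)" for n
  have LR: "L n = - R n" for n
    using wd eta(1)[of n] by (auto simp: has_weak_derivative_def L_def R_def)
  have sub: "{a..b} \<subseteq> I" using ab interior_subset by blast
  \<comment> \<open>Dominated convergence with bound |g|: the cutoffs tend to 1 inside the interval,
    and its two end points form a null set.\<close>
  have "R \<longlonglongrightarrow> (LINT t:{a..b}|lebesgue. g t)"
  proof -
    have R: "R n = (LINT t|lebesgue. indicator {a..b} t *\<^sub>R (\<eta> n t *\<^sub>R g t))" for n
      unfolding R_def by (subst set_integral_zero_outside[of "{a..b}"]) (use eta(13) sub in \<open>auto simp: set_lebesgue_integral_def\<close>)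
    have gi': "integrable lebesgue (\<lambda>t. indicator {a..b} t *\<^sub>R g t)" using gi by (simp add: set_integrable_def)
    show ?thesis unfolding R set_lebesgue_integral_def
    proof (rule integral_dominated_convergence[where w="\<lambda>t. norm (indicator {a..b} t *\<^sub>R g t)"])
      show "(\<lambda>t. indicator {a..b} t *\<^sub>R g t) \<in> borel_measurable lebesgue" using gi' by auto
      show "integrable lebesgue (\<lambda>t. norm (indicat_real {a..b} t *\<^sub>R g t))" by (rule integrable_norm[OF gi'])
      have "continuous_on UNIV (\<eta> n)" for n
        by (intro continuous_at_imp_continuous_on ballI DERIV_isCont[OF eta(2)])
      then have "\<eta> n \<in> borel_measurable lebesgue" for n
        by (intro measurable_completion) (simp add: borel_measurable_continuous_onI)
      then have "(\<lambda>t. \<eta> n t *\<^sub>R (indicator {a..b} t *\<^sub>R g t)) \<in> borel_measurable lebesgue" for n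
        by (rule borel_measurable_scaleR[OF _ borel_measurable_integrable[OF gi']])
      then show "(\<lambda>t. indicator {a..b} t *\<^sub>R (\<eta> n t *\<^sub>R g t)) \<in> borel_measurable lebesgue" for n
        by (simp add: mult.commute)
      show "AE t in lebesgue. norm (indicat_real {a..b} t *\<^sub>R \<eta> n t *\<^sub>R g t) \<le> norm (indicat_real {a..b} t *\<^sub>R g t)" for n
        using eta(11)[of n] by (auto simp: indicator_def intro!: mult_left_le_one_le AE_I2)
      have "AE t in lebesgue. t \<notin> {a, b}"
        by (rule AE_not_in) (simp add: negligible_iff_null_sets[symmetric])
      then show "AE t in lebesgue. (\<lambda>n. indicat_real {a..b} t *\<^sub>R \<eta> n t *\<^sub>R g t) \<longlonglongrightarrow> indicat_real {a..b} t *\<^sub>R g t"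
      proof eventually_elim
        fix t assume t: "t \<notin> {a, b}"
        show "(\<lambda>n. indicat_real {a..b} t *\<^sub>R \<eta> n t *\<^sub>R g t) \<longlonglongrightarrow> indicat_real {a..b} t *\<^sub>R g t"
        proof (cases "t \<in> {a..b}")
          case True
          then have "min (t - a) (b - t) > 0" using t by auto
          then have "\<forall>\<^sub>F n in sequentially. e n < min (t - a) (b - t)"
            using order_tendstoD(2)[OF e0] by blast
          then have "\<forall>\<^sub>F n in sequentially. indicat_real {a..b} t *\<^sub>R g t = indicat_real {a..b} t *\<^sub>R \<eta> n t *\<^sub>R g t"
            by eventually_elim (use True eta(12) in auto)
          then show ?thesis by (rule Lim_transform_eventually[OF tendsto_const])
        qed simp
      qed
    qed
  qed
  then have "L \<longlonglongrightarrow> - (LINT t:{a..b}|lebesgue. g t)" unfolding LR by (rule tendsto_minus)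
  \<comment> \<open>The derivatives of the cutoffs concentrate at a with mass 1 and at b with mass
    -1.\<close>
  moreover have "L \<longlonglongrightarrow> q a - q b"
  proof -
    have L: "L n = integral {a..b} (\<lambda>t. \<eta>1 n t *\<^sub>R q t) - integral {a..b} (\<lambda>t. \<eta>2 n t *\<^sub>R q t)" for n
    proof -
      have d: "deriv (\<eta> n) t = \<eta>1 n t - \<eta>2 n t" for t using eta(2) DERIV_imp_deriv by blast
      have z: "\<eta>1 n t = 0 \<and> \<eta>2 n t = 0" if "t \<notin> {a..b}" for t
        using eta(7)[of n t] eta(8)[of n t] e[of n] that by force
      have c: "continuous_on {a..b} (\<lambda>t. (\<eta>1 n t - \<eta>2 n t) *\<^sub>R q t)"
        by (intro continuous_intros eta(3,4) q)
      have "L n = (LINT t:{a..b}|lebesgue. (\<eta>1 n t - \<eta>2 n t) *\<^sub>R q t)"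
        unfolding L_def d by (rule set_integral_zero_outside) (use z sub in auto)
      also have "\<dots> = integral {a..b} (\<lambda>t. (\<eta>1 n t - \<eta>2 n t) *\<^sub>R q t)"
        by (rule set_lebesgue_integral_eq_integral[OF continuous_set_integrable_lebesgue[OF compact_Icc c]])
      also have "\<dots> = integral {a..b} (\<lambda>t. \<eta>1 n t *\<^sub>R q t) - integral {a..b} (\<lambda>t. \<eta>2 n t *\<^sub>R q t)"
        unfolding scaleR_diff_left
        by (intro integral_diff integrable_continuous_real continuous_intros eta(3,4) q)
      finally show ?thesis .
    qed
    have lim: "(\<lambda>n. integral {a..b} (\<lambda>t. w n t *\<^sub>R q t)) \<longlonglongrightarrow> q x"
      if w: "\<And>n. continuous_on {a..b} (w n)" "\<And>n t. w n t \<ge> 0" "\<And>n. (w n has_integral 1) {a..b}"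
        "\<And>n t. w n t \<noteq> 0 \<Longrightarrow> \<bar>t - x\<bar> \<le> e n" and x: "x \<in> {a..b}" for x and w :: "nat \<Rightarrow> real \<Rightarrow> real"
    proof (rule LIMSEQ_I)
      fix r :: real assume "r > 0"
      then obtain d where d: "d > 0" "\<And>t. t \<in> {a..b} \<Longrightarrow> \<bar>t - x\<bar> < d \<Longrightarrow> norm (q t - q x) < r / 2"
        using q x unfolding continuous_on_iff dist_norm real_norm_def by (metis half_gt_zero)
      obtain n0 where n0: "\<And>n. n \<ge> n0 \<Longrightarrow> e n < d"
        using order_tendstoD(2)[OF e0 d(1)] by (auto simp: eventually_sequentially)
      show "\<exists>no. \<forall>n\<ge>no. norm (integral {a..b} (\<lambda>t. w n t *\<^sub>R q t) - q x) < r"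
      proof (intro exI allI impI)
        fix n assume "n \<ge> n0"
        have "norm (integral {a..b} (\<lambda>t. w n t *\<^sub>R q t) - q x) \<le> r / 2"
          by (rule approximate_Dirac[OF q w(1-3)]) (use w(4) d(2) n0[OF \<open>n \<ge> n0\<close>] in force)
        then show "norm (integral {a..b} (\<lambda>t. w n t *\<^sub>R q t) - q x) < r" using \<open>r > 0\<close> by simp
      qed
    qed
    show ?thesis unfolding L
      by (intro tendsto_diff lim eta(3-6,9,10)) (use eta(7,8) ab in force)+
  qed
  ultimately have "- (LINT t:{a..b}|lebesgue. g t) = q a - q b" by (rule LIMSEQ_unique)
  then show "(LINT t:{a..b}|lebesgue. g t) = q b - q a" by (metis minus_diff_eq minus_minus)
qed

lemma sigma_finite_lebesgue: "sigma_finite_measure (lebesgue :: real measure)"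
proof
  obtain A :: "real set set" where A: "countable A" "A \<subseteq> sets lborel" "\<Union> A = space lborel"
    "\<forall>a\<in>A. emeasure lborel a \<noteq> \<infinity>"
    using lborel.sigma_finite_countable by blast
  then show "\<exists>A. countable A \<and> A \<subseteq> sets lebesgue \<and> \<Union> A = space (lebesgue :: real measure) \<and>
      (\<forall>a\<in>A. emeasure lebesgue a \<noteq> \<infinity>)"
    by (intro exI[of _ A]) (auto intro: sets_completionI_sets)
qed

text \<open>The Borel sets over which f integrates to 0 form a Dynkin system containing the
  intervals and, by the support condition, the whole line; so they are all Borel sets. A Lebesgue
  set differs from a Borel set only by a null set.\<close>

lemma AE_zero_of_interval_integrals:
  fixes f :: "real \<Rightarrow> 'a::euclidean_space"
  assumes f: "integrable lebesgue f" and z: "\<And>x y. (LINT t:{x..y}|lebesgue. f t) = 0"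
    and supp: "\<And>t. t \<notin> {a..b} \<Longrightarrow> f t = 0"
  shows "AE t in lebesgue. f t = 0"
proof -
  have si: "set_integrable lebesgue A f" if "A \<in> sets lebesgue" for A
    using integrable_mult_indicator[OF that f] by (simp add: set_integrable_def)
  have bor: "A \<in> sets lebesgue" if "A \<in> sets borel" for A :: "real set"
    using that by (simp add: sets_completionI_sets)
  have tot: "(LINT t:UNIV|lebesgue. f t) = 0"
    by (subst set_integral_zero_outside[of "{a..b}"]) (use supp z in auto)
  have B: "A \<in> sets borel \<and> (LINT t:A|lebesgue. f t) = 0"
    if "A \<in> sigma_sets UNIV (range (\<lambda>(x, y). {x..y}))" for A
  proof (rule sigma_sets_induct_disjoint[OF _ _ that])
    show "Int_stable (range (\<lambda>(x, y). {x..y::real}))"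
      by (auto simp: Int_stable_def)
    show "range (\<lambda>(x, y). {x..y::real}) \<subseteq> Pow UNIV" by simp
    show "A \<in> sets borel \<and> (LINT t:A|lebesgue. f t) = 0" if "A \<in> range (\<lambda>(x, y). {x..y})" for A
      using that z by auto
    show "{} \<in> sets borel \<and> (LINT t:{}|lebesgue. f t) = 0" by (simp add: set_lebesgue_integral_def)
    fix A assume "A \<in> sigma_sets UNIV (range (\<lambda>(x, y). {x..y}))" and A: "A \<in> sets borel \<and> (LINT t:A|lebesgue. f t) = 0"
    have "UNIV - A \<in> sets borel" using A by (simp add: Diff_UNIV borel_comp Compl_eq_Diff_UNIV[symmetric])
    moreover have "(LINT t:A \<union> (UNIV - A)|lebesgue. f t) = (LINT t:A|lebesgue. f t) + (LINT t:UNIV - A|lebesgue. f t)"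
      by (rule set_integral_Un) (use A calculation in \<open>auto intro!: si bor\<close>)
    ultimately show "UNIV - A \<in> sets borel \<and> (LINT t:UNIV - A|lebesgue. f t) = 0"
      using A tot by simp
  next
    fix A :: "nat \<Rightarrow> real set"
    assume dj: "disjoint_family A" and A: "\<And>i. A i \<in> sets borel \<and> (LINT t:A i|lebesgue. f t) = 0"
    have "(LINT t:(\<Union>i. A i)|lebesgue. f t) = (\<Sum>i. LINT t:A i|lebesgue. f t)"
      by (rule lebesgue_integral_countable_add)
        (use A dj in \<open>auto intro!: si bor simp: disjoint_family_on_def\<close>)
    then show "\<Union> (range A) \<in> sets borel \<and> (LINT t:\<Union> (range A)|lebesgue. f t) = 0"
      using A by auto
  qed
  have *: "(LINT t:A|lebesgue. f t) = 0" if "A \<in> sets borel" for A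
    using B that unfolding borel_eq_atLeastAtMost by simp
  show ?thesis
  proof (rule sigma_finite_measure.density_zero[OF sigma_finite_lebesgue f])
    fix A :: "real set" assume A: "A \<in> sets lebesgue"
    then obtain S N N' where S: "A = S \<union> N" "N \<subseteq> N'" "N' \<in> null_sets lborel" "S \<in> sets lborel"
      by (auto elim: sets_completionE)
    have "N' \<in> null_sets lebesgue" using S(3) by (rule null_sets_completionI)
    then have ae: "AE t in lebesgue. t \<notin> N'" by (rule AE_not_in)
    have mS: "S \<in> sets lebesgue" using S(4) bor by simp
    have "(LINT t:A|lebesgue. f t) = (LINT t:S|lebesgue. f t)"
      unfolding set_lebesgue_integral_def
    proof (rule integral_cong_AE)
      show "(\<lambda>x. indicat_real A x *\<^sub>R f x) \<in> borel_measurable lebesgue"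
        "(\<lambda>x. indicat_real S x *\<^sub>R f x) \<in> borel_measurable lebesgue"
        using si[OF A] si[OF mS] by (auto simp: set_integrable_def)
      show "AE x in lebesgue. indicat_real A x *\<^sub>R f x = indicat_real S x *\<^sub>R f x"
        using ae by eventually_elim (use S in \<open>auto simp: indicator_def\<close>)
    qed
    then show "set_lebesgue_integral lebesgue A f = 0" using * S(4) by simp
  qed
qed

lemma AE_eq_of_interval_integrals:
  fixes g1 g2 :: "real \<Rightarrow> 'a::euclidean_space"
  assumes J: "open J"
    and g: "\<And>a b. a < b \<Longrightarrow> {a..b} \<subseteq> J \<Longrightarrow> set_integrable lebesgue {a..b} g1"
      "\<And>a b. a < b \<Longrightarrow> {a..b} \<subseteq> J \<Longrightarrow> set_integrable lebesgue {a..b} g2"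
    and eq: "\<And>a b. a < b \<Longrightarrow> {a..b} \<subseteq> J \<Longrightarrow> (LINT t:{a..b}|lebesgue. g1 t) = (LINT t:{a..b}|lebesgue. g2 t)"
  shows "AE t in lebesgue. t \<in> J \<longrightarrow> g1 t = g2 t"
proof -
  have one: "AE t in lebesgue. t \<in> {a..b} \<longrightarrow> g1 t = g2 t" if ab: "a < b" "{a..b} \<subseteq> J" for a b
  proof -
    define f where "f t = indicat_real {a..b} t *\<^sub>R (g1 t - g2 t)" for t
    have sd: "set_integrable lebesgue {a..b} (\<lambda>t. g1 t - g2 t)"
      by (rule set_integral_diff(1)[OF g(1)[OF ab] g(2)[OF ab]])
    have "AE t in lebesgue. f t = 0"
    proof (rule AE_zero_of_interval_integrals[where a=a and b=b])
      show "integrable lebesgue f" using sd by (simp add: set_integrable_def f_def[abs_def])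
      show "f t = 0" if "t \<notin> {a..b}" for t using that by (simp add: f_def)
      fix x y
      have e: "(LINT t:{x..y}|lebesgue. f t) = (LINT t:{max a x..min b y}|lebesgue. g1 t - g2 t)"
        unfolding set_lebesgue_integral_def f_def
        by (intro Bochner_Integration.integral_cong refl) (auto simp: indicator_def)
      show "(LINT t:{x..y}|lebesgue. f t) = 0"
      proof (cases "max a x < min b y")
        case True
        then have s: "{max a x..min b y} \<subseteq> J" using ab by auto
        show ?thesis unfolding e
          using set_integral_diff(2)[OF g(1)[OF True s] g(2)[OF True s]] eq[OF True s] by simp
      next
        case False
        then have "{max a x..min b y} \<subseteq> {max a x}" by auto
        then have "negligible {max a x..min b y}" by (rule negligible_subset[OF negligible_sing])
        then have n: "{max a x..min b y} \<in> null_sets lebesgue" by (simp add: negligible_iff_null_sets)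
        show ?thesis unfolding e unfolding set_lebesgue_integral_def
          by (rule integral_eq_zero_AE) (use AE_not_in[OF n] in eventually_elim, simp)
      qed
    qed
    then show ?thesis by eventually_elim (auto simp: f_def)
  qed
  \<comment> \<open>Rational end points keep the number of exceptional null sets countable; every
    point of the open set J lies in such an interval.\<close>
  have "AE t in lebesgue. \<forall>a b::rat. of_rat a < (of_rat b::real) \<and> {of_rat a..of_rat b} \<subseteq> J \<longrightarrow>
      t \<in> {of_rat a..of_rat b} \<longrightarrow> g1 t = g2 t"
    unfolding AE_all_countable
  proof (intro allI)
    fix a b :: rat
    show "AE t in lebesgue. of_rat a < (of_rat b::real) \<and> {of_rat a..of_rat b} \<subseteq> J \<longrightarrow>
      t \<in> {of_rat a..of_rat b} \<longrightarrow> g1 t = g2 t"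
      using one[of "of_rat a" "of_rat b"]
      by (cases "of_rat a < (of_rat b::real) \<and> {of_rat a..of_rat b} \<subseteq> J") auto
  qed
  then show ?thesis
  proof eventually_elim
    fix t :: real
    assume *: "\<forall>a b::rat. of_rat a < (of_rat b::real) \<and> {of_rat a..of_rat b} \<subseteq> J \<longrightarrow>
      t \<in> {of_rat a..of_rat b} \<longrightarrow> g1 t = g2 t"
    show "t \<in> J \<longrightarrow> g1 t = g2 t"
    proof
      assume "t \<in> J"
      then obtain d where d: "d > 0" "ball t d \<subseteq> J" using J open_contains_ball by blast
      obtain a b where ab: "t - d < of_rat a" "of_rat a < t" "t < of_rat b" "of_rat b < t + d"
        using of_rat_dense[of "t - d" t] of_rat_dense[of t "t + d"] d(1) by auto
      have "{of_rat a..of_rat b} \<subseteq> J"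
        using d(2) ab by (force simp: ball_def dist_real_def)
      then show "g1 t = g2 t" using * ab by (meson atLeastAtMost_iff less_imp_le less_trans)
    qed
  qed
qed

text \<open>Both functions have the increments of q as integrals over compact intervals. Hence the
  arbitrary choice in \<open>weak_derivative\<close> does not affect the action.\<close>

lemma weak_derivative_unique:
  fixes q :: "real \<Rightarrow> 'a::euclidean_space"
  assumes "has_weak_derivative I q g1" "has_weak_derivative I q g2" "continuous_on (interior I) q"
  shows "AE t in lebesgue. t \<in> interior I \<longrightarrow> g1 t = g2 t"
  by (rule AE_eq_of_interval_integrals)
    (use weak_derivative_increment assms continuous_on_subset in \<open>metis open_interior\<close>)+

lemma continuous_in_L1_loc:
  fixes q :: "real \<Rightarrow> 'a::euclidean_space"
  assumes "continuous_on UNIV q" shows "q \<in> L1_loc I"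
  using continuous_set_integrable_lebesgue continuous_on_subset[OF assms] by (auto simp: L1_loc_def)

lemma continuous_on_Icc_bounded:
  fixes q :: "real \<Rightarrow> 'a::real_normed_vector"
  assumes "continuous_on UNIV q"
  obtains C where "\<And>t. t \<in> {a..b} \<Longrightarrow> norm (q t) \<le> C"
proof -
  have "bounded (q ` {a..b})"
    by (intro compact_imp_bounded compact_continuous_image continuous_on_subset[OF assms] compact_Icc) auto
  then obtain C where "\<forall>x\<in>q ` {a..b}. norm x \<le> C" unfolding bounded_iff by blast
  then show ?thesis by (intro that[of C]) blast
qed

lemma deriv_zero_outside_support:
  fixes \<eta> :: "real \<Rightarrow> real"
  assumes "t \<notin> closure {t. \<eta> t \<noteq> 0}" shows "deriv \<eta> t = 0"
proof -
  have "((\<lambda>_. 0) has_real_derivative 0) (at t)" by simp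
  then have "(\<eta> has_real_derivative 0) (at t)"
  proof (rule has_field_derivative_transform_within_open[where S="- closure {t. \<eta> t \<noteq> 0}"])
    show "0 = \<eta> x" if "x \<in> - closure {t. \<eta> t \<noteq> 0}" for x
      using that closure_subset[of "{t. \<eta> t \<noteq> 0}"] by auto
  qed (use assms in auto)
  then show ?thesis by (rule DERIV_imp_deriv)
qed

text \<open>A test function has compact support, so the weak derivatives on the intervals \<open>{-n..n}\<close>, which
  agree almost everywhere on common domains, combine into a global one.\<close>

lemma weak_derivative_glue:
  fixes q :: "real \<Rightarrow> 'a::euclidean_space"
  assumes q: "continuous_on UNIV q"
    and G: "\<And>n::nat. has_weak_derivative {-real n..real n} q (G n)"
  shows "\<exists>g. has_weak_derivative UNIV q g"
proof -
  \<comment> \<open>The index exceeds |t| strictly, so t is interior to the interval from which the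
    value is taken.\<close>
  define g where "g t = G (nat \<lceil>\<bar>t\<bar>\<rceil> + 1) t" for t
  have int: "interior {-real n..real n} = {-real n<..<real n}" for n by simp
  have ae1: "AE t in lebesgue. \<bar>t\<bar> < real k \<and> \<bar>t\<bar> < real n \<longrightarrow> G k t = G n t" for k n
  proof -
    have "AE t in lebesgue. t \<in> {-real (min k n)<..<real (min k n)} \<longrightarrow> G k t = G n t"
    proof (rule AE_eq_of_interval_integrals)
      fix a b :: real assume ab: "a < b" "{a..b} \<subseteq> {- real (min k n)<..<real (min k n)}"
      then have s: "{a..b} \<subseteq> interior {-real k..real k}" "{a..b} \<subseteq> interior {-real n..real n}"
        by (auto simp: subset_iff)
      have c: "continuous_on {a..b} q" using q continuous_on_subset by blast
      note k = weak_derivative_increment[OF G[of k] ab(1) s(1) c]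
      note n = weak_derivative_increment[OF G[of n] ab(1) s(2) c]
      show "set_integrable lebesgue {a..b} (G k)" "set_integrable lebesgue {a..b} (G n)"
        "(LINT t:{a..b}|lebesgue. G k t) = (LINT t:{a..b}|lebesgue. G n t)"
        using k n by simp_all
    qed auto
    then show ?thesis by eventually_elim auto
  qed
  then have "AE t in lebesgue. \<forall>k n. \<bar>t\<bar> < real k \<and> \<bar>t\<bar> < real n \<longrightarrow> G k t = G n t"
    unfolding AE_all_countable by blast
  then have ae: "AE t in lebesgue. \<forall>n. \<bar>t\<bar> < real n \<longrightarrow> g t = G n t"
  proof eventually_elim
    fix t assume *: "\<forall>k n. \<bar>t\<bar> < real k \<and> \<bar>t\<bar> < real n \<longrightarrow> G k t = G n t"
    have "\<bar>t\<bar> < real (nat \<lceil>\<bar>t\<bar>\<rceil> + 1)" by linarith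
    then show "\<forall>n. \<bar>t\<bar> < real n \<longrightarrow> g t = G n t" unfolding g_def using * by blast
  qed
  have bd: "\<exists>n. K \<subseteq> {-real n<..<real n}" if "compact K" for K :: "real set"
  proof -
    have "bounded K" using that by (rule compact_imp_bounded)
    then obtain B where B: "\<And>x. x \<in> K \<Longrightarrow> \<bar>x\<bar> \<le> B" unfolding bounded_iff by auto
    obtain n :: nat where "B < real n" using reals_Archimedean2 by blast
    then show ?thesis using B by (force simp: abs_le_iff intro!: exI[of _ n])
  qed
  have mG: "set_integrable lebesgue K (G n)" if "compact K" "K \<subseteq> {-real n<..<real n}" for K n
    using G[of n] that by (auto simp: has_weak_derivative_def L1_loc_def)
  have mg: "set_integrable lebesgue K g" if K: "compact K" for K
  proof -
    obtain n where n: "K \<subseteq> {-real n<..<real n}" using bd[OF K] by blast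
    have *: "integrable lebesgue (\<lambda>t. indicator K t *\<^sub>R G n t)" using mG[OF K n] by (simp add: set_integrable_def)
    have e: "AE t in lebesgue. indicator K t *\<^sub>R G n t = indicator K t *\<^sub>R g t"
      using ae
    proof eventually_elim
      fix t assume "\<forall>n. \<bar>t\<bar> < real n \<longrightarrow> g t = G n t"
      moreover have "\<bar>t\<bar> < real n" if "t \<in> K" using n that by (force simp: abs_less_iff)
      ultimately show "indicator K t *\<^sub>R G n t = indicator K t *\<^sub>R g t" by (auto simp: indicator_def)
    qed
    have "(\<lambda>t. indicator K t *\<^sub>R g t) \<in> borel_measurable lebesgue"
      by (rule borel_measurable_AE[OF borel_measurable_integrable[OF *] e])
    then show ?thesis unfolding set_integrable_def by (rule integrable_cong_AE_imp[OF * _ e])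
  qed
  have "has_weak_derivative UNIV q g"
    unfolding has_weak_derivative_def
  proof (intro conjI ballI)
    show "q \<in> L1_loc (interior UNIV)"
      by (rule continuous_in_L1_loc[OF q])
    show "g \<in> L1_loc (interior UNIV)" using mg by (auto simp: L1_loc_def)
    fix \<eta> assume eta: "\<eta> \<in> test_functions UNIV"
    define S where "S = closure {t. \<eta> t \<noteq> 0}"
    have S: "compact S" using eta by (auto simp: test_functions_def S_def)
    obtain n where n: "S \<subseteq> {-real n<..<real n}" using bd[OF S] by blast
    have zS: "\<eta> t = 0" if "t \<notin> S" for t using that closure_subset[of "{t. \<eta> t \<noteq> 0}"] by (auto simp: S_def)
    have dS: "deriv \<eta> t = 0" if "t \<notin> S" for t
      using deriv_zero_outside_support that unfolding S_def by blast
    have "\<eta> \<in> test_functions {-real n..real n}"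
      using eta n by (auto simp: test_functions_def S_def)
    then have e: "(LINT t:{-real n..real n}|lebesgue. deriv \<eta> t *\<^sub>R q t) =
        - (LINT t:{-real n..real n}|lebesgue. \<eta> t *\<^sub>R G n t)"
      using G[of n] by (auto simp: has_weak_derivative_def)
    have sub: "S \<subseteq> {-real n..real n}" using n by force
    have "(LINT t:UNIV|lebesgue. deriv \<eta> t *\<^sub>R q t) = (LINT t:{-real n..real n}|lebesgue. deriv \<eta> t *\<^sub>R q t)"
      using set_integral_zero_outside[of S "\<lambda>t. deriv \<eta> t *\<^sub>R q t" UNIV] dS
        set_integral_zero_outside[of S "\<lambda>t. deriv \<eta> t *\<^sub>R q t" "{-real n..real n}"] sub by simp
    also note e
    also have "(LINT t:{-real n..real n}|lebesgue. \<eta> t *\<^sub>R G n t) = (LINT t:S|lebesgue. \<eta> t *\<^sub>R G n t)"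
      by (rule set_integral_zero_outside) (use zS sub in auto)
    also have "(LINT t:S|lebesgue. \<eta> t *\<^sub>R G n t) = (LINT t:S|lebesgue. \<eta> t *\<^sub>R g t)"
      unfolding set_lebesgue_integral_def
    proof (rule integral_cong_AE)
      have "continuous_on UNIV \<eta>"
        using eta differentiable_imp_continuous_on[of \<eta> UNIV]
        by (auto simp: test_functions_def dest: spec[of _ 0])
      then have m: "\<eta> \<in> borel_measurable lebesgue"
        by (intro measurable_completion) (simp add: borel_measurable_continuous_onI)
      show "(\<lambda>t. indicat_real S t *\<^sub>R \<eta> t *\<^sub>R G n t) \<in> borel_measurable lebesgue"
        using borel_measurable_scaleR[OF m borel_measurable_integrable[OF mG[OF S n, unfolded set_integrable_def]]]
        by (simp add: mult.commute)
      show "(\<lambda>t. indicat_real S t *\<^sub>R \<eta> t *\<^sub>R g t) \<in> borel_measurable lebesgue"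
        using borel_measurable_scaleR[OF m borel_measurable_integrable[OF mg[OF S, unfolded set_integrable_def]]]
        by (simp add: mult.commute)
      show "AE t in lebesgue. indicat_real S t *\<^sub>R \<eta> t *\<^sub>R G n t = indicat_real S t *\<^sub>R \<eta> t *\<^sub>R g t"
        using ae
      proof eventually_elim
        fix t assume "\<forall>n. \<bar>t\<bar> < real n \<longrightarrow> g t = G n t"
        moreover have "\<bar>t\<bar> < real n" if "t \<in> S" using n that by (force simp: abs_less_iff)
        ultimately show "indicat_real S t *\<^sub>R \<eta> t *\<^sub>R G n t = indicat_real S t *\<^sub>R \<eta> t *\<^sub>R g t"
          by (auto simp: indicator_def)
      qed
    qed
    also have "(LINT t:S|lebesgue. \<eta> t *\<^sub>R g t) = (LINT t:UNIV|lebesgue. \<eta> t *\<^sub>R g t)"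
      by (rule set_integral_zero_outside[symmetric]) (use zS in auto)
    finally show "(LINT t:UNIV|lebesgue. deriv \<eta> t *\<^sub>R q t) = - (LINT t:UNIV|lebesgue. \<eta> t *\<^sub>R g t)" .
  qed
  then show ?thesis by blast
qed

section \<open>Weak derivatives of piecewise C^1 curves\<close>

lemma bounded_in_L1_loc:
  fixes D :: "real \<Rightarrow> 'a::euclidean_space"
  assumes "D \<in> borel_measurable borel" "\<And>t. norm (D t) \<le> M" shows "D \<in> L1_loc I"
proof -
  have "set_integrable lebesgue K D" if "compact K" for K
    unfolding set_integrable_def
  proof (rule integrableI_bounded_set_indicator)
    have "K \<in> lmeasurable" using lmeasurable_compact[OF that] .
    then show "K \<in> sets lebesgue" "emeasure lebesgue K < \<infinity>"
      by (auto simp: fmeasurable_def)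
    show "D \<in> borel_measurable lebesgue" using assms(1) by (intro measurable_completion) simp
    show "AE x\<in>K in lebesgue. norm (D x) \<le> M" using assms(2) by simp
  qed
  then show ?thesis by (auto simp: L1_loc_def)
qed

text \<open>Integrate the derivative of \<eta> q over an interval around the support of \<eta>: the
  fundamental theorem tolerates finitely many exceptional points, and the boundary terms
  vanish.\<close>

lemma weak_derivative_piecewise_C1:
  fixes q D :: "real \<Rightarrow> 'a::euclidean_space"
  assumes q: "continuous_on UNIV q" and Z: "finite Z"
    and D: "D \<in> borel_measurable borel" "\<And>t. norm (D t) \<le> M"
    and d: "\<And>t. t \<notin> Z \<Longrightarrow> (q has_vector_derivative D t) (at t)"
  shows "has_weak_derivative I q D"
  unfolding has_weak_derivative_def
proof (intro conjI ballI)
  show "q \<in> L1_loc (interior I)" by (rule continuous_in_L1_loc[OF q])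
  show "D \<in> L1_loc (interior I)" by (rule bounded_in_L1_loc[OF D])
  fix \<eta> assume eta: "\<eta> \<in> test_functions I"
  define S where "S = closure {t. \<eta> t \<noteq> 0}"
  have S: "compact S" "S \<subseteq> I" using eta interior_subset by (auto simp: test_functions_def S_def)
  have "bounded S" using S(1) by (rule compact_imp_bounded)
  then obtain B where B: "\<And>x. x \<in> S \<Longrightarrow> \<bar>x\<bar> \<le> B" unfolding bounded_iff by auto
  define n where "n = \<bar>B\<bar> + 1"
  have n: "S \<subseteq> {-n<..<n}" "n > 0" using B by (force simp: n_def abs_le_iff)+
  have zS: "\<eta> t = 0" if "t \<notin> S" for t using that closure_subset[of "{t. \<eta> t \<noteq> 0}"] by (auto simp: S_def)
  have dS: "deriv \<eta> t = 0" if "t \<notin> S" for t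
    using deriv_zero_outside_support that unfolding S_def by blast
  have sm: "(deriv ^^ k) \<eta> differentiable_on UNIV" for k using eta by (auto simp: test_functions_def)
  have de: "(\<eta> has_vector_derivative deriv \<eta> t) (at t)" for t
    using sm[of 0] DERIV_deriv_iff_real_differentiable[of \<eta> t]
    by (auto simp: differentiable_on_def has_real_derivative_iff_has_vector_derivative[symmetric])
  have c1: "continuous_on UNIV (deriv \<eta>)" using differentiable_imp_continuous_on[OF sm[of 1]] by simp
  have c0: "continuous_on UNIV \<eta>" using differentiable_imp_continuous_on[OF sm[of 0]] by simp
  let ?f = "\<lambda>t. deriv \<eta> t *\<^sub>R q t + \<eta> t *\<^sub>R D t"
  have hi: "(?f has_integral (\<eta> n *\<^sub>R q n - \<eta> (-n) *\<^sub>R q (-n))) {-n..n}"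
  proof (rule fundamental_theorem_of_calculus_interior_strong[OF Z])
    show "- n \<le> n" using n by simp
    show "continuous_on {-n..n} (\<lambda>x. \<eta> x *\<^sub>R q x)"
      by (intro continuous_intros continuous_on_subset[OF c0] continuous_on_subset[OF q]) auto
    fix x assume x: "x \<in> {- n<..<n} - Z"
    then have "(q has_vector_derivative D x) (at x)" using d by simp
    from has_vector_derivative_scaleR[OF de[unfolded has_real_derivative_iff_has_vector_derivative[symmetric]] this]
    show "((\<lambda>x. \<eta> x *\<^sub>R q x) has_vector_derivative deriv \<eta> x *\<^sub>R q x + \<eta> x *\<^sub>R D x) (at x)"
      by (simp add: add.commute)
  qed
  have "n \<notin> S" "- n \<notin> S" using n by auto
  then have z: "\<eta> n = 0" "\<eta> (-n) = 0" using zS by auto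
  have i1: "set_integrable lebesgue {-n..n} (\<lambda>t. deriv \<eta> t *\<^sub>R q t)"
    by (intro continuous_set_integrable_lebesgue compact_Icc continuous_intros continuous_on_subset[OF c1]
        continuous_on_subset[OF q]) auto
  obtain C where C: "\<And>t. t \<in> {-n..n} \<Longrightarrow> \<bar>\<eta> t\<bar> \<le> C"
    using continuous_on_Icc_bounded[OF c0] by (metis real_norm_def)
  have i2: "set_integrable lebesgue {-n..n} (\<lambda>t. \<eta> t *\<^sub>R D t)"
    unfolding set_integrable_def
  proof (rule integrableI_bounded_set_indicator[where B="C * M"])
    show "(\<lambda>t. \<eta> t *\<^sub>R D t) \<in> borel_measurable lebesgue"
      by (intro measurable_completion)
        (use D borel_measurable_continuous_onI[OF c0] in \<open>auto intro!: borel_measurable_scaleR\<close>)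
    have "norm (\<eta> t *\<^sub>R D t) \<le> C * M" if "t \<in> {-n..n}" for t
      using C[OF that] D(2)[of t] by (auto intro!: mult_mono)
    then show "AE x\<in>{- n..n} in lebesgue. norm (\<eta> x *\<^sub>R D x) \<le> C * M" by simp
  qed (auto simp: emeasure_lborel_Icc_eq)
  have "(LINT t:I|lebesgue. deriv \<eta> t *\<^sub>R q t) = (LINT t:{-n..n}|lebesgue. deriv \<eta> t *\<^sub>R q t)"
    using set_integral_zero_outside[of S "\<lambda>t. deriv \<eta> t *\<^sub>R q t" I lebesgue] S(2) dS n(1)
      set_integral_zero_outside[of S "\<lambda>t. deriv \<eta> t *\<^sub>R q t" "{-n..n}" lebesgue] by force
  moreover have "(LINT t:I|lebesgue. \<eta> t *\<^sub>R D t) = (LINT t:{-n..n}|lebesgue. \<eta> t *\<^sub>R D t)"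
    using set_integral_zero_outside[of S "\<lambda>t. \<eta> t *\<^sub>R D t" I lebesgue] S(2) zS n(1)
      set_integral_zero_outside[of S "\<lambda>t. \<eta> t *\<^sub>R D t" "{-n..n}" lebesgue] by force
  moreover have "(LINT t:{-n..n}|lebesgue. ?f t) = 0"
    using set_lebesgue_integral_eq_integral(2)[OF set_integral_add(1)[OF i1 i2]] integral_unique[OF hi] z by simp
  ultimately show "(LINT t:I|lebesgue. deriv \<eta> t *\<^sub>R q t) = - (LINT t:I|lebesgue. \<eta> t *\<^sub>R D t)"
    using set_integral_add(2)[OF i1 i2] by (simp add: eq_neg_iff_add_eq_0)
qed

text \<open>\<open>weak_derivative\<close> is a choice among functions that agree almost everywhere
  on I, so any explicit one may replace it under the integral.\<close>

lemma action_eq: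
  fixes q :: "real \<Rightarrow> 'a::euclidean_space"
  assumes "open I" "continuous_on I q" and g: "has_weak_derivative I q g"
  shows "action \<phi> V c I q = (\<integral>\<^sup>+t\<in>I. ennreal (Phi \<phi> (norm (g t)) + V (q t) - c) \<partial>lebesgue)"
proof -
  have w: "has_weak_derivative I q (weak_derivative I q)"
    unfolding weak_derivative_def using g by (rule someI[where P="has_weak_derivative I q"])
  have "AE t in lebesgue. t \<in> I \<longrightarrow> weak_derivative I q t = g t"
    using weak_derivative_unique[OF w g] assms by (simp add: interior_open)
  then show ?thesis unfolding action_def
  proof (intro nn_integral_cong_AE, eventually_elim)
    fix t assume "t \<in> I \<longrightarrow> weak_derivative I q t = g t"
    then show "ennreal (Phi \<phi> (norm (weak_derivative I q t)) + V (q t) - c) * indicator I t =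
        ennreal (Phi \<phi> (norm (g t)) + V (q t) - c) * indicator I t" by (simp add: indicator_def)
  qed
qed

section \<open>Orlicz-Sobolev curves and Jensen's inequality\<close>

context orlicz
begin

lemma Phi_measurable: "(\<lambda>v::'a::euclidean_space. Phi \<phi> (norm v)) \<in> borel_measurable borel"
  by (rule borel_measurable_continuous_onI[OF continuous_on_Phi_norm])

lemma bounded_in_LPhi:
  fixes D :: "real \<Rightarrow> 'a::euclidean_space"
  assumes "D \<in> L1_loc {a..b}" "\<And>t. t \<in> {a..b} \<Longrightarrow> norm (D t) \<le> M" shows "D \<in> LPhi \<phi> {a..b}"
proof -
  have "(\<integral>\<^sup>+t\<in>{a..b}. ennreal (Phi \<phi> (norm (D t) / 1)) \<partial>lebesgue) \<le> (\<integral>\<^sup>+t\<in>{a..b}. ennreal (Phi \<phi> M) \<partial>lebesgue)"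
    using assms(2) by (intro nn_integral_mono) (auto simp: indicator_def intro!: ennreal_leI Phi_mono)
  also have "\<dots> < \<infinity>"
    by (subst nn_integral_cmult_indicator) (auto simp: ennreal_mult_less_top emeasure_lborel_Icc_eq)
  finally show ?thesis using assms(1) unfolding LPhi_def by (auto intro!: exI[of _ 1])
qed

lemma piecewise_C1_in_W1Phi_loc:
  fixes q D :: "real \<Rightarrow> 'a::euclidean_space"
  assumes q: "continuous_on UNIV q" and Z: "finite Z"
    and D: "D \<in> borel_measurable borel" "\<And>t. norm (D t) \<le> M"
    and d: "\<And>t. t \<notin> Z \<Longrightarrow> (q has_vector_derivative D t) (at t)"
  shows "q \<in> W1Phi_loc \<phi>"
proof -
  have "q \<in> W1Phi \<phi> {a..b}" for a b
  proof -
    obtain C where "\<And>t. t \<in> {a..b} \<Longrightarrow> norm (q t) \<le> C"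
      using continuous_on_Icc_bounded[OF q] by blast
    then have "q \<in> LPhi \<phi> {a..b}" by (intro bounded_in_LPhi continuous_in_L1_loc[OF q])
    moreover have "D \<in> LPhi \<phi> {a..b}" by (rule bounded_in_LPhi[OF bounded_in_L1_loc[OF D] D(2)])
    ultimately show ?thesis
      using weak_derivative_piecewise_C1[OF q Z D d] by (auto simp: W1Phi_def)
  qed
  then show ?thesis using q by (simp add: W1Phi_loc_def)
qed

text \<open>Membership in \<open>W1Phi_loc\<close> supplies weak derivatives on compact intervals
  only, while the action over the whole line refers to one on \<open>UNIV\<close>.\<close>

lemma W1Phi_loc_weak_derivative:
  fixes q :: "real \<Rightarrow> 'a::euclidean_space"
  assumes "q \<in> W1Phi_loc \<phi>"
  shows "has_weak_derivative UNIV q (weak_derivative UNIV q)"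
proof -
  have "\<forall>n. \<exists>g. has_weak_derivative {-real n..real n} q g"
    using assms by (auto simp: W1Phi_loc_def W1Phi_def)
  then obtain G where "\<And>n. has_weak_derivative {-real n..real n} q (G n)" by metis
  then have "\<exists>g. has_weak_derivative UNIV q g"
    using assms by (intro weak_derivative_glue) (auto simp: W1Phi_loc_def)
  then show ?thesis unfolding weak_derivative_def by (rule someI_ex)
qed

text \<open>The witness L is the Lagrangian of q. Keeping it as a function, instead of one bound per
  interval, lets the estimates on consecutive sampling intervals add up to at most the
  action.\<close>

lemma action_ge_difference_quotient:
  fixes q :: "real \<Rightarrow> 'a::euclidean_space"
  assumes q: "q \<in> W1Phi_loc \<phi>" and V: "continuous_on UNIV V" "\<And>t. V (q t) \<ge> c"
    and fin: "action \<phi> V c UNIV q < \<infinity>"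
  obtains L where "\<And>a b. L integrable_on {a..b}"
    "\<And>a b. integral {a..b} L \<le> enn2real (action \<phi> V c UNIV q)"
    "\<And>a b. a < b \<Longrightarrow> (b - a) * Phi \<phi> (norm (q b - q a) / (b - a)) + integral {a..b} (\<lambda>t. V (q t) - c)
        \<le> integral {a..b} L"
proof -
  have cq: "continuous_on UNIV q" using q by (simp add: W1Phi_loc_def)
  define g where "g = weak_derivative UNIV q"
  have g: "has_weak_derivative UNIV q g" unfolding g_def by (rule W1Phi_loc_weak_derivative[OF q])
  define L where "L t = Phi \<phi> (norm (g t)) + V (q t) - c" for t
  have L0: "L t \<ge> 0" for t using V(2)[of t] Phi_nonneg[of "norm (g t)"] by (simp add: L_def)
  have gi: "set_integrable lebesgue {a..b} g" for a b
    using g by (auto simp: has_weak_derivative_def L1_loc_def)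
  have mg: "g \<in> borel_measurable lebesgue"
  proof (rule borel_measurable_LIMSEQ_metric)
    show "(\<lambda>t. indicat_real {-real n..real n} t *\<^sub>R g t) \<in> borel_measurable lebesgue" for n
      using gi[of "-real n" "real n"] by (auto simp: set_integrable_def)
    fix t
    obtain n0 :: nat where "\<bar>t\<bar> < real n0" using reals_Archimedean2 by blast
    then have "\<forall>\<^sub>F n in sequentially. g t = indicat_real {-real n..real n} t *\<^sub>R g t"
      by (intro eventually_sequentiallyI[of n0]) (auto simp: indicator_def)
    then show "(\<lambda>n. indicat_real {-real n..real n} t *\<^sub>R g t) \<longlonglongrightarrow> g t"
      by (rule Lim_transform_eventually[OF tendsto_const])
  qed
  have cV: "continuous_on S (\<lambda>t. V (q t))" for S
    by (rule continuous_on_compose2[OF V(1) continuous_on_subset[OF cq]]) auto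
  have mL: "L \<in> borel_measurable lebesgue"
    unfolding L_def using measurable_compose[OF mg Phi_measurable]
      measurable_completion[of "\<lambda>t. V (q t)" lborel borel] borel_measurable_continuous_onI[OF cV] by simp
  have nn: "(\<integral>\<^sup>+t. ennreal (L t) \<partial>lebesgue) = action \<phi> V c UNIV q"
    by (simp add: action_def g_def L_def)
  have iL: "integrable lebesgue L"
    using integrableI_nonneg[OF mL] L0 nn fin by simp
  have JL: "integral\<^sup>L lebesgue L = enn2real (action \<phi> V c UNIV q)"
    using nn integral_eq_nn_integral[OF mL] L0 by simp
  have sL: "set_integrable lebesgue {a..b} L" for a b
    using integrable_mult_indicator[OF _ iL, of "{a..b}"] by (simp add: set_integrable_def)
  have LI: "L integrable_on {a..b}" "integral {a..b} L = (LINT t:{a..b}|lebesgue. L t)" for a b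
    using set_lebesgue_integral_eq_integral[OF sL] by auto
  show ?thesis
  proof (rule that[of L])
    show "L integrable_on {a..b}" for a b by (rule LI)
    show "integral {a..b} L \<le> enn2real (action \<phi> V c UNIV q)" for a b
      unfolding LI JL[symmetric] set_lebesgue_integral_def
      by (intro integral_mono iL sL[unfolded set_integrable_def]) (use L0 in \<open>auto simp: indicator_def\<close>)
    fix a b :: real assume ab: "a < b"
    text \<open>Jensen's inequality: integrate the tangent of \<open>Phi\<close> at the mean velocity \<open>w\<close>.\<close>
    define w where "w = (1 / (b - a)) *\<^sub>R (q b - q a)"
    have gI: "(g has_integral (q b - q a)) {a..b}"
      using weak_derivative_increment[OF g ab _ continuous_on_subset[OF cq]]
        set_lebesgue_integral_eq_integral[OF gi[of a b]] by (auto simp: has_integral_iff)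
    have "((\<lambda>t. mom w \<bullet> g t) has_integral mom w \<bullet> (q b - q a)) {a..b}"
      using has_integral_linear[OF gI bounded_linear_inner_right[of "mom w"]] by (simp add: o_def)
    then have "((\<lambda>t. mom w \<bullet> g t + ((Phi \<phi> (norm w) - mom w \<bullet> w) + (V (q t) - c))) has_integral
      mom w \<bullet> (q b - q a) + ((b - a) * (Phi \<phi> (norm w) - mom w \<bullet> w) + integral {a..b} (\<lambda>t. V (q t) - c))) {a..b}"
      by (intro has_integral_add integrable_integral integrable_continuous_real continuous_intros cV)
        (use ab has_integral_const_real[of "Phi \<phi> (norm w) - mom w \<bullet> w" a b] in auto)
    moreover have "(L has_integral integral {a..b} L) {a..b}" using LI by blast
    moreover have "mom w \<bullet> g t + ((Phi \<phi> (norm w) - mom w \<bullet> w) + (V (q t) - c)) \<le> L t" for t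
      using Phi_norm_tangent[of w "g t"] by (simp add: L_def inner_diff_right)
    ultimately have "mom w \<bullet> (q b - q a) + ((b - a) * (Phi \<phi> (norm w) - mom w \<bullet> w) + integral {a..b} (\<lambda>t. V (q t) - c))
        \<le> integral {a..b} L" by (rule has_integral_le)
    moreover have "q b - q a = (b - a) *\<^sub>R w" using ab by (simp add: w_def)
    moreover have "norm (q b - q a) / (b - a) = norm w" using ab by (simp add: w_def)
    ultimately show "(b - a) * Phi \<phi> (norm (q b - q a) / (b - a)) + integral {a..b} (\<lambda>t. V (q t) - c)
        \<le> integral {a..b} L" by (simp add: algebra_simps)
  qed
qed

end

section \<open>The discretized problem\<close>

text \<open>Here f stands for V - c and A, B for the two parts of the sublevel set, so that
  \<open>C0\<close> and \<open>rbar\<close> no longer appear. B is unbounded, because f is positive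
  only on a bounded set and A is compact.\<close>

locale well = orlicz \<phi> l m for \<phi> l m +
  fixes f :: "'a::euclidean_space \<Rightarrow> real" and df :: "'a \<Rightarrow> 'a" and A B :: "'a set"
  assumes f_derivative: "\<And>x. (f has_derivative (\<lambda>h. df x \<bullet> h)) (at x)"
    and df_continuous: "continuous_on UNIV df"
    and bounded_positive: "bounded {x. f x > 0}"
    and nonpositive_eq: "{x. f x \<le> 0} = A \<union> B"
    and A: "compact A" "A \<noteq> {}" and B: "closed B" "B \<noteq> {}" and AB: "A \<inter> B = {}"
begin

definition U :: "'a set" where "U = {x. f x > 0}"

text \<open>The closure of U rather than \<open>{x. f x \<ge> 0}\<close>, which may contain
  unbounded parts of the zero set and need not be compact.\<close>

definition K :: "'a set" where "K = closure U"

definition gap :: real where "gap = setdist A B"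

lemma continuous_on_f: "continuous_on S f"
  using f_derivative has_derivative_continuous by (blast intro: continuous_at_imp_continuous_on)

lemma open_U: "open U"
  unfolding U_def by (rule open_Collect_less) (auto intro: continuous_on_f)

lemma U_sub_K: "U \<subseteq> K" unfolding K_def by (rule closure_subset)

lemma compact_K: "compact K"
  unfolding K_def U_def using bounded_positive by simp

lemma f_nonneg: assumes "x \<in> K" shows "f x \<ge> 0"
proof -
  have "closed {x. 0 \<le> f x}" by (rule closed_Collect_le) (auto intro: continuous_on_f)
  then have "K \<subseteq> {x. 0 \<le> f x}" unfolding K_def by (rule closure_minimal[rotated]) (auto simp: U_def)
  then show ?thesis using assms by auto
qed

lemma not_U: "x \<notin> U \<longleftrightarrow> x \<in> A \<or> x \<in> B"
  using nonpositive_eq by (auto simp: U_def not_less)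

lemma f_zero: "x \<in> K \<Longrightarrow> x \<notin> U \<Longrightarrow> f x = 0"
  using f_nonneg[of x] by (auto simp: U_def)

lemma gap_pos: "gap > 0"
  unfolding gap_def using setdist_gt_0_compact_closed[OF A(1) B(1)] A B AB by auto

lemma gap_le: "a \<in> A \<Longrightarrow> b \<in> B \<Longrightarrow> gap \<le> dist a b"
  unfolding gap_def by (rule setdist_le_dist)

lemma gap_le_infdist: assumes "b \<in> B" shows "gap \<le> infdist b A"
proof -
  obtain a where "a \<in> A" "infdist b A = dist b a"
    using infdist_attains_inf[OF compact_imp_closed[OF A(1)] A(2)] by metis
  then show ?thesis using gap_le[of a b] assms by (simp add: dist_commute)
qed

lemma f_bounded: obtains C where "C \<ge> 0" "\<And>x. x \<in> K \<Longrightarrow> f x \<le> C" "\<And>x. x \<in> K \<Longrightarrow> norm (df x) \<le> C"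
proof -
  have "bounded (f ` K)" "bounded (df ` K)"
    by (intro compact_imp_bounded compact_continuous_image compact_K continuous_on_f
        continuous_on_subset[OF df_continuous] subset_UNIV)+
  then obtain C1 C2 where "\<forall>y\<in>f ` K. norm y \<le> C1" "\<forall>y\<in>df ` K. norm y \<le> C2"
    unfolding bounded_iff by blast
  then show ?thesis
    by (intro that[of "\<bar>C1\<bar> + \<bar>C2\<bar>"]) fastforce+
qed

lemma f_lower_bound:
  assumes "d > 0"
  obtains \<eta> where "\<eta> > 0" "\<And>x. x \<in> K \<Longrightarrow> infdist x A \<ge> d \<Longrightarrow> infdist x B \<ge> d \<Longrightarrow> f x \<ge> \<eta>"
proof -
  define S where "S = K \<inter> {x. infdist x A \<ge> d} \<inter> {x. infdist x B \<ge> d}"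
  have "compact S" unfolding S_def
    by (intro compact_Int_closed compact_K closed_Collect_le continuous_intros)
  have pos: "f x > 0" if "x \<in> S" for x
  proof -
    have "x \<notin> A" "x \<notin> B" using that assms by (auto simp: S_def)
    then show ?thesis using not_U[of x] by (auto simp: U_def)
  qed
  show ?thesis
  proof (cases "S = {}")
    case True then show ?thesis by (intro that[of 1]) (auto simp: S_def)
  next
    case False
    then obtain x where "x \<in> S" "\<And>y. y \<in> S \<Longrightarrow> f x \<le> f y"
      using continuous_attains_inf[OF \<open>compact S\<close> False continuous_on_f] by blast
    then show ?thesis using pos by (intro that[of "f x"]) (auto simp: S_def)
  qed
qed

text \<open>An inner point of the segment to a nearest point of S is closer to x than S is, hence
  not in S, and closer than \<open>gap\<close> to that nearest point, hence not in the other set; so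
  it lies in U.\<close>

lemma access:
  assumes S: "S = A \<or> S = B" and x: "x \<in> K" "infdist x S < gap"
  obtains a where "a \<in> S" "dist x a = infdist x S" "closed_segment x a \<subseteq> K"
proof -
  have cl: "closed S" "S \<noteq> {}" using S A B compact_imp_closed by auto
  obtain a where a: "a \<in> S" "infdist x S = dist x a" using infdist_attains_inf[OF cl] by metis
  have "closed_segment x a \<subseteq> K"
  proof (cases "x = a")
    case False
    have "y \<in> U" if "y \<in> open_segment x a" for y
    proof -
      have d: "dist y x < dist x a" "dist a y < dist x a"
        using dist_decreases_open_segment[OF that, of x] dist_decreases_open_segment[OF that, of a]
          dist_in_open_segment[OF that] by (auto simp: dist_commute)
      have "y \<notin> S"
      proof
        assume "y \<in> S"
        then have "infdist x S \<le> dist x y" by (rule infdist_le)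
        then show False using d a by (simp add: dist_commute)
      qed
      moreover have "y \<notin> A \<or> S = A" "y \<notin> B \<or> S = B"
        using S gap_le[of a y] gap_le[of y a] d a x by (auto simp: dist_commute)
      ultimately show ?thesis using not_U[of y] S by auto
    qed
    then have "closure (open_segment x a) \<subseteq> K" unfolding K_def by (intro closure_mono) auto
    then show ?thesis using False by (simp add: closure_open_segment)
  qed (use x in auto)
  then show ?thesis using that a by simp
qed

section \<open>Polygons, their discrete action and its minimizers\<close>

definition cost :: "real \<Rightarrow> (nat \<Rightarrow> 'a) \<Rightarrow> nat \<Rightarrow> real" where
  "cost h x n = (\<Sum>i<n. h * (Phi \<phi> (norm (x (Suc i) - x i) / h) + f (x i)))"

definition polygon :: "nat \<Rightarrow> (nat \<Rightarrow> 'a) \<Rightarrow> bool" where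
  "polygon N x \<longleftrightarrow> x 0 \<in> A \<and> x N \<in> B \<and> (\<forall>i\<le>N. x i \<in> K)"

lemma cost_0 [simp]: "cost h x 0 = 0" by (simp add: cost_def)

lemma cost_Suc: "cost h x (Suc n) = cost h x n + h * (Phi \<phi> (norm (x (Suc n) - x n) / h) + f (x n))"
  by (simp add: cost_def)

lemma cost_add: "cost h x (a + n) = cost h x a + cost h (\<lambda>i. x (a + i)) n"
  by (induction n) (auto simp: cost_Suc)

lemma cost_cong: "(\<And>i. i \<le> n \<Longrightarrow> x i = y i) \<Longrightarrow> cost h x n = cost h y n"
  unfolding cost_def by (intro sum.cong) auto

lemma step_nonneg: "h > 0 \<Longrightarrow> y \<in> K \<Longrightarrow> 0 \<le> h * (Phi \<phi> (norm v / h) + f y)"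
  using Phi_nonneg[of "norm v / h"] f_nonneg[of y] by simp

lemma cost_mono:
  assumes "h > 0" "\<And>i. i \<le> n \<Longrightarrow> x i \<in> K" "k \<le> n" shows "cost h x k \<le> cost h x n"
  unfolding cost_def by (rule sum_mono2) (use assms in \<open>auto intro!: step_nonneg\<close>)

lemma cost_nonneg: "h > 0 \<Longrightarrow> (\<And>i. i \<le> n \<Longrightarrow> x i \<in> K) \<Longrightarrow> 0 \<le> cost h x n"
  using cost_mono[of h n x 0] by simp

text \<open>Steps of length at most h have speed at most 1, so each of them costs at most h (Phi 1 +
  C).\<close>

lemma segment_cost:
  assumes uv: "closed_segment u v \<subseteq> K" "dist u v \<le> real j * h" and j: "j \<ge> 1" and h: "h > 0"
    and C: "\<And>x. x \<in> K \<Longrightarrow> f x \<le> C"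
  obtains y where "y 0 = u" "y j = v" "\<And>i. i \<le> j \<Longrightarrow> y i \<in> K" "cost h y j \<le> real j * h * (Phi \<phi> 1 + C)"
proof -
  define y where "y i = u + (real i / real j) *\<^sub>R (v - u)" for i
  have yK: "y i \<in> K" if "i \<le> j" for i
  proof -
    have "y i = (1 - real i / real j) *\<^sub>R u + (real i / real j) *\<^sub>R v"
      by (simp add: y_def algebra_simps)
    then have "y i \<in> closed_segment u v"
      using that j by (auto simp: closed_segment_def intro!: exI[of _ "real i / real j"])
    then show ?thesis using uv by auto
  qed
  have st: "norm (y (Suc i) - y i) / h \<le> 1" for i
  proof -
    have "y (Suc i) - y i = (1 / real j) *\<^sub>R (v - u)"
      by (simp add: y_def scaleR_left_diff_distrib[symmetric] diff_divide_distrib[symmetric])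
    then have "norm (y (Suc i) - y i) = dist u v / real j"
      by (simp add: dist_norm norm_minus_commute)
    moreover have "dist u v / real j \<le> h" using divide_right_mono[OF uv(2), of "real j"] j by simp
    ultimately have "norm (y (Suc i) - y i) \<le> h" by simp
    then show ?thesis using h by simp
  qed
  have "cost h y j \<le> (\<Sum>i<j. h * (Phi \<phi> 1 + C))"
    unfolding cost_def using h st yK C
    by (intro sum_mono mult_left_mono add_mono Phi_mono) auto
  also have "\<dots> = real j * h * (Phi \<phi> 1 + C)" by simp
  finally show ?thesis using yK j by (intro that[of y]) (auto simp: y_def)
qed

lemma exists_minimizer:
  assumes N: "N \<ge> 1" and h: "h > 0" and ex: "polygon N z"
  shows "\<exists>x. polygon N x \<and> (\<forall>y. polygon N y \<longrightarrow> cost h x N \<le> cost h y N)"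
proof -
  \<comment> \<open>Infinite sequences with one compact constraint per coordinate, so that
    Tychonoff's theorem applies; coordinates beyond N are only required to lie in K and do not
    affect the cost.\<close>
  define S where "S i = (if i = 0 then K \<inter> A else if i = N then K \<inter> B else K)" for i
  have cS: "compact (S i)" for i
    using compact_K A B by (auto simp: S_def intro: compact_Int_closed compact_imp_closed)
  have memS: "x \<in> PiE UNIV S \<Longrightarrow> polygon N x" for x
    using N by (auto simp: PiE_def Pi_def polygon_def S_def split: if_splits)
  have toS: "(\<lambda>i. x (min i N)) \<in> PiE UNIV S" if "polygon N x" for x
    using that N by (auto simp: PiE_def Pi_def polygon_def S_def min_def)
  have "compactin (product_topology (\<lambda>i. euclidean) UNIV) (PiE UNIV S)"
    unfolding compactin_PiE using cS by simp
  then have comp: "compact (PiE UNIV S)"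
    by (simp add: euclidean_product_topology compactin_euclidean_iff)
  have ne: "PiE UNIV S \<noteq> {}" using toS[OF ex] by auto
  have coord: "continuous_on (PiE UNIV S) (\<lambda>x::nat \<Rightarrow> 'a. x i)" for i
    by (intro continuous_intros continuous_on_product_coordinates[THEN continuous_on_subset]) auto
  have "continuous_on (PiE UNIV S) (\<lambda>x. h * (Phi \<phi> (norm (x (Suc i) - x i) / h) + f (x i)))" for i
  proof -
    have e: "norm v / h = norm ((1/h) *\<^sub>R v)" for v :: 'a using h by simp
    show ?thesis unfolding e
      by (intro continuous_intros continuous_on_compose2[OF continuous_on_Phi_norm[of UNIV]]
          continuous_on_compose2[OF continuous_on_f[of UNIV]] coord) auto
  qed
  then have "continuous_on (PiE UNIV S) (\<lambda>x. cost h x N)"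
    unfolding cost_def by (intro continuous_on_sum) auto
  from continuous_attains_inf[OF comp ne this]
  obtain x where x: "x \<in> PiE UNIV S" "\<And>y. y \<in> PiE UNIV S \<Longrightarrow> cost h x N \<le> cost h y N" by blast
  have "cost h x N \<le> cost h y N" if "polygon N y" for y
    using x(2)[OF toS[OF that]] cost_cong[of N y "\<lambda>i. y (min i N)" h] by simp
  then show ?thesis using memS[OF x(1)] by blast
qed

text \<open>Ties are broken in favour of fewer steps, which keeps the interior vertices off \<open>A\<close> and \<open>B\<close>.\<close>

definition optimal :: "real \<Rightarrow> nat \<Rightarrow> (nat \<Rightarrow> 'a) \<Rightarrow> bool" where
  "optimal h N x \<longleftrightarrow> N \<ge> 1 \<and> polygon N x \<and>
    (\<forall>N' y. 1 \<le> N' \<and> N' \<le> N \<and> polygon N' y \<longrightarrow>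
       cost h x N \<le> cost h y N' \<and> (N' < N \<longrightarrow> cost h x N < cost h y N'))"

lemma exists_optimal:
  assumes N0: "N0 \<ge> 1" and h: "h > 0" and z: "polygon N0 z"
  obtains N x where "optimal h N x" "cost h x N \<le> cost h z N0"
proof -
  define T where "T = {N \<in> {1..N0}. \<exists>x. polygon N x}"
  have "\<forall>N\<in>T. \<exists>x. polygon N x \<and> (\<forall>y. polygon N y \<longrightarrow> cost h x N \<le> cost h y N)"
    using exists_minimizer[OF _ h] by (auto simp: T_def)
  then obtain X where X: "\<And>N. N \<in> T \<Longrightarrow> polygon N (X N)"
    "\<And>N y. N \<in> T \<Longrightarrow> polygon N y \<Longrightarrow> cost h (X N) N \<le> cost h y N" by metis
  define \<mu> where "\<mu> N = cost h (X N) N" for N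
  have T: "finite T" "N0 \<in> T" using N0 z by (auto simp: T_def)
  \<comment> \<open>Among the step numbers of smallest cost the least is taken, which gives the
    strict inequality against polygons with fewer steps.\<close>
  define P where "P N \<longleftrightarrow> N \<in> T \<and> \<mu> N = Min (\<mu> ` T)" for N
  have "Min (\<mu> ` T) \<in> \<mu> ` T" using T by (intro Min_in) auto
  then have ex: "\<exists>N. P N" by (auto simp: P_def)
  define N where "N = (LEAST N. P N)"
  have PN: "P N" unfolding N_def using ex by (rule LeastI_ex)
  have least: "N \<le> N'" if "P N'" for N' unfolding N_def using that by (rule Least_le)
  have mn: "\<mu> N \<le> \<mu> N'" if "N' \<in> T" for N'
    using PN T that by (auto simp: P_def)
  have NT: "N \<in> T" using PN by (simp add: P_def)
  have "optimal h N (X N)"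
    unfolding optimal_def
  proof (intro conjI allI impI)
    show "N \<ge> 1" "polygon N (X N)" using NT X(1) by (auto simp: T_def)
    fix N' y assume a: "1 \<le> N' \<and> N' \<le> N \<and> polygon N' y"
    then have N'T: "N' \<in> T" using NT by (auto simp: T_def)
    have y: "\<mu> N' \<le> cost h y N'" using X(2)[OF N'T] a by (auto simp: \<mu>_def)
    show "cost h (X N) N \<le> cost h y N'" using y mn[OF N'T] by (simp add: \<mu>_def)
    assume "N' < N"
    then have "\<not> P N'" using least by force
    then have "\<mu> N < \<mu> N'" using mn[OF N'T] N'T PN by (auto simp: P_def)
    then show "cost h (X N) N < cost h y N'" using y by (simp add: \<mu>_def)
  qed
  moreover have "cost h (X N) N \<le> cost h z N0"
    using mn[OF T(2)] X(2)[OF T(2) z] by (simp add: \<mu>_def)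
  ultimately show ?thesis by (rule that)
qed

text \<open>At an inner vertex in A or B one of the two pieces is already a polygon with fewer
  steps, and its cost is no larger because costs are nonnegative.\<close>

lemma optimal_interior:
  assumes opt: "optimal h N x" and h: "h > 0" and i: "0 < i" "i < N"
  shows "x i \<in> U"
proof (rule ccontr)
  have xK: "\<And>j. j \<le> N \<Longrightarrow> x j \<in> K" and ends: "x 0 \<in> A" "x N \<in> B" using opt by (auto simp: optimal_def polygon_def)
  assume "x i \<notin> U"
  then consider "x i \<in> A" | "x i \<in> B" using not_U by auto
  then show False
  proof cases
    case 1
    have "polygon (N - i) (\<lambda>j. x (i + j))" using 1 ends xK i by (auto simp: polygon_def)
    then have "cost h x N < cost h (\<lambda>j. x (i + j)) (N - i)" using opt i by (auto simp: optimal_def)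
    moreover have "cost h x N = cost h x i + cost h (\<lambda>j. x (i + j)) (N - i)"
      using cost_add[of h x i "N - i"] i by simp
    moreover have "cost h x i \<ge> 0" using xK i by (intro cost_nonneg h) auto
    ultimately show False by simp
  next
    case 2
    have "polygon i x" using 2 ends xK i by (auto simp: polygon_def)
    then have "cost h x N < cost h x i" using opt i by (auto simp: optimal_def)
    moreover have "cost h x i \<le> cost h x N" using xK i by (intro cost_mono h) auto
    ultimately show False by simp
  qed
qed

section \<open>The discrete Euler-Lagrange equation and a priori bounds\<close>

lemma step_derivative:
  fixes y a :: 'a assumes "h > 0"
  shows "((\<lambda>y. h * Phi \<phi> (norm (y - a) / h)) has_derivative (\<lambda>d. mom ((1/h) *\<^sub>R (y - a)) \<bullet> d)) (at y)"
proof -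
  have e: "norm (y - a) / h = norm ((1/h) *\<^sub>R (y - a))" for y using assms by simp
  have "((\<lambda>y. Phi \<phi> (norm ((1/h) *\<^sub>R (y - a)))) has_derivative (\<lambda>d. mom ((1/h) *\<^sub>R (y - a)) \<bullet> ((1/h) *\<^sub>R d))) (at y)"
    by (rule has_derivative_compose[OF _ Phi_norm_has_derivative]) (auto intro!: derivative_eq_intros)
  then have "((\<lambda>y. h * Phi \<phi> (norm ((1/h) *\<^sub>R (y - a)))) has_derivative (\<lambda>d. h * (mom ((1/h) *\<^sub>R (y - a)) \<bullet> ((1/h) *\<^sub>R d)))) (at y)"
    by (rule has_derivative_mult_right)
  then show ?thesis unfolding e using assms by simp
qed

text \<open>An inner vertex lies in the open set U and may be moved freely, so the part of the cost
  that depends on it is stationary there.\<close>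

lemma optimal_EL:
  assumes opt: "optimal h N x" and h: "h > 0" and i: "Suc i < N"
  shows "mom ((1/h) *\<^sub>R (x (Suc (Suc i)) - x (Suc i))) - mom ((1/h) *\<^sub>R (x (Suc i) - x i)) = h *\<^sub>R df (x (Suc i))"
proof -
  let ?x = "x (Suc i)" and ?p = "\<lambda>i. mom ((1/h) *\<^sub>R (x (Suc i) - x i))"
  define F where "F y = h * Phi \<phi> (norm (y - x i) / h) + (h * Phi \<phi> (norm (y - x (Suc (Suc i))) / h) + h * f y)" for y
  have poly: "polygon N x" using opt by (simp add: optimal_def)
  have xU: "?x \<in> U" using optimal_interior[OF opt h] i by simp
  have FD: "(F has_derivative (\<lambda>d. ?p i \<bullet> d + (mom ((1/h) *\<^sub>R (?x - x (Suc (Suc i)))) \<bullet> d + h * (df ?x \<bullet> d)))) (at ?x)"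
    unfolding F_def by (intro has_derivative_add step_derivative h has_derivative_mult_right f_derivative)
  have min: "F ?x \<le> F y" if "y \<in> U" for y
  proof -
    define z where "z = x(Suc i := y)"
    have "polygon N z" using poly that i U_sub_K by (auto simp: polygon_def z_def)
    then have le: "cost h x N \<le> cost h z N" using opt by (auto simp: optimal_def)
    define n where "n = N - Suc (Suc i)"
    have N: "N = Suc (Suc i) + n" using i by (simp add: n_def)
    have 1: "cost h w N = cost h w i + (h * (Phi \<phi> (norm (w (Suc i) - w i) / h) + f (w i))) +
        (h * (Phi \<phi> (norm (w (Suc (Suc i)) - w (Suc i)) / h) + f (w (Suc i)))) + cost h (\<lambda>j. w (Suc (Suc i) + j)) n" for w
      unfolding N cost_add[of h w "Suc (Suc i)"] by (simp add: cost_Suc)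
    have "cost h z i = cost h x i" by (rule cost_cong) (auto simp: z_def)
    then show ?thesis using le unfolding 1 by (simp add: z_def F_def norm_minus_commute algebra_simps)
  qed
  obtain r where r: "r > 0" "ball ?x r \<subseteq> U" using open_U xU open_contains_ball by blast
  have "(\<lambda>d. ?p i \<bullet> d + (mom ((1/h) *\<^sub>R (?x - x (Suc (Suc i)))) \<bullet> d + h * (df ?x \<bullet> d))) = (\<lambda>d. 0)"
    by (rule differential_zero_maxmin[OF _ open_ball FD]) (use r min in auto)
  then have "(?p i + mom ((1/h) *\<^sub>R (?x - x (Suc (Suc i)))) + h *\<^sub>R df ?x) \<bullet> d = 0" for d
    by (auto simp: inner_add_left dest: fun_cong[of _ _ d])
  then have "?p i + mom ((1/h) *\<^sub>R (?x - x (Suc (Suc i)))) + h *\<^sub>R df ?x = 0"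
    by (metis inner_eq_zero_iff)
  \<comment> \<open>The vertex is the initial point of the next step, which therefore enters with
    reversed direction; \<open>mom\<close> is odd.\<close>
  moreover have "mom ((1/h) *\<^sub>R (?x - x (Suc (Suc i)))) = - ?p (Suc i)"
  proof -
    have "(1/h) *\<^sub>R (?x - x (Suc (Suc i))) = - ((1/h) *\<^sub>R (x (Suc (Suc i)) - ?x))"
      by (simp add: scaleR_diff_right)
    moreover have "mom (- v) = - mom v" for v :: 'a by (simp add: mom_def)
    ultimately show ?thesis by metis
  qed
  ultimately show ?thesis by (simp add: algebra_simps)
qed

text \<open>Each step contributes the linear lower bound of Phi with slope \<open>flux a\<close>.
  For large a this bounds the duration n h from below: a polygon of bounded cost cannot cover a
  fixed distance in a short time.\<close>

lemma displacement_le: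
  assumes h: "h > 0" and xK: "\<And>i. i \<le> n \<Longrightarrow> x i \<in> K" and a: "a \<ge> 0"
  shows "flux a * dist (x 0) (x n) \<le> cost h x n + real n * h * (flux a * a)"
  using xK
proof (induction n)
  case (Suc n)
  let ?d = "norm (x (Suc n) - x n)"
  have "dist (x 0) (x (Suc n)) \<le> dist (x 0) (x n) + ?d"
    using dist_triangle[of "x 0" "x (Suc n)" "x n"] by (simp add: dist_norm norm_minus_commute)
  then have "flux a * dist (x 0) (x (Suc n)) \<le> flux a * dist (x 0) (x n) + flux a * ?d"
    using mult_left_mono[OF _ flux_nonneg[OF a]] by (metis distrib_left)
  moreover have "flux a * ?d \<le> h * Phi \<phi> (?d / h) + h * (flux a * a)"
  proof -
    have "h * (flux a * (?d / h) - flux a * a) \<le> h * Phi \<phi> (?d / h)"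
      using h a by (intro mult_left_mono Phi_ge_linear) auto
    then show ?thesis using h by (simp add: algebra_simps)
  qed
  moreover have "h * f (x n) \<ge> 0" using f_nonneg[OF Suc.prems[of n]] h by simp
  ultimately show ?case using Suc by (simp add: cost_Suc algebra_simps)
qed simp


abbreviation momentum :: "real \<Rightarrow> (nat \<Rightarrow> 'a) \<Rightarrow> nat \<Rightarrow> 'a" where
  "momentum h x i \<equiv> mom ((1/h) *\<^sub>R (x (Suc i) - x i))"

text \<open>Summation of the discrete equation; the constant C depends neither on h nor on the
  polygon.\<close>

lemma momentum_lipschitz:
  assumes opt: "optimal h N x" and h: "h > 0" and C: "\<And>x. x \<in> K \<Longrightarrow> norm (df x) \<le> C"
    and ij: "i \<le> j" "j < N"
  shows "norm (momentum h x j - momentum h x i) \<le> real (j - i) * h * C"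
  using ij
proof (induction j)
  case (Suc j)
  show ?case
  proof (cases "i = Suc j")
    case False
    then have IH: "norm (momentum h x j - momentum h x i) \<le> real (j - i) * h * C" using Suc by simp
    have xK: "x (Suc j) \<in> K" using opt Suc.prems by (auto simp: optimal_def polygon_def)
    have "momentum h x (Suc j) - momentum h x i = h *\<^sub>R df (x (Suc j)) + (momentum h x j - momentum h x i)"
      using optimal_EL[OF opt h Suc.prems(2)] by (simp add: algebra_simps)
    then have "norm (momentum h x (Suc j) - momentum h x i) \<le> norm (h *\<^sub>R df (x (Suc j))) + norm (momentum h x j - momentum h x i)"
      by (metis norm_triangle_ineq)
    also have "\<dots> \<le> h * C + real (j - i) * h * C"
      using IH C[OF xK] h by (intro add_mono) auto
    also have "\<dots> = real (Suc j - i) * h * C" using False Suc.prems(1) by (simp add: Suc_diff_le algebra_simps)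
    finally show ?thesis .
  qed simp
qed simp

text \<open>In a time window of bounded length some step is slow because the cost is bounded, and the momentum
  varies by a bounded amount there.\<close>

lemma velocity_bound:
  obtains R where "R > 0" "\<And>h N x i. 0 < h \<Longrightarrow> h \<le> 1 \<Longrightarrow> optimal h N x \<Longrightarrow> cost h x N \<le> M \<Longrightarrow> i < N \<Longrightarrow>
    norm (x (Suc i) - x i) \<le> h * R"
proof -
  obtain C where C: "C \<ge> 0" "\<And>x. x \<in> K \<Longrightarrow> norm (df x) \<le> C" using f_bounded by metis
  \<comment> \<open>With this slope the displacement estimate leaves flux(a) a N h \<ge> 1, a lower
    bound for the duration N h.\<close>
  obtain a where a: "a > 0" "flux a \<ge> (M + 1) / gap" using flux_unbounded by blast
  have fa: "flux a * a > 0" using flux_pos[OF a(1)] a(1) by simp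
  define \<tau> where "\<tau> = min (1 / (flux a * a)) 1"
  have tau: "\<tau> > 0" "\<tau> \<le> 1" using fa by (auto simp: \<tau>_def)
  have f1: "flux 1 > 0" by (rule flux_pos) simp
  \<comment> \<open>A speed bound for slow steps: the linear lower bound with slope flux 1, applied
    where Phi \<le> M / \<tau>.\<close>
  define R0 where "R0 = 1 + \<bar>M\<bar> / (\<tau> * flux 1)"
  have R0: "R0 > 0" using tau f1 by (auto simp: R0_def intro!: add_pos_nonneg)
  \<comment> \<open>The momentum changes by at most 2 C across a window, whose duration is at most
    2.\<close>
  obtain R where R: "R > 0" "flux R \<ge> flux R0 + 2 * C" using flux_unbounded by blast
  have "norm (x (Suc j) - x j) \<le> h * R"
    if h: "0 < h" "h \<le> 1" and opt: "optimal h N x" and M: "cost h x N \<le> M" and j: "j < N" for h N x j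
  proof -
    have xK: "\<And>i. i \<le> N \<Longrightarrow> x i \<in> K" and ends: "x 0 \<in> A" "x N \<in> B" using opt by (auto simp: optimal_def polygon_def)
    have M0: "M \<ge> 0" using cost_nonneg[of h N x] h xK M by simp
    have "M + 1 \<le> flux a * gap" using a(2) gap_pos by (simp add: field_simps)
    also have "\<dots> \<le> flux a * dist (x 0) (x N)"
      using gap_le[OF ends] flux_pos[OF a(1)] by simp
    also have "\<dots> \<le> M + real N * h * (flux a * a)"
      using displacement_le[of h N x a] h xK a(1) M by auto
    finally have "1 / (flux a * a) \<le> real N * h" using fa by (simp add: field_simps)
    then have Nh: "\<tau> \<le> real N * h" by (simp add: \<tau>_def)
    \<comment> \<open>About 1 / h steps, or all N if there are fewer; the duration then lies between
      \<tau> and 2.\<close>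
    define k where "k = min N (nat \<lceil>1 / h\<rceil>)"
    have c1: "1 / h \<le> real (nat \<lceil>1 / h\<rceil>)" "real (nat \<lceil>1 / h\<rceil>) \<le> 1 / h + 1" using h by (auto simp: of_nat_nat ceiling_correct)
    have kh: "\<tau> \<le> real k * h" "real k * h \<le> 2" "k \<le> N"
    proof -
      have "1 \<le> real (nat \<lceil>1 / h\<rceil>) * h" using mult_right_mono[OF c1(1), of h] h by simp
      then show "\<tau> \<le> real k * h" using Nh tau by (auto simp: k_def min_def)
      have "real k \<le> real (nat \<lceil>1 / h\<rceil>)" unfolding of_nat_le_iff k_def by (rule min.cobounded2)
      then have "real k * h \<le> real (nat \<lceil>1 / h\<rceil>) * h" using mult_right_mono[of _ _ h] h by simp
      also have "\<dots> \<le> (1 / h + 1) * h" using c1(2) h by (intro mult_right_mono) auto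
      also have "\<dots> \<le> 2" using h by (simp add: field_simps)
      finally show "real k * h \<le> 2" .
    qed (simp add: k_def)
    have k1: "k \<ge> 1" using kh(1) tau by (cases k) auto
    \<comment> \<open>The window starts at j unless it would run past N, in which case it is shifted
      back; it contains j either way.\<close>
    define w where "w = min j (N - k)"
    have W: "{w..<w + k} \<subseteq> {..<N}" "j \<in> {w..<w + k}" using kh(3) k1 j by (auto simp: w_def min_def)
    have "\<exists>i\<in>{w..<w + k}. Phi \<phi> (norm (x (Suc i) - x i) / h) \<le> M / \<tau>"
    proof (rule ccontr)
      assume "\<not> ?thesis"
      then have gt: "\<And>i. i \<in> {w..<w + k} \<Longrightarrow> M / \<tau> < Phi \<phi> (norm (x (Suc i) - x i) / h)" by force
      have "M \<le> (real k * h) * (M / \<tau>)"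
        using mult_right_mono[OF kh(1), of "M / \<tau>"] M0 tau by simp
      also have "\<dots> = (\<Sum>i\<in>{w..<w + k}. h * (M / \<tau>))" by simp
      also have "\<dots> < (\<Sum>i\<in>{w..<w + k}. h * (Phi \<phi> (norm (x (Suc i) - x i) / h) + f (x i)))"
      proof (rule sum_strict_mono)
        fix i assume i: "i \<in> {w..<w + k}"
        then have "f (x i) \<ge> 0" using W(1) by (intro f_nonneg xK) auto
        then show "h * (M / \<tau>) < h * (Phi \<phi> (norm (x (Suc i) - x i) / h) + f (x i))"
          using gt[OF i] h by (intro mult_strict_left_mono) auto
      qed (use k1 in auto)
      also have "\<dots> \<le> cost h x N" unfolding cost_def
        by (rule sum_mono2) (use W(1) h xK in \<open>auto intro!: step_nonneg\<close>)
      finally show False using M by simp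
    qed
    then obtain i where i: "i \<in> {w..<w + k}" "Phi \<phi> (norm (x (Suc i) - x i) / h) \<le> M / \<tau>" by blast
    have "flux 1 * (norm (x (Suc i) - x i) / h) - flux 1 \<le> M / \<tau>"
      using Phi_ge_linear[of 1 "norm (x (Suc i) - x i) / h"] i(2) h by simp
    then have "norm (x (Suc i) - x i) / h \<le> R0"
      using f1 tau M0 h by (simp add: R0_def field_simps)
    then have "flux (norm (x (Suc i) - x i) / h) \<le> flux R0" using h by (intro flux_mono) auto
    then have p: "norm (momentum h x i) \<le> flux R0" using h by (simp add: norm_mom)
    have "norm (momentum h x j - momentum h x i) \<le> real k * h * C"
    proof (cases "i \<le> j")
      case True
      have "norm (momentum h x j - momentum h x i) \<le> real (j - i) * h * C"
        by (rule momentum_lipschitz[OF opt h(1) C(2) True j])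
      also have "\<dots> \<le> real k * h * C" using i W h C(1) by (intro mult_right_mono) auto
      finally show ?thesis .
    next
      case False
      have "norm (momentum h x i - momentum h x j) \<le> real (i - j) * h * C"
        by (rule momentum_lipschitz[OF opt h(1) C(2)]) (use False subsetD[OF W(1) i(1)] in auto)
      also have "\<dots> \<le> real k * h * C" using i W h C(1) by (intro mult_right_mono) auto
      finally show ?thesis by (simp add: norm_minus_commute)
    qed
    also have "\<dots> \<le> 2 * C" using kh(2) C(1) by (intro mult_right_mono) auto
    finally have "norm (momentum h x j) \<le> flux R"
      using p R(2) norm_triangle_sub[of "momentum h x j" "momentum h x i"] by linarith
    then have "flux (norm (x (Suc j) - x j) / h) \<le> flux R" using h by (simp add: norm_mom)
    then have "norm (x (Suc j) - x j) / h \<le> R"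
      using flux_strict_mono[of R "norm (x (Suc j) - x j) / h"] R(1) by force
    then show ?thesis using h by (simp add: field_simps)
  qed
  then show ?thesis using R(1) that by blast
qed

section \<open>Splicing of polygons, and no return to the starting set\<close>

definition cat :: "nat \<Rightarrow> (nat \<Rightarrow> 'a) \<Rightarrow> (nat \<Rightarrow> 'a) \<Rightarrow> nat \<Rightarrow> 'a" where
  "cat J y x n = (if n \<le> J then y n else x (n - J))"

lemma cost_cat: assumes "y J = x 0" shows "cost h (cat J y x) (J + n) = cost h y J + cost h x n"
proof -
  have "cost h (cat J y x) J = cost h y J" by (rule cost_cong) (simp add: cat_def)
  moreover have "cost h (\<lambda>i. cat J y x (J + i)) n = cost h x n"
    by (rule cost_cong) (use assms in \<open>auto simp: cat_def\<close>)
  ultimately show ?thesis by (simp add: cost_add)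
qed

lemma gap_infdist_sum: "gap \<le> infdist x A + infdist x B"
proof -
  obtain a where "a \<in> A" "infdist x A = dist x a"
    using infdist_attains_inf[OF compact_imp_closed[OF A(1)] A(2)] by metis
  moreover obtain b where "b \<in> B" "infdist x B = dist x b"
    using infdist_attains_inf[OF B] by metis
  ultimately show ?thesis using gap_le[of a b] dist_triangle2[of a b x] by (simp add: dist_commute)
qed

lemma infdist_step: "norm (y - x) \<le> r \<Longrightarrow> infdist y S \<le> infdist x S + r"
  using infdist_triangle[of y S x] by (simp add: dist_norm)

lemma infdist_steps:
  assumes "\<And>i. i < k \<Longrightarrow> norm (x (Suc i) - x i) \<le> r" "j \<le> k"
  shows "infdist (x k) S \<le> infdist (x j) S + real (k - j) * r"
  using assms
proof (induction k)
  case (Suc k)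
  show ?case
  proof (cases "j = Suc k")
    case False
    then show ?thesis
      using Suc infdist_step[of "x (Suc k)" "x k" r S] by (simp add: Suc_diff_le algebra_simps)
  qed simp
qed simp

text \<open>Once an optimal polygon has left the \<open>gap/2\<close>-neighbourhood of \<open>A\<close>, which costs at least a fixed
  amount, it cannot come close to \<open>A\<close> again: starting afresh from there would be cheaper.\<close>

lemma no_return:
  assumes R: "R > 0"
  obtains \<delta> h0 where "\<delta> > 0" "h0 > 0"
    "\<And>h N x k i. 0 < h \<Longrightarrow> h < h0 \<Longrightarrow> optimal h N x \<Longrightarrow> (\<And>i. i < N \<Longrightarrow> norm (x (Suc i) - x i) \<le> h * R) \<Longrightarrow>
      gap / 2 \<le> infdist (x k) A \<Longrightarrow> k \<le> i \<Longrightarrow> i \<le> N \<Longrightarrow> \<delta> \<le> infdist (x i) A"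
proof -
  obtain C where C: "C \<ge> 0" "\<And>x. x \<in> K \<Longrightarrow> f x \<le> C" using f_bounded by metis
  define E where "E = Phi \<phi> 1 + C"
  have E: "E > 0" using Phi_pos[of 1] C(1) by (simp add: E_def)
  obtain \<eta> where eta: "\<eta> > 0" "\<And>x. x \<in> K \<Longrightarrow> infdist x A \<ge> gap / 4 \<Longrightarrow> infdist x B \<ge> gap / 4 \<Longrightarrow> f x \<ge> \<eta>"
    using f_lower_bound[of "gap / 4"] gap_pos by auto
  \<comment> \<open>Getting from distance gap/4 to gap/2 at speed at most R takes time gap/(4 R), at
    potential at least \<eta>; half of that time is given up to the discretization.\<close>
  define \<kappa> where "\<kappa> = gap * \<eta> / (8 * R)"
  have kap: "\<kappa> > 0" using gap_pos eta R by (simp add: \<kappa>_def)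
  \<comment> \<open>The three bounds keep the shortcut from having more than i steps, bring the
    vertex within reach of \<open>access\<close>, and, together with h < h0, keep the cost of the
    shortcut below \<kappa>.\<close>
  define \<delta> where "\<delta> = min (gap / (8 * R)) (min (gap / 2) (\<kappa> / (4 * E)))"
  define h0 where "h0 = min (gap / (8 * R)) (\<kappa> / (4 * E))"
  have pos: "\<delta> > 0" "h0 > 0" using gap_pos R kap E by (auto simp: \<delta>_def h0_def)
  have "\<delta> \<le> infdist (x i) A"
    if h: "0 < h" "h < h0" and opt: "optimal h N x" and st: "\<And>i. i < N \<Longrightarrow> norm (x (Suc i) - x i) \<le> h * R"
      and k: "gap / 2 \<le> infdist (x k) A" "k \<le> i" "i \<le> N" for h N x k i
  proof (rule ccontr)
    assume "\<not> \<delta> \<le> infdist (x i) A"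
    then have small: "infdist (x i) A < \<delta>" by simp
    have xK: "\<And>i. i \<le> N \<Longrightarrow> x i \<in> K" and ends: "x 0 \<in> A" "x N \<in> B" using opt by (auto simp: optimal_def polygon_def)
    define k' where "k' = (LEAST k. gap / 2 \<le> infdist (x k) A)"
    have k': "gap / 2 \<le> infdist (x k') A" "k' \<le> k"
      unfolding k'_def using k(1) by (rule LeastI) (rule Least_le, rule k(1))
    have before: "infdist (x n) A < gap / 2" if "n < k'" for n
      using not_less_Least[OF that[unfolded k'_def]] by simp
    \<comment> \<open>Vertices up to the first exit that are still within gap/4 of A; after the last
      of them and before the exit, A and B are both at distance at least gap/4.\<close>
    define T where "T = {n \<in> {..k'}. infdist (x n) A \<le> gap / 4}"
    have T0: "0 \<in> T" using ends(1) gap_pos by (simp add: T_def)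
    define j where "j = Max T"
    have jT: "j \<in> T" unfolding j_def using T0 by (intro Max_in) (auto simp: T_def)
    have jk: "j < k'" using jT k'(1) gap_pos by (cases "j = k'") (auto simp: T_def)
    have mid: "f (x n) \<ge> \<eta>" if n: "j < n" "n < k'" for n
    proof -
      have "finite T" by (simp add: T_def)
      then have "n \<notin> T" using n(1) Max_ge[of T n] unfolding j_def by fastforce
      then have "infdist (x n) A > gap / 4" using n by (auto simp: T_def)
      moreover have "infdist (x n) B \<ge> gap / 4"
        using gap_infdist_sum[of "x n"] before[OF n(2)] gap_pos by linarith
      ultimately show ?thesis using n k' k by (intro eta xK) auto
    qed
    have "infdist (x k') A \<le> infdist (x j) A + real (k' - j) * (h * R)"
      by (rule infdist_steps) (use st k k' jk in auto)
    then have "gap / 4 \<le> real (k' - j) * (h * R)" using jT k'(1) by (auto simp: T_def)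
    then have t1: "gap / (4 * R) \<le> real (k' - j) * h" using R by (simp add: field_simps)
    have hs: "h < gap / (8 * R)" "h < \<kappa> / (4 * E)" using h by (auto simp: h0_def)
    \<comment> \<open>The sum below runs over the vertices strictly between j and k', one fewer than
      the number of steps; h < gap/(8 R) absorbs the loss.\<close>
    have "gap / (8 * R) = gap / (4 * R) - gap / (8 * R)" using R by (simp add: field_simps)
    then have "gap / (8 * R) \<le> real (k' - j - 1) * h"
      using t1 hs(1) jk by (simp add: of_nat_diff algebra_simps)
    then have "\<kappa> \<le> (real (k' - j - 1) * h) * \<eta>"
      using mult_right_mono[of "gap / (8 * R)" "real (k' - j - 1) * h" \<eta>] eta(1) by (simp add: \<kappa>_def)
    also have "\<dots> = (\<Sum>n\<in>{j<..<k'}. h * \<eta>)" by simp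
    also have "\<dots> \<le> (\<Sum>n\<in>{j<..<k'}. h * (Phi \<phi> (norm (x (Suc n) - x n) / h) + f (x n)))"
    proof (rule sum_mono)
      fix n assume "n \<in> {j<..<k'}"
      then show "h * \<eta> \<le> h * (Phi \<phi> (norm (x (Suc n) - x n) / h) + f (x n))"
        using mid[of n] h Phi_nonneg[of "norm (x (Suc n) - x n) / h"] by auto
    qed
    also have "\<dots> \<le> cost h x i" unfolding cost_def
      by (rule sum_mono2) (use h xK k k' in \<open>auto intro!: step_nonneg\<close>)
    finally have big: "\<kappa> \<le> cost h x i" .
    have "infdist (x k') A \<le> infdist (x 0) A + real (k' - 0) * (h * R)"
      by (rule infdist_steps) (use st k k' in auto)
    then have "gap / 2 \<le> real k' * (h * R)" using ends(1) k'(1) by simp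
    moreover have "real k' * (h * R) \<le> real i * (h * R)" using k k' h R by (intro mult_right_mono) auto
    ultimately have "gap / 2 \<le> real i * (h * R)" by linarith
    then have ih: "gap / (2 * R) \<le> real i * h" using R by (simp add: field_simps)
    \<comment> \<open>Enough steps of length h to cover \<delta>. Once J \<le> i is known, replacing
      the first i steps by J steps from A gives a polygon with at most N steps, which competes with
      x.\<close>
    define J where "J = nat \<lceil>\<delta> / h\<rceil>"
    have "\<delta> / h \<le> real J" "real J < \<delta> / h + 1"
      using pos h ceiling_correct[of "\<delta> / h"] by (auto simp: J_def of_nat_nat)
    then have J: "\<delta> \<le> real J * h" "real J * h < \<delta> + h" using h by (auto simp: field_simps)
    have J1: "J \<ge> 1" using J(1) pos by (cases J) auto
    have "\<delta> \<le> gap / (8 * R)" by (simp add: \<delta>_def)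
    moreover have "gap / (8 * R) + gap / (8 * R) \<le> gap / (2 * R)" using R gap_pos by (simp add: field_simps)
    ultimately have "real J * h \<le> real i * h" using J(2) hs(1) ih by linarith
    then have Ji: "J \<le> i" using h by simp
    have "infdist (x i) A < gap" using small gap_pos by (simp add: \<delta>_def)
    then obtain a where a: "a \<in> A" "dist (x i) a = infdist (x i) A" "closed_segment (x i) a \<subseteq> K"
      using access[of A "x i"] xK k by auto
    obtain y where y: "y 0 = a" "y J = x i" "\<And>i. i \<le> J \<Longrightarrow> y i \<in> K" "cost h y J \<le> real J * h * (Phi \<phi> 1 + C)"
    proof (rule segment_cost[of a "x i" J h C])
      show "closed_segment a (x i) \<subseteq> K" using a by (simp add: closed_segment_commute)
      show "dist a (x i) \<le> real J * h" using a(2) small J(1) by (simp add: dist_commute)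
    qed (use J1 h C in auto)
    define z where "z = cat J y (\<lambda>n. x (i + n))"
    have "polygon (J + (N - i)) z"
      unfolding polygon_def
    proof (intro conjI allI impI)
      show "z 0 \<in> A" using y(1) a(1) by (simp add: z_def cat_def)
      show "z (J + (N - i)) \<in> B" using y(2) ends k by (cases "i = N") (auto simp: z_def cat_def)
      show "z n \<in> K" if "n \<le> J + (N - i)" for n
        using that y(3) xK k by (auto simp: z_def cat_def)
    qed
    moreover have "1 \<le> J + (N - i)" "J + (N - i) \<le> N" using J1 Ji k by auto
    ultimately have "cost h x N \<le> cost h z (J + (N - i))" using opt unfolding optimal_def by blast
    also have "\<dots> = cost h y J + cost h (\<lambda>n. x (i + n)) (N - i)"
      unfolding z_def by (rule cost_cat) (simp add: y)
    finally have "cost h x i \<le> cost h y J" using cost_add[of h x i "N - i"] k by simp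
    also have "\<dots> \<le> (\<delta> + h) * E"
      by (rule order_trans[OF y(4)[folded E_def] mult_right_mono]) (use J(2) E in auto)
    also have "\<dots> \<le> (\<kappa> / (4 * E) + \<kappa> / (4 * E)) * E"
      using hs(2) E by (intro mult_right_mono add_mono) (auto simp: \<delta>_def)
    also have "\<dots> < \<kappa>" using E kap by (simp add: field_simps)
    finally show False using big by simp
  qed
  then show ?thesis using pos that by blast
qed

text \<open>Take the last visit near A and the first visit near B after it: in between the curve
  avoids both sets, so it stays in U, and by continuity the two end points lie in the
  closure.\<close>

lemma curve_crossing:
  fixes q :: "real \<Rightarrow> 'a"
  assumes q: "continuous_on UNIV q" and d: "0 \<le> \<delta>" "2 * \<delta> < gap"
    and t: "t1 < t2" "infdist (q t1) A \<le> \<delta>" "infdist (q t2) B \<le> \<delta>"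
  obtains s t where "s < t" "infdist (q s) A \<le> \<delta>" "infdist (q t) B \<le> \<delta>" "\<And>r. s \<le> r \<Longrightarrow> r \<le> t \<Longrightarrow> q r \<in> K"
proof -
  have ci: "continuous_on UNIV (\<lambda>r. infdist (q r) S)" for S by (intro continuous_intros q)
  have cl: "closed {r. infdist (q r) S \<le> \<delta>}" for S
    by (rule closed_Collect_le[OF ci continuous_on_const])
  have "compact ({t1..t2} \<inter> {r. infdist (q r) A \<le> \<delta>})" by (rule compact_Int_closed[OF compact_Icc cl])
  then obtain s where s: "s \<in> {t1..t2}" "infdist (q s) A \<le> \<delta>"
    "\<And>r. r \<in> {t1..t2} \<Longrightarrow> infdist (q r) A \<le> \<delta> \<Longrightarrow> r \<le> s"
    using compact_attains_sup[of "{t1..t2} \<inter> {r. infdist (q r) A \<le> \<delta>}"] t by fastforce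
  have "compact ({s..t2} \<inter> {r. infdist (q r) B \<le> \<delta>})" by (rule compact_Int_closed[OF compact_Icc cl])
  then obtain t where t': "t \<in> {s..t2}" "infdist (q t) B \<le> \<delta>"
    "\<And>r. r \<in> {s..t2} \<Longrightarrow> infdist (q r) B \<le> \<delta> \<Longrightarrow> t \<le> r"
    using compact_attains_inf[of "{s..t2} \<inter> {r. infdist (q r) B \<le> \<delta>}"] t s(1) by fastforce
  have st: "s < t" using gap_infdist_sum[of "q s"] s(2) t'(1,2) d(2) by (cases "s = t") auto
  have "q r \<in> U" if "s < r" "r < t" for r
  proof -
    have "infdist (q r) A > \<delta>" "infdist (q r) B > \<delta>"
      using s(3)[of r] t'(3)[of r] that s(1) t'(1) by force+
    then have "q r \<notin> A" "q r \<notin> B" using d(1) by auto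
    then show ?thesis using not_U by blast
  qed
  then have "q ` closure {s<..<t} \<subseteq> closure U"
    by (intro image_closure_subset continuous_on_subset[OF q]) (auto simp: closure_subset[THEN subsetD])
  then have "q r \<in> K" if "s \<le> r" "r \<le> t" for r using that st by (auto simp: K_def)
  then show ?thesis using that st s(2) t'(2) by blast
qed

text \<open>Sampling a crossing at equal steps does not increase the kinetic part, by the last
  hypothesis on L; the potential part becomes a Riemann sum, and straight pieces attach the ends to
  A and B. The Riemann error and the two end pieces take \<epsilon>/4 each.\<close>

lemma approximating_polygon:
  fixes q :: "real \<Rightarrow> 'a" and L :: "real \<Rightarrow> real"
  assumes q: "continuous_on UNIV q"
    and near: "\<And>\<delta>. \<delta> > 0 \<Longrightarrow> \<exists>s t. s < t \<and> infdist (q s) A < \<delta> \<and> infdist (q t) B < \<delta>"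
    and L: "\<And>a b. L integrable_on {a..b}" "\<And>a b. integral {a..b} L \<le> J"
      "\<And>a b. a < b \<Longrightarrow> (b - a) * Phi \<phi> (norm (q b - q a) / (b - a)) + integral {a..b} (\<lambda>t. f (q t)) \<le> integral {a..b} L"
    and e: "\<epsilon> > 0"
  obtains h N z where "0 < h" "h < \<epsilon>" "N \<ge> 1" "polygon N z" "cost h z N \<le> J + \<epsilon>"
proof -
  obtain C where C: "C \<ge> 0" "\<And>x. x \<in> K \<Longrightarrow> f x \<le> C" using f_bounded by metis
  define E where "E = Phi \<phi> 1 + C"
  have E: "E > 0" using Phi_pos[of 1] C(1) by (simp add: E_def)
  define \<delta> where "\<delta> = min (gap / 4) (\<epsilon> / (8 * E))"
  have d: "\<delta> > 0" "2 * \<delta> < gap" "\<delta> < gap" "\<delta> \<le> \<epsilon> / (8 * E)" using gap_pos e E by (auto simp: \<delta>_def)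
  obtain t1 t2 where t12: "t1 < t2" "infdist (q t1) A < \<delta>" "infdist (q t2) B < \<delta>" using near[OF d(1)] by blast
  obtain s t where st: "s < t" "infdist (q s) A \<le> \<delta>" "infdist (q t) B \<le> \<delta>"
    and qK: "\<And>r. s \<le> r \<Longrightarrow> r \<le> t \<Longrightarrow> q r \<in> K"
    using curve_crossing[OF q _ d(2) t12(1)] d(1) t12(2,3) by (metis less_imp_le)
  have cf: "continuous_on S (\<lambda>r. f (q r))" for S
    by (rule continuous_on_compose2[OF continuous_on_f[of UNIV] continuous_on_subset[OF q]]) auto
  \<comment> \<open>The oscillation allowed within one step, so that the Riemann sum over [s, t]
    errs by at most \<epsilon>/4.\<close>
  define \<omega> where "\<omega> = \<epsilon> / (4 * (t - s))"
  have om: "\<omega> > 0" using e st by (simp add: \<omega>_def)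
  have "uniformly_continuous_on {s..t} (\<lambda>r. f (q r))"
    by (rule compact_uniformly_continuous[OF cf compact_Icc])
  then obtain r0 where r0: "r0 > 0" "\<And>u v. u \<in> {s..t} \<Longrightarrow> v \<in> {s..t} \<Longrightarrow> \<bar>u - v\<bar> < r0 \<Longrightarrow> \<bar>f (q u) - f (q v)\<bar> < \<omega>"
    unfolding uniformly_continuous_on_def dist_real_def using om by metis
  define h1 where "h1 = min r0 (min \<epsilon> (\<epsilon> / (16 * E)))"
  have h1: "h1 > 0" using r0 e E by (simp add: h1_def)
  obtain n :: nat where n: "(t - s) / h1 < real n" using reals_Archimedean2 by blast
  have n0: "real n > 0" using n st h1 by (meson divide_pos_pos diff_gt_0_iff_gt less_trans)
  define h where "h = (t - s) / real n"
  have h: "0 < h" "h < h1" "real n * h = t - s"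
    using n n0 st h1 by (auto simp: h_def field_simps)
  define x where "x i = q (s + real i * h)" for i
  have in_st: "s + real i * h \<in> {s..t}" if "i \<le> n" for i
    using that h mult_right_mono[of "real i" "real n" h] by auto
  have xK: "x i \<in> K" if "i \<le> n" for i unfolding x_def using in_st[OF that] by (intro qK) auto
  have mid: "cost h x i \<le> integral {s..s + real i * h} L + real i * h * \<omega>" if "i \<le> n" for i
    using that
  proof (induction i)
    case (Suc i)
    let ?a = "s + real i * h" and ?b = "s + real (Suc i) * h"
    have ab: "?b - ?a = h" "?a < ?b" using h by (auto simp: algebra_simps)
    have ins: "?a \<in> {s..t}" "?b \<in> {s..t}"
      using in_st[of i] in_st[OF Suc.prems] Suc.prems by (simp_all only: Suc_leD)
    have lo: "f (q ?a) - \<omega> \<le> f (q r)" if "r \<in> {?a..?b}" for r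
    proof -
      have "r \<in> {s..t}" using that ins unfolding atLeastAtMost_iff by linarith
      moreover have "\<bar>?a - r\<bar> < r0" using that ab h by (auto simp: h1_def)
      ultimately show ?thesis using r0(2)[OF ins(1), of r] by linarith
    qed
    have "integral {?a..?b} (\<lambda>_. f (q ?a) - \<omega>) \<le> integral {?a..?b} (\<lambda>r. f (q r))"
      by (rule integral_le) (use lo in \<open>auto intro: integrable_continuous_real cf\<close>)
    then have "h * (f (x i) - \<omega>) \<le> integral {?a..?b} (\<lambda>r. f (q r))"
      using ab by (simp add: x_def)
    moreover have "h * Phi \<phi> (norm (x (Suc i) - x i) / h) + integral {?a..?b} (\<lambda>t. f (q t)) \<le> integral {?a..?b} L"
      using L(3)[OF ab(2)] unfolding ab(1) x_def .
    moreover have "integral {s..?a} L + integral {?a..?b} L = integral {s..?b} L"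
      by (rule Henstock_Kurzweil_Integration.integral_combine) (use ab h L in auto)
    ultimately show ?case using Suc by (simp add: cost_Suc algebra_simps)
  qed simp
  have "real n * h * \<omega> = \<epsilon> / 4" unfolding h(3) \<omega>_def using st by (simp add: divide_simps)
  then have costx: "cost h x n \<le> J + \<epsilon> / 4" using mid[of n] L(2)[of s "s + real n * h"] by simp
  \<comment> \<open>The number of steps of each end piece, traversed at speed at most 1; the bounds
    on \<delta> and h make its cost at most \<epsilon>/4.\<close>
  define k where "k = nat \<lceil>\<delta> / h\<rceil>"
  have "\<delta> / h \<le> real k" "real k < \<delta> / h + 1"
    using d h ceiling_correct[of "\<delta> / h"] by (auto simp: k_def of_nat_nat)
  then have k: "\<delta> \<le> real k * h" "real k * h < \<delta> + h" using h by (auto simp: field_simps)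
  have k1: "k \<ge> 1" using k(1) d by (cases k) auto
  have "\<delta> * E \<le> \<epsilon> / 8" using d(4) E by (simp add: field_simps)
  moreover have "h * E \<le> \<epsilon> / 16" using h(2) E by (simp add: h1_def field_simps)
  moreover have "real k * h * E \<le> (\<delta> + h) * E" using k(2) E by (intro mult_right_mono) auto
  ultimately have kE: "real k * h * E \<le> \<epsilon> / 4" using e by (simp add: algebra_simps)
  have ends: "x 0 = q s" "x n = q t" using h(3) by (auto simp: x_def)
  have "infdist (x 0) A < gap" "infdist (x n) B < gap" using st d ends by auto
  then obtain a b where a: "a \<in> A" "dist (x 0) a = infdist (x 0) A" "closed_segment (x 0) a \<subseteq> K"
    and b: "b \<in> B" "dist (x n) b = infdist (x n) B" "closed_segment (x n) b \<subseteq> K"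
    using access[of A "x 0"] access[of B "x n"] xK[of 0] xK[of n] by (metis le0 order_refl)
  obtain y where y: "y 0 = a" "y k = x 0" "\<And>i. i \<le> k \<Longrightarrow> y i \<in> K" "cost h y k \<le> real k * h * (Phi \<phi> 1 + C)"
  proof (rule segment_cost[of a "x 0" k h C])
    show "closed_segment a (x 0) \<subseteq> K" using a by (simp add: closed_segment_commute)
    show "dist a (x 0) \<le> real k * h" using a(2) st ends k(1) by (simp add: dist_commute)
  qed (use k1 h C in auto)
  obtain w where w: "w 0 = x n" "w k = b" "\<And>i. i \<le> k \<Longrightarrow> w i \<in> K" "cost h w k \<le> real k * h * (Phi \<phi> 1 + C)"
  proof (rule segment_cost[of "x n" b k h C])
    show "dist (x n) b \<le> real k * h" using b(2) st ends k(1) by simp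
  qed (use b k1 h C in auto)
  define z where "z = cat k y (cat n x w)"
  have "polygon (k + (n + k)) z"
    unfolding polygon_def z_def cat_def using y w a b xK k1
    by (auto simp: not_le split: if_splits)
  moreover have "cost h z (k + (n + k)) = cost h y k + (cost h x n + cost h w k)"
    unfolding z_def using w(1) y(2) by (subst cost_cat) (auto simp: cat_def[of n] cost_cat)
  then have "cost h z (k + (n + k)) \<le> J + \<epsilon>" using y(4) w(4) costx kE e by (simp add: E_def)
  moreover have "h < \<epsilon>" using h(2) by (simp add: h1_def)
  ultimately show ?thesis using that h(1) k1 by (metis le_add1 le_trans)
qed

end

section \<open>Passage to the limit\<close>

lemma floor_mult_close: "h > 0 \<Longrightarrow> \<bar>of_int \<lfloor>t / h\<rfloor> * h - t\<bar> \<le> (h::real)"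
proof -
  assume h: "h > 0"
  then show ?thesis
    using floor_divide_lower[OF h, of t] floor_divide_upper[OF h, of t] by (simp add: algebra_simps abs_le_iff)
qed

lemma floor_mult_tendsto:
  assumes "\<And>n::nat. h n > 0" "h \<longlonglongrightarrow> (0::real)"
  shows "(\<lambda>n. of_int \<lfloor>t / h n\<rfloor> * h n) \<longlonglongrightarrow> t"
proof (rule LIM_zero_cancel, rule Lim_null_comparison[OF _ assms(2)])
  show "\<forall>\<^sub>F n in sequentially. norm (of_int \<lfloor>t / h n\<rfloor> * h n - t) \<le> h n"
    using floor_mult_close[OF assms(1)] by simp
qed

lemma int_telescope:
  fixes u :: "int \<Rightarrow> 'b::real_normed_vector"
  assumes "\<And>k. min i j \<le> k \<Longrightarrow> k < max i j \<Longrightarrow> norm (u (k + 1) - u k - v) \<le> e"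
  shows "norm (u j - u i - of_int (j - i) *\<^sub>R v) \<le> of_int \<bar>j - i\<bar> * e"
proof -
  have up: "norm (u (i + int n) - u i - of_int (int n) *\<^sub>R v) \<le> of_int (int n) * e"
    if "\<And>k. i \<le> k \<Longrightarrow> k < i + int n \<Longrightarrow> norm (u (k + 1) - u k - v) \<le> e" for i n
    using that
  proof (induction n)
    case (Suc n)
    have "u (i + int (Suc n)) - u i - of_int (int (Suc n)) *\<^sub>R v =
        (u (i + int n + 1) - u (i + int n) - v) + (u (i + int n) - u i - of_int (int n) *\<^sub>R v)"
      by (simp add: algebra_simps)
    also have "norm \<dots> \<le> norm (u (i + int n + 1) - u (i + int n) - v) + norm (u (i + int n) - u i - of_int (int n) *\<^sub>R v)"
      by (rule norm_triangle_ineq)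
    also have "\<dots> \<le> e + of_int (int n) * e" using Suc by (intro add_mono) auto
    finally show ?case by (simp add: algebra_simps)
  qed simp
  show ?thesis
  proof (cases "i \<le> j")
    case True
    then show ?thesis using up[of i "nat (j - i)"] assms by (simp add: min_def max_def)
  next
    case False
    then have "norm (u i - u j - of_int (i - j) *\<^sub>R v) \<le> of_int (i - j) * e"
      using up[of j "nat (i - j)"] assms by (simp add: min_def max_def)
    moreover have "u j - u i - of_int (j - i) *\<^sub>R v = - (u i - u j - of_int (i - j) *\<^sub>R v)"
      by (simp add: algebra_simps)
    ultimately show ?thesis using False by (metis abs_minus_commute abs_of_pos diff_gt_0_iff_gt norm_minus_cancel not_le)
  qed
qed

text \<open>\<open>Y n i\<close> is the value of the \<open>n\<close>-th curve at time \<open>i * h n\<close>.\<close>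

locale discrete_curves =
  fixes Y :: "nat \<Rightarrow> int \<Rightarrow> 'b::euclidean_space" and h :: "nat \<Rightarrow> real" and C :: real
  assumes h: "\<And>n. h n > 0" "h \<longlonglongrightarrow> 0"
    and C: "C \<ge> 0" and step: "\<And>n i. norm (Y n (i + 1) - Y n i) \<le> C * h n"
begin

lemma lipschitz: "norm (Y n i - Y n j) \<le> C * \<bar>of_int i * h n - of_int j * h n\<bar>"
proof -
  have "norm (Y n i - Y n j - of_int (i - j) *\<^sub>R 0) \<le> of_int \<bar>i - j\<bar> * (C * h n)"
    by (rule int_telescope) (use step in simp)
  moreover have "\<bar>of_int i * h n - of_int j * h n\<bar> = of_int \<bar>i - j\<bar> * h n"
    using h(1)[of n] by (simp add: left_diff_distrib[symmetric] abs_mult)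
  ultimately show ?thesis by (simp add: algebra_simps)
qed

lemma lipschitz_floor: "norm (Y n i - Y n \<lfloor>t / h n\<rfloor>) \<le> C * (\<bar>of_int i * h n - t\<bar> + h n)"
  by (rule order_trans[OF lipschitz mult_left_mono[OF _ C]])
    (use floor_mult_close[OF h(1)[of n], of t] in linarith)

text \<open>The Arzela-Ascoli argument: sequential compactness of a countable product gives
  convergence at all rational times, and the common Lipschitz bound carries it over to real
  times.\<close>

lemma convergent_subsequence:
  assumes bd: "\<And>n i. norm (Y n i) \<le> B"
  shows "\<exists>r y. strict_mono (r :: nat \<Rightarrow> nat) \<and> (\<forall>t. (\<lambda>n. Y (r n) \<lfloor>t / h (r n)\<rfloor>) \<longlonglongrightarrow> y t)"
proof -
  define g where "g n = (\<lambda>\<rho>::rat. Y n \<lfloor>of_rat \<rho> / h n\<rfloor>)" for n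
  have "compactin (product_topology (\<lambda>i::rat. euclidean) UNIV) (PiE UNIV (\<lambda>_. cball (0::'b) B))"
    unfolding compactin_PiE by simp
  then have "compact (PiE (UNIV :: rat set) (\<lambda>_. cball (0::'b) B))"
    by (simp add: euclidean_product_topology compactin_euclidean_iff)
  then have "seq_compact (PiE (UNIV :: rat set) (\<lambda>_. cball (0::'b) B))"
    by (simp add: compact_eq_seq_compact_metric)
  moreover have "\<forall>n. g n \<in> PiE UNIV (\<lambda>_. cball 0 B)" using bd by (auto simp: g_def PiE_def Pi_def)
  ultimately obtain l r where r: "strict_mono (r :: nat \<Rightarrow> nat)" "(g \<circ> r) \<longlonglongrightarrow> l"
    unfolding seq_compact_def by blast
  have rat: "(\<lambda>n. Y (r n) \<lfloor>of_rat \<rho> / h (r n)\<rfloor>) \<longlonglongrightarrow> l \<rho>" for \<rho>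
  proof -
    have "isCont (\<lambda>f::rat \<Rightarrow> 'b. f \<rho>) l"
      using continuous_on_eq_continuous_at[OF open_UNIV, THEN iffD1, OF continuous_on_product_coordinates[of \<rho>]]
      by blast
    from isCont_tendsto_compose[OF this r(2)] show ?thesis by (simp add: g_def)
  qed
  have hr: "(\<lambda>n. h (r n)) \<longlonglongrightarrow> 0" using LIMSEQ_subseq_LIMSEQ[OF h(2) r(1)] by (simp add: o_def)
  have "convergent (\<lambda>n. Y (r n) \<lfloor>t / h (r n)\<rfloor>)" for t
  proof (rule Cauchy_convergent, rule metric_CauchyI)
    fix e :: real assume e: "e > 0"
    \<comment> \<open>Moving from t to a rational time within d then changes every late curve by at
      most e/3; the divisor is C + 1 because C may be 0.\<close>
    define d where "d = e / 6 / (C + 1)"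
    have "d > 0" "d * (C + 1) = e / 6"
      using e C nonzero_eq_divide_eq[of "C + 1" d "e / 6"] by (auto simp: d_def)
    then have d: "d > 0" "C * (d + d) \<le> e / 3" using e by (auto simp: algebra_simps)
    obtain \<rho> where rho: "t < of_rat \<rho>" "of_rat \<rho> < t + d" using of_rat_dense[of t "t + d"] d by auto
    obtain n1 where n1: "\<And>n. n \<ge> n1 \<Longrightarrow> h (r n) < d / 2"
      using order_tendstoD(2)[OF hr, of "d / 2"] d by (auto simp: eventually_sequentially)
    obtain n2 where n2: "\<And>m n. m \<ge> n2 \<Longrightarrow> n \<ge> n2 \<Longrightarrow>
        dist (Y (r m) \<lfloor>of_rat \<rho> / h (r m)\<rfloor>) (Y (r n) \<lfloor>of_rat \<rho> / h (r n)\<rfloor>) < e / 3"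
      using metric_CauchyD[OF LIMSEQ_imp_Cauchy[OF rat[of \<rho>]], of "e / 3"] e by auto
    have cl: "dist (Y (r n) \<lfloor>t / h (r n)\<rfloor>) (Y (r n) \<lfloor>of_rat \<rho> / h (r n)\<rfloor>) \<le> e / 3" if "n \<ge> n1" for n
    proof -
      have "dist (Y (r n) \<lfloor>t / h (r n)\<rfloor>) (Y (r n) \<lfloor>of_rat \<rho> / h (r n)\<rfloor>) \<le>
          C * (\<bar>of_int \<lfloor>t / h (r n)\<rfloor> * h (r n) - of_rat \<rho>\<bar> + h (r n))"
        unfolding dist_norm by (rule lipschitz_floor)
      also have "\<dots> \<le> C * (d + d)"
        using floor_mult_close[OF h(1)[of "r n"], of t] n1[OF that] rho
        by (intro mult_left_mono C) linarith
      also note d(2)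
      finally show ?thesis .
    qed
    show "\<exists>M. \<forall>m\<ge>M. \<forall>n\<ge>M. dist (Y (r m) \<lfloor>t / h (r m)\<rfloor>) (Y (r n) \<lfloor>t / h (r n)\<rfloor>) < e"
    proof (intro exI allI impI)
      fix m n assume mn: "m \<ge> max n1 n2" "n \<ge> max n1 n2"
      let ?a = "\<lambda>n. Y (r n) \<lfloor>t / h (r n)\<rfloor>" and ?b = "\<lambda>n. Y (r n) \<lfloor>of_rat \<rho> / h (r n)\<rfloor>"
      have "dist (?a m) (?a n) \<le> dist (?a m) (?b m) + dist (?b m) (?b n) + dist (?a n) (?b n)"
        using dist_triangle[of "?a m" "?a n" "?b m"] dist_triangle[of "?b m" "?a n" "?b n"]
        by (simp add: dist_commute)
      then show "dist (?a m) (?a n) < e" using cl[of m] cl[of n] n2[of m n] mn by simp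
    qed
  qed
  then have "\<forall>t. \<exists>l. (\<lambda>n. Y (r n) \<lfloor>t / h (r n)\<rfloor>) \<longlonglongrightarrow> l" by (simp add: convergent_def)
  then obtain y where "\<And>t. (\<lambda>n. Y (r n) \<lfloor>t / h (r n)\<rfloor>) \<longlonglongrightarrow> y t" by metis
  then show ?thesis using r(1) by blast
qed

lemma subsequence:
  assumes "strict_mono (r :: nat \<Rightarrow> nat)"
  shows "discrete_curves (\<lambda>n. Y (r n)) (\<lambda>n. h (r n)) C"
  by unfold_locales (use h C step LIMSEQ_subseq_LIMSEQ[OF h(2) assms] in \<open>auto simp: o_def\<close>)

context
  fixes y assumes y: "\<And>t. (\<lambda>n. Y n \<lfloor>t / h n\<rfloor>) \<longlonglongrightarrow> y t"
begin

lemma limit_lipschitz: "norm (y t - y s) \<le> C * \<bar>t - s\<bar>"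
proof (rule LIMSEQ_le)
  show "(\<lambda>n. norm (Y n \<lfloor>t / h n\<rfloor> - Y n \<lfloor>s / h n\<rfloor>)) \<longlonglongrightarrow> norm (y t - y s)"
    by (intro tendsto_intros y)
  show "(\<lambda>n. C * \<bar>of_int \<lfloor>t / h n\<rfloor> * h n - of_int \<lfloor>s / h n\<rfloor> * h n\<bar>) \<longlonglongrightarrow> C * \<bar>t - s\<bar>"
    by (intro tendsto_intros floor_mult_tendsto h)
qed (use lipschitz in auto)

lemma limit_continuous: "continuous_on S y"
proof (rule continuous_on_subset[of UNIV])
  show "continuous_on UNIV y"
    unfolding continuous_on_iff
  proof (intro ballI allI impI)
    fix t e :: real assume "e > 0"
    show "\<exists>d>0. \<forall>t'\<in>UNIV. dist t' t < d \<longrightarrow> dist (y t') (y t) < e"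
    proof (intro exI conjI ballI impI)
      show "e / (C + 1) > 0" using \<open>e > 0\<close> C by simp
      fix t' assume d: "dist t' t < e / (C + 1)"
      have "dist (y t') (y t) \<le> C * \<bar>t' - t\<bar>" using limit_lipschitz by (simp add: dist_norm)
      also have "\<dots> \<le> (C + 1) * \<bar>t' - t\<bar>" by (simp add: algebra_simps)
      also have "\<dots> < e" using d C by (simp add: dist_real_def field_simps)
      finally show "dist (y t') (y t) < e" .
    qed
  qed
qed simp

text \<open>Pointwise convergence and the common Lipschitz bound control all indices whose time is
  close to s. The next index is included because one-step increments will be needed.\<close>

lemma near:
  assumes e: "e > 0"
  obtains d n0 where "d > 0" "\<And>n i. n \<ge> n0 \<Longrightarrow> \<bar>of_int i * h n - s\<bar> < d \<Longrightarrow>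
    norm (Y n i - y s) < e \<and> norm (Y n (i + 1) - y s) < e"
proof -
  define d where "d = e / 6 / (C + 1)"
  have "d > 0" "d * (C + 1) = e / 6"
      using e C nonzero_eq_divide_eq[of "C + 1" d "e / 6"] by (auto simp: d_def)
  then have d: "d > 0" "C * (3 * d) \<le> e / 2" using e by (auto simp: algebra_simps)
  obtain n1 where n1: "\<And>n. n \<ge> n1 \<Longrightarrow> h n < d"
    using order_tendstoD(2)[OF h(2) d(1)] by (auto simp: eventually_sequentially)
  obtain n2 where n2: "\<And>n. n \<ge> n2 \<Longrightarrow> norm (Y n \<lfloor>s / h n\<rfloor> - y s) < e / 2"
    using LIMSEQ_D[OF y[of s], of "e/2"] e by auto
  have "norm (Y n j - y s) < e" if n: "n \<ge> max n1 n2" and j: "\<bar>of_int j * h n - s\<bar> < 2 * d" for n j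
  proof -
    have "norm (Y n j - Y n \<lfloor>s / h n\<rfloor>) \<le> C * (\<bar>of_int j * h n - s\<bar> + h n)" by (rule lipschitz_floor)
    also have "\<dots> \<le> C * (3 * d)" using j n1[of n] n by (intro mult_left_mono C) linarith
    finally have "norm (Y n j - Y n \<lfloor>s / h n\<rfloor>) \<le> e / 2" using d(2) by linarith
    moreover have "norm (Y n \<lfloor>s / h n\<rfloor> - y s) < e / 2" using n2 n by simp
    moreover have "norm (Y n j - y s) \<le> norm (Y n j - Y n \<lfloor>s / h n\<rfloor>) + norm (Y n \<lfloor>s / h n\<rfloor> - y s)"
      by (metis add_diff_cancel_left' diff_add_cancel diff_diff_eq2 norm_triangle_ineq diff_add_eq)
    ultimately show ?thesis by linarith
  qed
  note close = this
  show ?thesis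
  proof (rule that[OF d(1), of "max n1 n2"])
    fix n i assume n: "n \<ge> max n1 n2" and i: "\<bar>of_int i * h n - s\<bar> < d"
    have hn: "h n < d" "h n > 0" using n1 n h(1) by auto
    have "\<bar>of_int (i + 1) * h n - s\<bar> < 2 * d" using i hn by (simp add: algebra_simps abs_less_iff)
    then show "norm (Y n i - y s) < e \<and> norm (Y n (i + 1) - y s) < e"
      using close[OF n, of i] close[OF n, of "i + 1"] i d by simp
  qed
qed

end

end

text \<open>Increments equal to h W up to e h, uniformly near s, telescope between the grid points
  below s and t; the limit is the differentiability estimate with error e |t - s|.\<close>

lemma discrete_derivative:
  fixes u :: "nat \<Rightarrow> int \<Rightarrow> 'b::real_normed_vector"
  assumes h: "\<And>n. h n > 0" "h \<longlonglongrightarrow> 0"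
    and u: "\<And>t. (\<lambda>n. u n \<lfloor>t / h n\<rfloor>) \<longlonglongrightarrow> y t"
    and d: "\<And>e. e > 0 \<Longrightarrow> \<exists>d>0. \<exists>n0. \<forall>n\<ge>n0. \<forall>i. \<bar>of_int i * h n - s\<bar> < d \<longrightarrow>
        norm (u n (i + 1) - u n i - h n *\<^sub>R W) \<le> e * h n"
  shows "(y has_vector_derivative W) (at s)"
  unfolding has_vector_derivative_def has_derivative_at_alt
proof (intro conjI allI impI)
  show "bounded_linear (\<lambda>x. x *\<^sub>R W)" by (rule bounded_linear_scaleR_left)
  fix e :: real assume "e > 0"
  then obtain d n0 where d: "d > 0" "\<And>n i. n \<ge> n0 \<Longrightarrow> \<bar>of_int i * h n - s\<bar> < d \<Longrightarrow>
        norm (u n (i + 1) - u n i - h n *\<^sub>R W) \<le> e * h n" using d by metis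
  show "\<exists>d>0. \<forall>t. norm (t - s) < d \<longrightarrow> norm (y t - y s - (t - s) *\<^sub>R W) \<le> e * norm (t - s)"
  proof (intro exI conjI allI impI)
    show "d / 2 > 0" using d by simp
    fix t assume t: "norm (t - s) < d / 2"
    obtain n1 where n1: "\<And>n. n \<ge> n1 \<Longrightarrow> h n < d / 2"
      using order_tendstoD(2)[OF h(2), of "d/2"] d(1) by (auto simp: eventually_sequentially)
    have bound: "norm (u n \<lfloor>t / h n\<rfloor> - u n \<lfloor>s / h n\<rfloor> - (of_int \<lfloor>t / h n\<rfloor> * h n - of_int \<lfloor>s / h n\<rfloor> * h n) *\<^sub>R W)
        \<le> e * \<bar>of_int \<lfloor>t / h n\<rfloor> * h n - of_int \<lfloor>s / h n\<rfloor> * h n\<bar>" if n: "n \<ge> max n0 n1" for n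
    proof -
      let ?i = "\<lfloor>s / h n\<rfloor>" and ?j = "\<lfloor>t / h n\<rfloor>"
      have "norm (u n ?j - u n ?i - of_int (?j - ?i) *\<^sub>R (h n *\<^sub>R W)) \<le> of_int \<bar>?j - ?i\<bar> * (e * h n)"
      proof (rule int_telescope)
        fix k assume k: "min ?i ?j \<le> k" "k < max ?i ?j"
        have "of_int (min ?i ?j) * h n \<le> of_int k * h n" "of_int k * h n \<le> of_int (max ?i ?j) * h n"
          using k h(1)[of n] by (auto intro!: mult_right_mono)
        moreover have "of_int (min ?i ?j) * h n \<ge> min s t - h n"
          using floor_mult_close[OF h(1)[of n], of s] floor_mult_close[OF h(1)[of n], of t]
          by (auto simp: min_def abs_le_iff)
        moreover have "of_int (max ?i ?j) * h n \<le> max s t"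
          using floor_divide_lower[OF h(1)[of n], of s] floor_divide_lower[OF h(1)[of n], of t]
          by (auto simp: max_def)
        ultimately have "\<bar>of_int k * h n - s\<bar> < d"
          using n1[of n] n t by (auto simp: abs_less_iff min_def max_def split: if_splits)
        then show "norm (u n (k + 1) - u n k - h n *\<^sub>R W) \<le> e * h n" using d(2) n by auto
      qed
      moreover have "\<bar>of_int ?j * h n - of_int ?i * h n\<bar> = of_int \<bar>?j - ?i\<bar> * h n"
        using h(1)[of n] by (simp add: left_diff_distrib[symmetric] abs_mult)
      ultimately show ?thesis by (simp add: left_diff_distrib algebra_simps)
    qed
    have "norm (y t - y s - (t - s) *\<^sub>R W) \<le> e * \<bar>t - s\<bar>"
    proof (rule LIMSEQ_le)
      show "(\<lambda>n. norm (u n \<lfloor>t / h n\<rfloor> - u n \<lfloor>s / h n\<rfloor> - (of_int \<lfloor>t / h n\<rfloor> * h n - of_int \<lfloor>s / h n\<rfloor> * h n) *\<^sub>R W))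
          \<longlonglongrightarrow> norm (y t - y s - (t - s) *\<^sub>R W)"
        by (intro tendsto_intros u floor_mult_tendsto h)
      show "(\<lambda>n. e * \<bar>of_int \<lfloor>t / h n\<rfloor> * h n - of_int \<lfloor>s / h n\<rfloor> * h n\<bar>) \<longlonglongrightarrow> e * \<bar>t - s\<bar>"
        by (intro tendsto_intros floor_mult_tendsto h)
    qed (use bound in blast)
    then show "norm (y t - y s - (t - s) *\<^sub>R W) \<le> e * norm (t - s)" by simp
  qed
qed

context well
begin

text \<open>The limit S of the partial costs takes the place of a lower semicontinuity theorem: its
  total increase is at most \<mu>, and it is an antiderivative of the Lagrangian as long as q is in
  U.\<close>

lemma limit_curve:
  assumes ap: "\<And>\<epsilon>. \<epsilon> > 0 \<Longrightarrow> \<exists>h N z. 0 < h \<and> h < \<epsilon> \<and> N \<ge> 1 \<and> polygon N z \<and> cost h z N \<le> \<mu> + \<epsilon>"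
  obtains q p :: "real \<Rightarrow> 'a" and S :: "real \<Rightarrow> real" and R \<delta> L where
    "R > 0" "\<delta> > 0" "L > 0" "\<And>s t. norm (q t - q s) \<le> L * \<bar>t - s\<bar>"
    "continuous_on UNIV p" "continuous_on UNIV S" "\<And>t. norm (p t) \<le> flux R"
    "\<And>t. q t \<in> K" "\<And>t. t \<le> 0 \<Longrightarrow> infdist (q t) A \<le> gap / 2" "infdist (q 0) A = gap / 2"
    "\<And>t. t \<ge> 0 \<Longrightarrow> \<delta> \<le> infdist (q t) A" "mono S" "\<And>t. 0 \<le> S t" "\<And>t. S t \<le> \<mu>"
    "\<And>t. q t \<in> U \<Longrightarrow> (q has_vector_derivative vel (p t)) (at t)"
    "\<And>t. q t \<in> U \<Longrightarrow> (p has_vector_derivative df (q t)) (at t)"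
    "\<And>t. q t \<in> U \<Longrightarrow> (S has_real_derivative Phi \<phi> (norm (vel (p t))) + f (q t)) (at t)"
proof -
  obtain R where R: "R > 0" "\<And>h N x i. 0 < h \<Longrightarrow> h \<le> 1 \<Longrightarrow> optimal h N x \<Longrightarrow> cost h x N \<le> \<mu> + 1 \<Longrightarrow> i < N \<Longrightarrow>
    norm (x (Suc i) - x i) \<le> h * R" using velocity_bound by metis
  obtain \<delta> h0 where \<delta>: "\<delta> > 0" "h0 > 0"
    "\<And>h N x k i. 0 < h \<Longrightarrow> h < h0 \<Longrightarrow> optimal h N x \<Longrightarrow> (\<And>i. i < N \<Longrightarrow> norm (x (Suc i) - x i) \<le> h * R) \<Longrightarrow>
      gap / 2 \<le> infdist (x k) A \<Longrightarrow> k \<le> i \<Longrightarrow> i \<le> N \<Longrightarrow> \<delta> \<le> infdist (x i) A"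
    by (rule no_return[OF R(1)]) blast
  obtain C where C: "C \<ge> 0" "\<And>x. x \<in> K \<Longrightarrow> f x \<le> C" "\<And>x. x \<in> K \<Longrightarrow> norm (df x) \<le> C" using f_bounded by metis
  \<comment> \<open>Small enough for \<open>velocity_bound\<close> and \<open>no_return\<close>, and
    tending to 0.\<close>
  define \<epsilon> where "\<epsilon> n = min (1 / (real n + 1)) (min h0 1)" for n
  have \<epsilon>: "\<epsilon> n > 0" "\<epsilon> n \<le> 1 / (real n + 1)" "\<epsilon> n \<le> h0" "\<epsilon> n \<le> 1" for n using \<delta>(2) by (auto simp: \<epsilon>_def)
  have "\<exists>h N x. 0 < h \<and> h < \<epsilon> n \<and> optimal h N x \<and> cost h x N \<le> \<mu> + \<epsilon> n" for n
  proof -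
    obtain h N z where z: "0 < h" "h < \<epsilon> n" "N \<ge> 1" "polygon N z" "cost h z N \<le> \<mu> + \<epsilon> n"
      using ap[OF \<epsilon>(1)] by blast
    obtain N' x where "optimal h N' x" "cost h x N' \<le> cost h z N" using exists_optimal[OF z(3,1,4)] .
    then show ?thesis using z by (intro exI[of _ h] exI[of _ N'] exI[of _ x]) auto
  qed
  then obtain h N x where hx: "\<And>n. 0 < h n" "\<And>n. h n < \<epsilon> n" "\<And>n. optimal (h n) (N n) (x n)"
    "\<And>n. cost (h n) (x n) (N n) \<le> \<mu> + \<epsilon> n" by metis
  have hlim: "h \<longlonglongrightarrow> 0"
  proof (rule tendsto_sandwich[OF _ _ tendsto_const])
    show "(\<lambda>n. 1 / (real n + 1)) \<longlonglongrightarrow> 0" by real_asymp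
    show "\<forall>\<^sub>F n in sequentially. 0 \<le> h n" using hx(1) by (auto simp: less_imp_le)
    show "\<forall>\<^sub>F n in sequentially. h n \<le> 1 / (real n + 1)" using hx(2) \<epsilon>(2) by (force intro: always_eventually less_imp_le less_le_trans)
  qed
  have poly: "polygon (N n) (x n)" and N1: "N n \<ge> 1" for n using hx(3)[of n] by (auto simp: optimal_def)
  have xK: "x n i \<in> K" if "i \<le> N n" for n i using poly[of n] that by (auto simp: polygon_def)
  have hs: "h n \<le> 1" "h n < h0" "cost (h n) (x n) (N n) \<le> \<mu> + 1" for n
    using hx(2)[of n] hx(4)[of n] \<epsilon>[of n] by linarith+
  have st: "norm (x n (Suc i) - x n i) \<le> h n * R" if "i < N n" for n i
    by (rule R(2)[OF hx(1) hs(1) hx(3) hs(3) that])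
  \<comment> \<open>The first exit from the gap/2-neighbourhood of A, which becomes time 0; the step
    leading there is short, so the limit is at distance exactly gap/2.\<close>
  define k where "k n = (LEAST k. gap / 2 \<le> infdist (x n k) A)" for n
  have exk: "gap / 2 \<le> infdist (x n (N n)) A" for n
    using gap_le_infdist[of "x n (N n)"] poly[of n] gap_pos by (auto simp: polygon_def)
  have k: "gap / 2 \<le> infdist (x n (k n)) A" "k n \<le> N n" for n
    unfolding k_def using exk by (rule LeastI) (rule Least_le, rule exk)
  have before: "infdist (x n i) A < gap / 2" if "i < k n" for n i
    using not_less_Least[OF that[unfolded k_def]] by simp
  have k0: "k n > 0" for n
    using k(1)[of n] poly[of n] gap_pos by (cases "k n") (auto simp: polygon_def)
  \<comment> \<open>Time 0 corresponds to vertex k n; before its start and after its end the polygon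
    rests at its end vertices.\<close>
  define idx where "idx n i = nat (min (int (N n)) (max 0 (i + int (k n))))" for n i
  have idx_le: "idx n i \<le> N n" for n i by (auto simp: idx_def)
  have idx_step: "idx n (i + 1) = idx n i \<or> idx n i < N n \<and> idx n (i + 1) = Suc (idx n i)" for n i
    by (auto simp: idx_def min_def max_def)
  have idx_int: "idx n (i + 1) = Suc (idx n i)" if "0 < idx n i" "idx n i < N n" for n i
    using that by (auto simp: idx_def min_def max_def split: if_splits)
  have idx_mono: "idx n i \<le> idx n j" if "i \<le> j" for n i j
    using that by (auto simp: idx_def)
  have idx_less: "idx n i < k n" if "i < 0" for n i
    using that k0[of n] by (auto simp: idx_def nat_less_iff)
  have idx_ge: "k n \<le> idx n i" if "i \<ge> 0" for n i
    using that k(2)[of n] by (auto simp: idx_def le_nat_iff)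
  define X where "X n i = x n (idx n i)" for n i
  \<comment> \<open>No step starts at the last vertex, which is given the momentum of the last
    step.\<close>
  define P where "P n i = momentum (h n) (x n) (min (idx n i) (N n - 1))" for n i
  define SS where "SS n i = cost (h n) (x n) (idx n i)" for n i
  have XK: "X n i \<in> K" for n i using xK[OF idx_le] by (simp add: X_def)
  have SSm: "SS n i \<le> SS n j" if "i \<le> j" for n i j
    unfolding SS_def using idx_le xK by (intro cost_mono hx idx_mono that) (meson le_trans)
  have SS0: "0 \<le> SS n i" for n i
    unfolding SS_def using idx_le xK by (intro cost_nonneg hx) (meson le_trans)
  have SSl: "SS n i \<le> \<mu> + \<epsilon> n" for n i
  proof -
    have "SS n i \<le> cost (h n) (x n) (N n)" unfolding SS_def by (rule cost_mono[OF hx(1) xK idx_le])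
    then show ?thesis using hx(4)[of n] by linarith
  qed
  have Pb: "norm (P n i) \<le> flux R" for n i
  proof -
    have "min (idx n i) (N n - 1) < N n" using N1[of n] by auto
    note s = st[OF this]
    have "norm ((1 / h n) *\<^sub>R v) \<le> R" if "norm v \<le> h n * R" for v :: 'a
      using hx(1)[of n] that by (simp add: field_simps)
    from this[OF s] show ?thesis unfolding P_def norm_mom by (intro flux_mono norm_ge_zero)
  qed
  obtain BK where BK: "\<And>x. x \<in> K \<Longrightarrow> norm x \<le> BK"
    using compact_imp_bounded[OF compact_K] unfolding bounded_iff by blast
  \<comment> \<open>One sequence in the product space, so that a single subsequence serves
    positions, momenta and costs.\<close>
  define Y where "Y n i = (X n i, P n i, SS n i)" for n i
  define Ct where "Ct = R + C + (Phi \<phi> R + C)"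
  have Ct: "Ct > 0" using R(1) C(1) Phi_nonneg[of R] by (simp add: Ct_def)
  have np: "norm (a, b, c) \<le> norm a + norm b + norm c" for a b :: 'a and c :: real
    using norm_Pair_le[of a "(b, c)"] norm_Pair_le[of b c] by linarith
  have stepX: "norm (X n (i + 1) - X n i) \<le> R * h n" for n i
    using idx_step[of n i] st[of "idx n i" n] R(1) hx(1)[of n] by (auto simp: X_def mult.commute)
  have stepP: "norm (P n (i + 1) - P n i) \<le> C * h n" for n i
  proof -
    let ?a = "min (idx n i) (N n - 1)" and ?b = "min (idx n (i + 1)) (N n - 1)"
    have ab: "?a \<le> ?b" "?b < N n" "?b - ?a \<le> 1" using idx_step[of n i] N1[of n] by auto
    have "norm (P n (i + 1) - P n i) \<le> real (?b - ?a) * h n * C"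
      unfolding P_def by (rule momentum_lipschitz[OF hx(3) hx(1) C(3) ab(1,2)])
    also have "\<dots> \<le> 1 * h n * C" using ab(3) hx(1)[of n] C(1) by (intro mult_right_mono) auto
    finally show ?thesis by (simp add: mult.commute)
  qed
  have stepS: "norm (SS n (i + 1) - SS n i) \<le> (Phi \<phi> R + C) * h n" for n i
  proof (cases "idx n (i + 1) = idx n i")
    case False
    then have j: "idx n i < N n" "idx n (i + 1) = Suc (idx n i)" using idx_step[of n i] by auto
    let ?j = "idx n i"
    have "norm (x n (Suc ?j) - x n ?j) / h n \<le> R" using st[OF j(1)] hx(1)[of n] by (simp add: field_simps)
    then have "Phi \<phi> (norm (x n (Suc ?j) - x n ?j) / h n) + f (x n ?j) \<le> Phi \<phi> R + C"
      using C(2)[OF xK] j(1) hx(1)[of n] by (intro add_mono Phi_mono) auto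
    then have "h n * (Phi \<phi> (norm (x n (Suc ?j) - x n ?j) / h n) + f (x n ?j)) \<le> h n * (Phi \<phi> R + C)"
      using hx(1)[of n] by (intro mult_left_mono) auto
    moreover have "SS n (i + 1) - SS n i \<ge> 0" using SSm[of i "i + 1" n] by simp
    ultimately show ?thesis using j(2) by (simp add: SS_def cost_Suc mult.commute)
  qed (use hx(1)[of n] Phi_nonneg[of R] R(1) C(1) in \<open>simp add: SS_def\<close>)
  interpret D: discrete_curves Y h Ct
  proof
    show "0 < h n" for n by (rule hx)
    show "h \<longlonglongrightarrow> 0" by (rule hlim)
    show "0 \<le> Ct" using Ct by simp
    show "norm (Y n (i + 1) - Y n i) \<le> Ct * h n" for n i
      using np[of "X n (i + 1) - X n i" "P n (i + 1) - P n i" "SS n (i + 1) - SS n i"]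
        stepX[of n i] stepP[of n i] stepS[of n i]
      by (simp add: Y_def Ct_def algebra_simps)
  qed
  have "norm (Y n i) \<le> BK + flux R + (\<mu> + 1)" for n i
    using np[of "X n i" "P n i" "SS n i"] BK[OF XK[of n i]] Pb[of n i] SS0[of n i] SSl[of n i] \<epsilon>(4)[of n]
    by (simp add: Y_def)
  from D.convergent_subsequence[OF this] obtain r y where r: "strict_mono (r :: nat \<Rightarrow> nat)"
    and y: "\<And>t. (\<lambda>n. Y (r n) \<lfloor>t / h (r n)\<rfloor>) \<longlonglongrightarrow> y t"
    by blast
  interpret E: discrete_curves "\<lambda>n. Y (r n)" "\<lambda>n. h (r n)" Ct by (rule D.subsequence[OF r])
  define q where "q t = fst (y t)" for t
  define p where "p t = fst (snd (y t))" for t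
  define S where "S t = snd (snd (y t))" for t
  have q: "(\<lambda>n. X (r n) \<lfloor>t / h (r n)\<rfloor>) \<longlonglongrightarrow> q t" for t
    using tendsto_fst[OF y[of t]] by (simp add: Y_def q_def)
  have p: "(\<lambda>n. P (r n) \<lfloor>t / h (r n)\<rfloor>) \<longlonglongrightarrow> p t" for t
    using tendsto_fst[OF tendsto_snd[OF y[of t]]] by (simp add: Y_def p_def)
  have S: "(\<lambda>n. SS (r n) \<lfloor>t / h (r n)\<rfloor>) \<longlonglongrightarrow> S t" for t
    using tendsto_snd[OF tendsto_snd[OF y[of t]]] by (simp add: Y_def S_def)
  have nfst: "norm (fst z) \<le> norm z" for z :: "'a \<times> 'a \<times> real" by (cases z) (simp add: norm_fst_le)
  have nsnd: "norm (fst (snd z)) \<le> norm z" for z :: "'a \<times> 'a \<times> real"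
    by (cases z) (metis fst_conv norm_fst_le norm_snd_le order_trans snd_conv)
  have cy: "continuous_on UNIV y" by (rule E.limit_continuous[OF y])
  have floor_pos: "\<lfloor>t / h n\<rfloor> \<ge> 0" if "t \<ge> 0" for t n using that hx(1)[of n] by simp
  have floor_neg: "\<lfloor>t / h n\<rfloor> < 0" if "t < 0" for t n using that hx(1)[of n] by (simp add: field_simps)
  have cinf: "((\<lambda>n. infdist (X (r n) \<lfloor>t / h (r n)\<rfloor>) A) \<longlonglongrightarrow> infdist (q t) A)" for t
    by (intro tendsto_infdist q)
  have q0: "infdist (q 0) A = gap / 2"
  proof (rule antisym)
    have X0: "X n 0 = x n (k n)" for n using k(2)[of n] by (simp add: X_def idx_def)
    show "infdist (q 0) A \<le> gap / 2"
    proof (rule LIMSEQ_le)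
      show "(\<lambda>n. infdist (X (r n) \<lfloor>0 / h (r n)\<rfloor>) A) \<longlonglongrightarrow> infdist (q 0) A" by (rule cinf)
      have "(\<lambda>n. gap / 2 + h (r n) * R) \<longlonglongrightarrow> gap / 2 + 0 * R"
        by (intro tendsto_intros E.h)
      then show "(\<lambda>n. gap / 2 + h (r n) * R) \<longlonglongrightarrow> gap / 2" by simp
      have "infdist (x n (k n)) A \<le> gap / 2 + h n * R" for n
      proof -
        have e: "Suc (k n - 1) = k n" "k n - 1 < k n" using k0[of n] by auto
        then show ?thesis
          using infdist_step[OF st[of "k n - 1" n], of A] before[of "k n - 1" n] k(2)[of n] by simp
      qed
      then show "\<exists>N. \<forall>n\<ge>N. infdist (X (r n) \<lfloor>0 / h (r n)\<rfloor>) A \<le> gap / 2 + h (r n) * R" by (simp add: X0)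
    qed
    show "gap / 2 \<le> infdist (q 0) A"
      by (rule LIMSEQ_le_const[OF cinf]) (use k(1) X0 in simp)
  qed
  \<comment> \<open>Near a time at which the limit is in U the late polygons are in U too, hence at
    inner vertices; so no index is clamped and the exact discrete equations hold.\<close>
  have hnear: "\<exists>d>0. \<exists>n0. \<forall>n\<ge>n0. \<forall>i. \<bar>of_int i * h (r n) - s\<bar> < d \<longrightarrow>
      norm (X (r n) i - q s) < e \<and> norm (P (r n) i - p s) < e \<and> norm (X (r n) (i + 1) - q s) < e \<and>
      X (r n) (i + 1) - X (r n) i = h (r n) *\<^sub>R vel (P (r n) i) \<and>
      P (r n) (i + 1) - P (r n) i = h (r n) *\<^sub>R df (X (r n) (i + 1)) \<and>
      SS (r n) (i + 1) - SS (r n) i = h (r n) * (Phi \<phi> (norm (vel (P (r n) i))) + f (X (r n) i))"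
    if sU: "q s \<in> U" and e: "e > 0" for s e
  proof -
    obtain e0 where e0: "e0 > 0" "ball (q s) e0 \<subseteq> U" using open_U sU open_contains_ball by blast
    obtain d n0 where d: "d > 0" and dn: "\<And>n i. n \<ge> n0 \<Longrightarrow> \<bar>of_int i * h (r n) - s\<bar> < d \<Longrightarrow>
        norm (Y (r n) i - y s) < min e e0 \<and> norm (Y (r n) (i + 1) - y s) < min e e0"
      by (rule E.near[OF y, of "min e e0" s]) (use e e0 in auto)
    show ?thesis
    proof (rule exI[of _ d], intro conjI d, rule exI[of _ n0], intro allI impI)
      fix n i assume n: "n0 \<le> n" and i: "\<bar>of_int i * h (r n) - s\<bar> < d"
      note cl = dn[OF n i]
      have a: "norm (X (r n) i - q s) < min e e0" "norm (P (r n) i - p s) < min e e0" "norm (X (r n) (i+1) - q s) < min e e0"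
        using cl nfst[of "Y (r n) i - y s"] nsnd[of "Y (r n) i - y s"] nfst[of "Y (r n) (i + 1) - y s"]
        unfolding fst_diff snd_diff by (simp_all add: Y_def q_def p_def)
      have inU: "X (r n) i \<in> U" "X (r n) (i + 1) \<in> U"
        using a e0(2) by (auto simp: dist_norm norm_minus_commute subset_iff)
      have int: "0 < idx (r n) j \<and> idx (r n) j < N (r n)" if "X (r n) j \<in> U" for j
      proof -
        have "x (r n) 0 \<notin> U" "x (r n) (N (r n)) \<notin> U"
          using poly[of "r n"] by (simp_all add: not_U polygon_def)
        then have "idx (r n) j \<noteq> 0" "idx (r n) j \<noteq> N (r n)"
          using that unfolding X_def by metis+
        then show ?thesis using idx_le[of "r n" j] by simp
      qed
      let ?j = "idx (r n) i"
      have j: "0 < ?j" "?j < N (r n)" "idx (r n) (i + 1) = Suc ?j" "Suc ?j < N (r n)"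
        using int[OF inU(1)] int[OF inU(2)] idx_int[of "r n" i] by auto
      have hr: "h (r n) > 0" by (rule hx)
      have Pj: "P (r n) i = momentum (h (r n)) (x (r n)) ?j" "P (r n) (i + 1) = momentum (h (r n)) (x (r n)) (Suc ?j)"
        using j by (auto simp: P_def min_def)
      have v: "vel (P (r n) i) = (1 / h (r n)) *\<^sub>R (x (r n) (Suc ?j) - x (r n) ?j)" by (simp add: Pj)
      have 1: "X (r n) (i + 1) - X (r n) i = h (r n) *\<^sub>R vel (P (r n) i)"
        unfolding v using hr j(3) by (simp add: X_def)
      have 2: "P (r n) (i + 1) - P (r n) i = h (r n) *\<^sub>R df (X (r n) (i + 1))"
        unfolding Pj using optimal_EL[OF hx(3) hr j(4)] j(3) by (simp add: X_def)
      have "norm (vel (P (r n) i)) = norm (x (r n) (Suc ?j) - x (r n) ?j) / h (r n)" unfolding v using hr by simp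
      then have 3: "SS (r n) (i + 1) - SS (r n) i = h (r n) * (Phi \<phi> (norm (vel (P (r n) i))) + f (X (r n) i))"
        using j(3) by (simp add: SS_def cost_Suc X_def)
      show "norm (X (r n) i - q s) < e \<and> norm (P (r n) i - p s) < e \<and> norm (X (r n) (i + 1) - q s) < e \<and>
        X (r n) (i + 1) - X (r n) i = h (r n) *\<^sub>R vel (P (r n) i) \<and>
        P (r n) (i + 1) - P (r n) i = h (r n) *\<^sub>R df (X (r n) (i + 1)) \<and>
        SS (r n) (i + 1) - SS (r n) i = h (r n) * (Phi \<phi> (norm (vel (P (r n) i))) + f (X (r n) i))"
        using a 1 2 3 by auto
    qed
  qed
  \<comment> \<open>The three derivatives share one argument: F expresses the slope of a step
    through its two positions and its momentum. The later position occurs because the momentum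
    equation uses the gradient there.\<close>
  have deriv_generic: "(z has_vector_derivative W s) (at s)"
    if u: "\<And>t. (\<lambda>n. u n \<lfloor>t / h (r n)\<rfloor>) \<longlonglongrightarrow> z t" and sU: "q s \<in> U"
      and cont: "\<And>e. e > 0 \<Longrightarrow> \<exists>d>0. \<forall>a a' b. norm (a - q s) < d \<and> norm (a' - q s) < d \<and> norm (b - p s) < d \<longrightarrow>
          norm (F a a' b - W s) \<le> e"
      and eq: "\<And>n i. X (r n) (i + 1) - X (r n) i = h (r n) *\<^sub>R vel (P (r n) i) \<Longrightarrow>
        P (r n) (i + 1) - P (r n) i = h (r n) *\<^sub>R df (X (r n) (i + 1)) \<Longrightarrow>
        SS (r n) (i + 1) - SS (r n) i = h (r n) * (Phi \<phi> (norm (vel (P (r n) i))) + f (X (r n) i)) \<Longrightarrow>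
        u n (i + 1) - u n i = h (r n) *\<^sub>R F (X (r n) i) (X (r n) (i + 1)) (P (r n) i)"
    for u and z W :: "real \<Rightarrow> 'b::real_normed_vector" and F s
  proof (rule discrete_derivative[where h="\<lambda>n. h (r n)" and u=u and y=z and s=s and W="W s", OF E.h(1) E.h(2) u])
    fix e :: real assume "e > 0"
    from cont[OF this] obtain d where d: "d > 0" "\<And>a a' b. norm (a - q s) < d \<and> norm (a' - q s) < d \<and> norm (b - p s) < d \<Longrightarrow>
          norm (F a a' b - W s) \<le> e" by blast
    obtain d' n0 where d': "d' > 0" and nn: "\<And>n i. n \<ge> n0 \<Longrightarrow> \<bar>of_int i * h (r n) - s\<bar> < d' \<Longrightarrow>
      norm (X (r n) i - q s) < d \<and> norm (P (r n) i - p s) < d \<and> norm (X (r n) (i + 1) - q s) < d \<and>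
      X (r n) (i + 1) - X (r n) i = h (r n) *\<^sub>R vel (P (r n) i) \<and>
      P (r n) (i + 1) - P (r n) i = h (r n) *\<^sub>R df (X (r n) (i + 1)) \<and>
      SS (r n) (i + 1) - SS (r n) i = h (r n) * (Phi \<phi> (norm (vel (P (r n) i))) + f (X (r n) i))"
      using hnear[OF sU d(1)] by blast
    show "\<exists>d>0. \<exists>n0. \<forall>n\<ge>n0. \<forall>i. \<bar>of_int i * h (r n) - s\<bar> < d \<longrightarrow>
        norm (u n (i + 1) - u n i - h (r n) *\<^sub>R W s) \<le> e * h (r n)"
    proof (rule exI[of _ d'], intro conjI d', rule exI[of _ n0], intro allI impI)
      fix n i assume "n0 \<le> n" "\<bar>of_int i * h (r n) - s\<bar> < d'"
      note c = nn[OF this]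
      have "u n (i + 1) - u n i - h (r n) *\<^sub>R W s = h (r n) *\<^sub>R (F (X (r n) i) (X (r n) (i + 1)) (P (r n) i) - W s)"
        using eq[of n i] c by (simp add: scaleR_diff_right)
      then show "norm (u n (i + 1) - u n i - h (r n) *\<^sub>R W s) \<le> e * h (r n)"
        using d(2)[of "X (r n) i" "X (r n) (i + 1)" "P (r n) i"] c hx(1)[of "r n"]
        by (simp add: mult.commute mult_right_mono)
    qed
  qed
  have vc: "\<exists>d>0. \<forall>b. norm (b - a) < d \<longrightarrow> norm (G b - G a) \<le> e"
    if "isCont G a" "e > 0" for G :: "'a \<Rightarrow> 'c::real_normed_vector" and a e
    using that unfolding continuous_at_eps_delta dist_norm by (meson less_imp_le)
  show ?thesis
  proof (rule that[of R \<delta> Ct q p S])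
    show "R > 0" "\<delta> > 0" "Ct > 0" by fact+
    show "norm (q t - q s) \<le> Ct * \<bar>t - s\<bar>" for s t
      using E.limit_lipschitz[OF y, of t s] nfst[of "y t - y s"] by (simp add: q_def)
    show "continuous_on UNIV p" "continuous_on UNIV S"
      unfolding p_def[abs_def] S_def[abs_def] by (intro continuous_intros cy)+
    show "norm (p t) \<le> flux R" for t
      by (rule LIMSEQ_le_const2[OF tendsto_norm[OF p]]) (use Pb in blast)
    show "q t \<in> K" for t
      by (rule closed_sequentially[OF _ _ q]) (use compact_K XK compact_imp_closed in auto)
    show q_neg: "infdist (q t) A \<le> gap / 2" if "t \<le> 0" for t
    proof (cases "t = 0")
      case False
      then have t: "t < 0" using that by simp
      have "infdist (X n \<lfloor>t / h n\<rfloor>) A \<le> gap / 2" for n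
      proof -
        have "idx n \<lfloor>t / h n\<rfloor> < k n" by (rule idx_less[OF floor_neg[OF t]])
        then show ?thesis using before by (auto simp: X_def less_imp_le)
      qed
      then show ?thesis by (intro LIMSEQ_le_const2[OF cinf]) blast
    qed (simp add: q0)
    show "infdist (q 0) A = gap / 2" by (rule q0)
    show "\<delta> \<le> infdist (q t) A" if "t \<ge> 0" for t
    proof -
      have "\<delta> \<le> infdist (X n \<lfloor>t / h n\<rfloor>) A" for n
      proof -
        have "idx n \<lfloor>t / h n\<rfloor> \<ge> k n" by (rule idx_ge[OF floor_pos[OF that]])
        then show ?thesis unfolding X_def
          by (intro \<delta>(3)[OF hx(1) hs(2) hx(3) st k(1)] idx_le)
      qed
      then show ?thesis by (intro LIMSEQ_le_const[OF cinf]) blast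
    qed
    show "mono S"
    proof (rule monoI)
      fix s t :: real assume "s \<le> t"
      then have "SS (r n) \<lfloor>s / h (r n)\<rfloor> \<le> SS (r n) \<lfloor>t / h (r n)\<rfloor>" for n
        using hx(1)[of "r n"] by (intro SSm floor_mono divide_right_mono) auto
      then show "S s \<le> S t" by (intro LIMSEQ_le[OF S S]) blast
    qed
    show "0 \<le> S t" for t by (rule LIMSEQ_le_const[OF S]) (use SS0 in blast)
    show "S t \<le> \<mu>" for t
    proof (rule LIMSEQ_le[OF S])
      have "(\<lambda>n. \<mu> + 1 / (real n + 1)) \<longlonglongrightarrow> \<mu>" by real_asymp
      from LIMSEQ_subseq_LIMSEQ[OF this r]
      show "(\<lambda>n. \<mu> + 1 / (real (r n) + 1)) \<longlonglongrightarrow> \<mu>" by (simp add: o_def)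
      have "SS (r n) \<lfloor>t / h (r n)\<rfloor> \<le> \<mu> + 1 / (real (r n) + 1)" for n
        using SSl[of "r n" "\<lfloor>t / h (r n)\<rfloor>"] \<epsilon>(2)[of "r n"] by linarith
      then show "\<exists>N. \<forall>n\<ge>N. SS (r n) \<lfloor>t / h (r n)\<rfloor> \<le> \<mu> + 1 / (real (r n) + 1)" by blast
    qed
    fix s assume sU: "q s \<in> U"
    show "(q has_vector_derivative vel (p s)) (at s)"
    proof (rule deriv_generic[of "\<lambda>n. X (r n)" q s "\<lambda>a a' b. vel b" "\<lambda>s. vel (p s)", OF q sU])
      fix e :: real assume "e > 0"
      then show "\<exists>d>0. \<forall>a a' b. norm (a - q s) < d \<and> norm (a' - q s) < d \<and> norm (b - p s) < d \<longrightarrow> norm (vel b - vel (p s)) \<le> e"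
        using vc[OF isCont_vel[of "p s"]] by blast
    qed
    have cdf: "isCont df (q s)" using df_continuous by (simp add: continuous_on_eq_continuous_at)
    show "(p has_vector_derivative df (q s)) (at s)"
    proof (rule deriv_generic[of "\<lambda>n. P (r n)" p s "\<lambda>a a' b. df a'" "\<lambda>s. df (q s)", OF p sU])
      fix e :: real assume "e > 0"
      then show "\<exists>d>0. \<forall>a a' b. norm (a - q s) < d \<and> norm (a' - q s) < d \<and> norm (b - p s) < d \<longrightarrow> norm (df a' - df (q s)) \<le> e"
        using vc[OF cdf] by blast
    qed
    have cf: "isCont f (q s)" using continuous_on_f[of UNIV] by (simp add: continuous_on_eq_continuous_at)
    have cP: "isCont (\<lambda>b. Phi \<phi> (norm (vel b))) (p s)"
      by (rule isCont_o2[OF isCont_vel]) (rule has_derivative_continuous[OF Phi_norm_has_derivative])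
    have "(S has_vector_derivative (Phi \<phi> (norm (vel (p s))) + f (q s))) (at s)"
    proof (rule deriv_generic[of "\<lambda>n. SS (r n)" S s "\<lambda>a a' b. Phi \<phi> (norm (vel b)) + f a" "\<lambda>s. Phi \<phi> (norm (vel (p s))) + f (q s)", OF S sU])
      fix e :: real assume e: "e > 0"
      obtain d1 where d1: "d1 > 0" "\<And>b. norm (b - p s) < d1 \<Longrightarrow> norm (Phi \<phi> (norm (vel b)) - Phi \<phi> (norm (vel (p s)))) \<le> e / 2"
        using vc[OF cP, of "e/2"] e by auto
      obtain d2 where d2: "d2 > 0" "\<And>b. norm (b - q s) < d2 \<Longrightarrow> norm (f b - f (q s)) \<le> e / 2"
        using vc[OF cf, of "e/2"] e by auto
      have "norm (Phi \<phi> (norm (vel b)) + f a - (Phi \<phi> (norm (vel (p s))) + f (q s))) \<le> e"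
        if "norm (a - q s) < min d1 d2" "norm (b - p s) < min d1 d2" for a b
      proof -
        have "\<bar>Phi \<phi> (norm (vel b)) - Phi \<phi> (norm (vel (p s)))\<bar> \<le> e / 2" "\<bar>f a - f (q s)\<bar> \<le> e / 2"
          using d1(2)[of b] d2(2)[of a] that by simp_all
        then show ?thesis unfolding real_norm_def by linarith
      qed
      then show "\<exists>d>0. \<forall>a a' b. norm (a - q s) < d \<and> norm (a' - q s) < d \<and> norm (b - p s) < d \<longrightarrow>
          norm (Phi \<phi> (norm (vel b)) + f a - (Phi \<phi> (norm (vel (p s))) + f (q s))) \<le> e"
        using d1(1) d2(1) by (intro exI[of _ "min d1 d2"]) auto
    qed simp
    then show "(S has_real_derivative Phi \<phi> (norm (vel (p s))) + f (q s)) (at s)"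
      by (simp add: has_real_derivative_iff_has_vector_derivative)
  qed
qed

end

section \<open>The minimal action\<close>

text \<open>A Barbalat argument: whenever r reaches \<epsilon>, it stays above \<epsilon>/2 for a
  time \<epsilon>/(2 L), during which S gains a fixed amount; a bounded S allows this only finitely
  often.\<close>

lemma tendsto_0_at_top_of_bounded_increase:
  fixes S r :: "real \<Rightarrow> real"
  assumes S: "mono S" "\<And>t. S t \<le> \<mu>" and L: "L > 0" and r: "\<And>s t. \<bar>r t - r s\<bar> \<le> L * \<bar>t - s\<bar>" "\<And>t. r t \<ge> 0"
    and d: "\<And>\<epsilon>. \<epsilon> > 0 \<Longrightarrow> \<exists>\<eta>>0. \<forall>t\<ge>0. r t \<ge> \<epsilon> \<longrightarrow> (\<exists>D\<ge>\<eta>. (S has_real_derivative D) (at t))"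
  shows "(r \<longlongrightarrow> 0) at_top"
proof (rule order_tendstoI)
  fix \<epsilon> :: real assume e: "0 < \<epsilon>"
  obtain \<eta> where eta: "\<eta> > 0" "\<And>t. t \<ge> 0 \<Longrightarrow> r t \<ge> \<epsilon> / 2 \<Longrightarrow> \<exists>D\<ge>\<eta>. (S has_real_derivative D) (at t)"
    using d[of "\<epsilon> / 2"] e by auto
  define \<tau> where "\<tau> = \<epsilon> / (2 * L)"
  have tau: "\<tau> > 0" "L * \<tau> = \<epsilon> / 2" using e L by (auto simp: \<tau>_def)
  show "\<forall>\<^sub>F t in at_top. r t < \<epsilon>"
  proof (rule ccontr)
    assume "\<not> (\<forall>\<^sub>F t in at_top. r t < \<epsilon>)"
    then have far: "\<exists>t\<ge>T. r t \<ge> \<epsilon>" for T unfolding eventually_at_top_linorder by (meson not_le)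
    have jump: "S t + \<eta> * \<tau> \<le> S (t + \<tau>)" if t: "t \<ge> 0" "r t \<ge> \<epsilon>" for t
    proof -
      have der: "\<exists>D\<ge>\<eta>. (S has_real_derivative D) (at s)" if "t \<le> s" "s \<le> t + \<tau>" for s
      proof -
        have "L * \<bar>s - t\<bar> \<le> L * \<tau>" using that L by (intro mult_left_mono) auto
        then have "r s \<ge> \<epsilon> / 2" using r(1)[of s t] t(2) tau(2) by linarith
        then show ?thesis using eta(2)[of s] t that by auto
      qed
      have "S t - \<eta> * t \<le> S (t + \<tau>) - \<eta> * (t + \<tau>)"
      proof (rule DERIV_nonneg_imp_nondecreasing[of t "t + \<tau>" "\<lambda>s. S s - \<eta> * s"])
        fix s assume "t \<le> s" "s \<le> t + \<tau>"
        then obtain D where "D \<ge> \<eta>" "(S has_real_derivative D) (at s)" using der by blast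
        then show "\<exists>y. ((\<lambda>s. S s - \<eta> * s) has_real_derivative y) (at s) \<and> 0 \<le> y"
          by (intro exI[of _ "D - \<eta>"]) (auto intro!: derivative_eq_intros)
      qed (use tau in simp)
      then show ?thesis by (simp add: algebra_simps)
    qed
    have "\<exists>t\<ge>0. S 0 + real n * (\<eta> * \<tau>) \<le> S t" for n
    proof (induction n)
      case (Suc n)
      then obtain t where t: "t \<ge> 0" "S 0 + real n * (\<eta> * \<tau>) \<le> S t" by blast
      obtain s where s: "s \<ge> t" "r s \<ge> \<epsilon>" using far by blast
      have "S t \<le> S s" using S(1) s(1) by (rule monoD)
      then have "S 0 + real (Suc n) * (\<eta> * \<tau>) \<le> S (s + \<tau>)"
        using jump[of s] s t by (simp add: algebra_simps)
      then show ?case using s t tau by (intro exI[of _ "s + \<tau>"]) auto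
    qed auto
    then have bound: "S 0 + real n * (\<eta> * \<tau>) \<le> \<mu>" for n using S(2) order_trans by blast
    obtain n :: nat where "(\<mu> - S 0) / (\<eta> * \<tau>) < real n" using reals_Archimedean2 by blast
    then have "\<mu> - S 0 < real n * (\<eta> * \<tau>)" using eta tau by (simp add: field_simps)
    then show False using bound[of n] by linarith
  qed
next
  fix a :: real assume "a < 0"
  then show "\<forall>\<^sub>F t in at_top. a < r t"
    by (intro always_eventually allI less_le_trans[OF _ r(2)])
qed

lemma monotone_tendsto_at_bot:
  fixes S :: "real \<Rightarrow> real"
  assumes "mono S" "\<And>t. a \<le> S t"
  shows "(S \<longlongrightarrow> Inf (range S)) at_bot"
proof (rule order_tendstoI)
  have bd: "bdd_below (range S)" using assms(2) by (auto simp: bdd_below_def)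
  fix y assume "y < Inf (range S)"
  then show "\<forall>\<^sub>F t in at_bot. y < S t"
    using cInf_lower[OF rangeI bd] by (intro always_eventually allI) (meson less_le_trans)
next
  fix y assume "Inf (range S) < y"
  then obtain t where "S t < y" using cInf_lessD[of "range S" y] by auto
  then show "\<forall>\<^sub>F t in at_bot. S t < y"
    unfolding eventually_at_bot_linorder using monoD[OF assms(1)] by (meson le_less_trans)
qed

lemma monotone_tendsto_at_top:
  fixes S :: "real \<Rightarrow> real"
  assumes "mono S" "\<And>t. S t \<le> a"
  shows "(S \<longlongrightarrow> Sup (range S)) at_top"
proof (rule order_tendstoI)
  have bd: "bdd_above (range S)" using assms(2) by (auto simp: bdd_above_def)
  fix y assume "y < Sup (range S)"
  then obtain t where "y < S t" using less_cSupD[of "range S" y] by auto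
  then show "\<forall>\<^sub>F t in at_top. y < S t"
    unfolding eventually_at_top_linorder using monoD[OF assms(1)] by (meson less_le_trans)
next
  have bd: "bdd_above (range S)" using assms(2) by (auto simp: bdd_above_def)
  fix y assume "Sup (range S) < y"
  then show "\<forall>\<^sub>F t in at_top. S t < y"
    using cSup_upper[OF rangeI bd] by (intro always_eventually allI) (meson le_less_trans)
qed

context well
begin

lemma infdist_A_0: "infdist x A = 0 \<longleftrightarrow> x \<in> A"
  using in_closed_iff_infdist_zero[OF compact_imp_closed[OF A(1)] A(2)] by simp

lemma infdist_B_0: "infdist x B = 0 \<longleftrightarrow> x \<in> B"
  using in_closed_iff_infdist_zero[OF B] by simp

lemma min_action_le:
  fixes q D :: "real \<Rightarrow> 'a"
  assumes V: "\<And>x. f x = V x - c"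
    and q: "continuous_on UNIV q" and Z: "finite Z"
    and D: "D \<in> borel_measurable borel" "\<And>t. norm (D t) \<le> M"
    and d: "\<And>t. t \<notin> Z \<Longrightarrow> (q has_vector_derivative D t) (at t)"
    and f0: "\<And>t. f (q t) \<ge> 0"
    and lim: "((\<lambda>t. infdist (q t) A) \<longlongrightarrow> 0) at_bot" "((\<lambda>t. infdist (q t) B) \<longlongrightarrow> 0) at_top"
  shows "min_action \<phi> V c A B \<le> (\<integral>\<^sup>+t. ennreal (Phi \<phi> (norm (D t)) + f (q t)) \<partial>lborel)"
proof -
  have "Liminf at_bot (\<lambda>t. ereal (infdist (q t) A)) = 0" "Liminf at_top (\<lambda>t. ereal (infdist (q t) B)) = 0"
    using lim_imp_Liminf[OF _ tendsto_ereal[OF lim(1)]] lim_imp_Liminf[OF _ tendsto_ereal[OF lim(2)]]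
    by (auto simp: zero_ereal_def)
  then have "q \<in> Gamma_c \<phi> V c A B"
    using piecewise_C1_in_W1Phi_loc[OF q Z D d] f0 by (simp add: Gamma_c_def V)
  then have "min_action \<phi> V c A B \<le> action \<phi> V c UNIV q"
    unfolding min_action_def by (rule INF_lower)
  also have "\<dots> = (\<integral>\<^sup>+t. ennreal (Phi \<phi> (norm (D t)) + f (q t)) \<partial>lebesgue)"
    using action_eq[OF open_UNIV q weak_derivative_piecewise_C1[OF q Z D d], of \<phi> V c]
    by (simp add: V add_diff_eq)
  also have "\<dots> = (\<integral>\<^sup>+t. ennreal (Phi \<phi> (norm (D t)) + f (q t)) \<partial>lborel)"
    by (rule nn_integral_completion)
  finally show ?thesis .
qed

text \<open>The competitor is a piece of a straight segment from A to B, stopped at both ends, where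
  the Lagrangian vanishes. Finiteness makes \<open>enn2real\<close> faithful on the minimal
  action.\<close>

lemma min_action_finite:
  assumes V: "\<And>x. f x = V x - c"
  shows "min_action \<phi> V c A B < \<infinity>"
proof -
  obtain a b where ab: "a \<in> A" "b \<in> B" using A B by blast
  define g where "g s = a + s *\<^sub>R (b - a)" for s :: real
  have cg: "continuous_on UNIV g" unfolding g_def by (intro continuous_intros)
  have gd: "(g has_vector_derivative (b - a)) (at s)" for s
    unfolding g_def by (auto intro!: derivative_eq_intros)
  have ends: "infdist (g 0) A \<le> 0" "infdist (g 1) B \<le> 0" using ab by (simp_all add: g_def)
  \<comment> \<open>Distance 0 in place of a small \<delta>: the end points lie in A and B
    themselves.\<close>
  obtain s t where st: "s < t" "infdist (g s) A \<le> 0" "infdist (g t) B \<le> 0" "\<And>r. s \<le> r \<Longrightarrow> r \<le> t \<Longrightarrow> g r \<in> K"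
    using curve_crossing[OF cg order_refl _ zero_less_one ends] gap_pos by auto
  have gs: "g s \<in> A" "g t \<in> B"
    using st(2,3) infdist_A_0[of "g s"] infdist_B_0[of "g t"] infdist_nonneg[of "g s" A] infdist_nonneg[of "g t" B] by linarith+
  define q where "q r = g (max s (min t r))" for r
  define D where "D r = (if r \<in> {s<..<t} then b - a else 0)" for r
  have qK: "q r \<in> K" for r unfolding q_def using st by (intro st(4)) auto
  have out: "q r = g s" if "r \<le> s" for r using that st(1) by (simp add: q_def max_def min_def)
  have out': "q r = g t" if "r \<ge> t" for r using that st(1) by (simp add: q_def max_def min_def)
  have "min_action \<phi> V c A B \<le> (\<integral>\<^sup>+r. ennreal (Phi \<phi> (norm (D r)) + f (q r)) \<partial>lborel)"
  proof (rule min_action_le[OF V, of q "{s, t}" D "norm (b - a)"])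
    show "continuous_on UNIV q" unfolding q_def
      by (rule continuous_on_compose2[OF cg]) (auto intro!: continuous_intros)
    show "D \<in> borel_measurable borel" unfolding D_def by measurable
    show "norm (D r) \<le> norm (b - a)" for r by (simp add: D_def)
    show "f (q r) \<ge> 0" for r by (rule f_nonneg[OF qK])
    show "(q has_vector_derivative D r) (at r)" if r: "r \<notin> {s, t}" for r
    proof -
      consider "r < s" | "s < r" "r < t" | "t < r" using r by fastforce
      then show ?thesis
      proof cases
        case 1
        then have "((\<lambda>_. g s) has_vector_derivative D r) (at r)" by (simp add: D_def)
        then show ?thesis
          by (rule has_vector_derivative_transform_within_open[where S="{..<s}"]) (use 1 out in auto)
      next
        case 2
        then have "(g has_vector_derivative D r) (at r)" using gd by (simp add: D_def)
        then show ?thesis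
          by (rule has_vector_derivative_transform_within_open[where S="{s<..<t}"]) (use 2 in \<open>auto simp: q_def\<close>)
      next
        case 3
        then have "((\<lambda>_. g t) has_vector_derivative D r) (at r)" using st by (simp add: D_def)
        then show ?thesis
          by (rule has_vector_derivative_transform_within_open[where S="{t<..}"]) (use 3 out' in auto)
      qed
    qed
    have "\<forall>\<^sub>F r in at_bot. infdist (q r) A = 0"
      using out gs by (auto simp: eventually_at_bot_linorder infdist_A_0 intro!: exI[of _ s])
    then show "((\<lambda>r. infdist (q r) A) \<longlongrightarrow> 0) at_bot" by (rule tendsto_eventually)
    have "\<forall>\<^sub>F r in at_top. infdist (q r) B = 0"
      using out' gs by (auto simp: eventually_at_top_linorder infdist_B_0 intro!: exI[of _ t])
    then show "((\<lambda>r. infdist (q r) B) \<longlongrightarrow> 0) at_top" by (rule tendsto_eventually)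
  qed simp
  also obtain C where C: "C \<ge> 0" "\<And>x. x \<in> K \<Longrightarrow> f x \<le> C" using f_bounded by metis
  have "(\<integral>\<^sup>+r. ennreal (Phi \<phi> (norm (D r)) + f (q r)) \<partial>lborel) \<le>
      (\<integral>\<^sup>+r. ennreal (Phi \<phi> (norm (b - a)) + C) * indicator {s..t} r \<partial>lborel)"
  proof (rule nn_integral_mono)
    fix r
    show "ennreal (Phi \<phi> (norm (D r)) + f (q r)) \<le> ennreal (Phi \<phi> (norm (b - a)) + C) * indicator {s..t} r"
    proof (cases "r \<in> {s..t}")
      case True
      have "Phi \<phi> (norm (D r)) \<le> Phi \<phi> (norm (b - a))" by (rule Phi_mono) (auto simp: D_def)
      then show ?thesis using True C(2)[OF qK[of r]] by (auto intro!: ennreal_leI)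
    next
      case False
      then have "q r = g s \<or> q r = g t" using out[of r] out'[of r] by force
      then have "f (q r) = 0" using gs f_zero[OF qK[of r]] not_U by metis
      then show ?thesis using False by (auto simp: D_def)
    qed
  qed
  also have "\<dots> < \<infinity>"
    by (subst nn_integral_cmult_indicator) (auto simp: ennreal_mult_less_top emeasure_lborel_Icc_eq)
  finally show ?thesis .
qed

text \<open>The lower limits only give nearness to A at arbitrarily early times and to B at
  arbitrarily late ones; t is fixed first and s is then chosen before it.\<close>

lemma Gamma_c_near:
  assumes q: "q \<in> Gamma_c \<phi> V c A B" and d: "\<delta> > 0"
  shows "\<exists>s t. s < t \<and> infdist (q s) A < \<delta> \<and> infdist (q t) B < \<delta>"
proof -
  have fr: "\<exists>\<^sub>F t in F. r t < \<delta>" if "Liminf F (\<lambda>t. ereal (r t)) = 0" for F and r :: "real \<Rightarrow> real"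
  proof (rule ccontr)
    assume "\<not> (\<exists>\<^sub>F t in F. r t < \<delta>)"
    then have "\<forall>\<^sub>F t in F. ereal \<delta> \<le> ereal (r t)" by (simp add: not_frequently not_less)
    then have "ereal \<delta> \<le> Liminf F (\<lambda>t. ereal (r t))" by (rule Liminf_bounded)
    then show False using that d by simp
  qed
  have 1: "\<exists>\<^sub>F t in at_bot. infdist (q t) A < \<delta>" "\<exists>\<^sub>F t in at_top. infdist (q t) B < \<delta>"
    using q fr by (auto simp: Gamma_c_def)
  obtain t where t: "infdist (q t) B < \<delta>" using frequently_ex[OF 1(2)] by blast
  have "\<forall>\<^sub>F s in at_bot. s < t" by (rule eventually_gt_at_bot)
  from frequently_ex[OF frequently_eventually_frequently[OF 1(1) this]] t show ?thesis by blast
qed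

text \<open>Half of \<epsilon> pays for the choice of a near-minimal curve, the other half for its
  discretization.\<close>

lemma min_action_polygons:
  assumes V: "\<And>x. f x = V x - c" and e: "\<epsilon> > 0"
  shows "\<exists>h N z. 0 < h \<and> h < \<epsilon> \<and> N \<ge> 1 \<and> polygon N z \<and> cost h z N \<le> enn2real (min_action \<phi> V c A B) + \<epsilon>"
proof -
  let ?m = "min_action \<phi> V c A B"
  have fin: "?m < \<infinity>" by (rule min_action_finite[OF V])
  then have "?m < ?m + ennreal (\<epsilon> / 2)" using e by (simp add: ennreal_less_iff ennreal_add_left_cancel_less)
  then obtain q where q: "q \<in> Gamma_c \<phi> V c A B" "action \<phi> V c UNIV q < ?m + ennreal (\<epsilon> / 2)"
    unfolding min_action_def by (auto simp: INF_less_iff)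
  have "?m + ennreal (\<epsilon> / 2) < \<infinity>" using fin by (simp add: less_top)
  with q(2) have afin: "action \<phi> V c UNIV q < \<infinity>" by (rule less_trans)
  have "enn2real (action \<phi> V c UNIV q) \<le> enn2real (?m + ennreal (\<epsilon> / 2))"
    using q(2) fin by (intro enn2real_mono) (auto simp: less_top)
  also have "\<dots> = enn2real ?m + \<epsilon> / 2" using fin e by (subst enn2real_plus) (auto simp: less_top)
  finally have le: "enn2real (action \<phi> V c UNIV q) \<le> enn2real ?m + \<epsilon> / 2" .
  have qW: "q \<in> W1Phi_loc \<phi>" and qV: "\<And>t. V (q t) \<ge> c" using q(1) by (auto simp: Gamma_c_def)
  have cV: "continuous_on UNIV V"
  proof -
    have "V = (\<lambda>x. f x + c)" using V by auto
    then show ?thesis by (simp add: continuous_on_add continuous_on_f)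
  qed
  obtain L where L: "\<And>a b. L integrable_on {a..b}"
    "\<And>a b. integral {a..b} L \<le> enn2real (action \<phi> V c UNIV q)"
    "\<And>a b. a < b \<Longrightarrow> (b - a) * Phi \<phi> (norm (q b - q a) / (b - a)) + integral {a..b} (\<lambda>t. V (q t) - c)
        \<le> integral {a..b} L"
    by (rule action_ge_difference_quotient[OF qW cV qV afin]) blast
  have cq: "continuous_on UNIV q" using qW by (simp add: W1Phi_loc_def)
  obtain h N z where "0 < h" "h < \<epsilon> / 2" "N \<ge> 1" "polygon N z" "cost h z N \<le> enn2real (action \<phi> V c UNIV q) + \<epsilon> / 2"
    by (rule approximating_polygon[OF cq Gamma_c_near[OF q(1)] L(1,2), of "\<epsilon> / 2"]) (use L(3) e V in auto)
  then show ?thesis using le e by (intro exI[of _ h] exI[of _ N] exI[of _ z]) auto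
qed

end

section \<open>The extremal\<close>

text \<open>Away from momentum 0 the norm and \<open>flux_inv\<close> are C^1, and
  \<open>vel\<close> multiplies p by a quotient of the two.\<close>

lemma (in orlicz) vel_C1:
  fixes p p' :: "real \<Rightarrow> 'a::euclidean_space"
  assumes p: "\<And>t. t \<in> I \<Longrightarrow> (p has_vector_derivative p' t) (at t)" and p': "continuous_on I p'"
    and nz: "\<And>t. t \<in> I \<Longrightarrow> p t \<noteq> 0"
  shows "(\<lambda>t. vel (p t)) C1_differentiable_on I"
proof -
  obtain g' where g': "\<And>y. y > 0 \<Longrightarrow> (flux_inv has_real_derivative g' y) (at y)" "continuous_on {0<..} g'"
    using flux_inv_derivative by metis
  define n where "n t = norm (p t)" for t
  define n' where "n' t = p' t \<bullet> sgn (p t)" for t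
  have n0: "n t > 0" if "t \<in> I" for t using nz[OF that] by (simp add: n_def)
  have dn: "(n has_real_derivative n' t) (at t)" if t: "t \<in> I" for t
  proof -
    have "((\<lambda>t. norm (p t)) has_derivative (\<lambda>x. (x *\<^sub>R p' t) \<bullet> sgn (p t))) (at t)"
      by (rule has_derivative_compose[OF p[OF t, unfolded has_vector_derivative_def] has_derivative_norm[OF nz[OF t]]])
    then show ?thesis
      unfolding has_field_derivative_def n_def[abs_def] n'_def by (simp add: mult.commute[of _ "p' t \<bullet> sgn (p t)"])
  qed
  define k' where "k' t = (g' (n t) * n' t * n t - flux_inv (n t) * n' t) / (n t * n t)" for t
  have dk: "((\<lambda>t. flux_inv (n t) / n t) has_real_derivative k' t) (at t)" if t: "t \<in> I" for t
    unfolding k'_def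
    by (rule DERIV_divide[OF DERIV_chain2[OF g'(1)[OF n0[OF t]] dn[OF t]] dn[OF t]]) (use n0[OF t] in simp)
  have cp: "continuous_on I p"
    using p by (intro continuous_at_imp_continuous_on ballI) (rule has_vector_derivative_continuous)
  have cn: "continuous_on I n" unfolding n_def[abs_def] by (intro continuous_intros cp)
  have cn': "continuous_on I n'" unfolding n'_def[abs_def] sgn_div_norm
    by (intro continuous_intros cp p') (use nz in auto)
  have cfi: "continuous_on S flux_inv" for S
    by (intro continuous_at_imp_continuous_on ballI isCont_flux_inv)
  have cg: "continuous_on I (\<lambda>t. g' (n t))" by (rule continuous_on_compose2[OF g'(2) cn]) (use n0 in auto)
  have cf: "continuous_on I (\<lambda>t. flux_inv (n t))" by (rule continuous_on_compose2[OF cfi cn]) auto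
  have ck': "continuous_on I k'" unfolding k'_def[abs_def]
    by (intro continuous_intros cg cf cn cn') (use n0 in force)
  show ?thesis unfolding C1_differentiable_on_def
  proof (intro exI conjI ballI)
    fix t assume t: "t \<in> I"
    have "((\<lambda>t. (flux_inv (n t) / n t) *\<^sub>R p t) has_vector_derivative
        ((flux_inv (n t) / n t) *\<^sub>R p' t + k' t *\<^sub>R p t)) (at t)"
      by (rule has_vector_derivative_scaleR[OF dk[OF t] p[OF t]])
    then show "((\<lambda>t. vel (p t)) has_vector_derivative
        ((flux_inv (n t) / n t) *\<^sub>R p' t + k' t *\<^sub>R p t)) (at t)"
      by (simp add: vel_def n_def)
  next
    show "continuous_on I (\<lambda>t. (flux_inv (n t) / n t) *\<^sub>R p' t + k' t *\<^sub>R p t)"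
      by (intro continuous_intros cf cn ck' cp p') (use n0 in force)
  qed
qed

text \<open>Records the output of \<open>limit_curve\<close> when \<mu> is the minimal
  action.\<close>

locale minimizer = well \<phi> l m f df A B
  for \<phi> l m and f :: "'a::euclidean_space \<Rightarrow> real" and df A B +
  fixes V :: "'a \<Rightarrow> real" and c :: real and q p :: "real \<Rightarrow> 'a" and S :: "real \<Rightarrow> real" and R \<delta> L :: real
  assumes V: "\<And>x. f x = V x - c" and gradV: "\<And>x. grad V x = df x"
    and R: "R > 0" and \<delta>: "\<delta> > 0" and L: "L > 0" and q_lipschitz: "\<And>s t. norm (q t - q s) \<le> L * \<bar>t - s\<bar>"
    and p_continuous: "continuous_on UNIV p" and S_continuous: "continuous_on UNIV S"
    and p_bounded: "\<And>t. norm (p t) \<le> flux R"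
    and q_in_K: "\<And>t. q t \<in> K" and q_neg: "\<And>t. t \<le> 0 \<Longrightarrow> infdist (q t) A \<le> gap / 2"
    and q_0: "infdist (q 0) A = gap / 2" and q_pos: "\<And>t. t \<ge> 0 \<Longrightarrow> \<delta> \<le> infdist (q t) A"
    and S_mono: "mono S" and S_nonneg: "\<And>t. 0 \<le> S t" and S_le: "\<And>t. S t \<le> enn2real (min_action \<phi> V c A B)"
    and q_derivative: "\<And>t. q t \<in> U \<Longrightarrow> (q has_vector_derivative vel (p t)) (at t)"
    and p_derivative: "\<And>t. q t \<in> U \<Longrightarrow> (p has_vector_derivative df (q t)) (at t)"
    and S_derivative: "\<And>t. q t \<in> U \<Longrightarrow> (S has_real_derivative Phi \<phi> (norm (vel (p t))) + f (q t)) (at t)"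
begin

definition \<mu> :: real where "\<mu> = enn2real (min_action \<phi> V c A B)"

lemma min_action_eq: "min_action \<phi> V c A B = ennreal \<mu>"
  unfolding \<mu>_def using min_action_finite[OF V] by (simp add: less_top)

lemma q_continuous: "continuous_on T q"
proof (rule continuous_on_subset[of UNIV])
  show "continuous_on UNIV q"
    by (rule lipschitz_on_continuous_on[of L]) (use q_lipschitz L in \<open>auto intro!: lipschitz_onI simp: dist_norm\<close>)
qed simp

lemma q_neg_B: assumes "t \<le> 0" shows "gap / 2 \<le> infdist (q t) B"
  using q_neg[OF assms] gap_infdist_sum[of "q t"] by linarith

lemma q_neg_not_B: "t \<le> 0 \<Longrightarrow> q t \<notin> B"
  using q_neg_B[of t] gap_pos infdist_B_0[of "q t"] by auto

lemma q_pos_not_A: "t \<ge> 0 \<Longrightarrow> q t \<notin> A"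
  using q_pos[of t] \<delta> infdist_A_0[of "q t"] by auto

lemma q_0_U: "q 0 \<in> U"
  using q_neg_not_B[of 0] q_pos_not_A[of 0] not_U[of "q 0"] by auto

text \<open>By \<open>Sup {} = -\<infinity>\<close> and \<open>Inf {} = \<infinity>\<close> this covers curves that approach \<open>A\<close> or \<open>B\<close> only asymptotically.\<close>

definition \<alpha> :: ereal where "\<alpha> = Sup (ereal ` {t. t < 0 \<and> q t \<in> A})"
definition \<omega> :: ereal where "\<omega> = Inf (ereal ` {t. t > 0 \<and> q t \<in> B})"
definition J :: "real set" where "J = einterval \<alpha> \<omega>"

lemma \<alpha>_neg: "\<alpha> < 0" and \<omega>_pos: "\<omega> > 0"
proof -
  have "open (q -` U)" using open_vimage[OF open_U q_continuous] .
  then obtain d where d: "d > 0" "ball 0 d \<subseteq> q -` U" using q_0_U open_contains_ball by (metis vimageI)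
  have "\<alpha> \<le> ereal (- d)" unfolding \<alpha>_def
  proof (rule Sup_least)
    fix x assume "x \<in> ereal ` {t. t < 0 \<and> q t \<in> A}"
    then obtain t where t: "x = ereal t" "t < 0" "q t \<in> A" by auto
    then have "q t \<notin> U" using not_U by blast
    then have "t \<notin> ball 0 d" using d(2) by auto
    then show "x \<le> ereal (- d)" using t by (simp add: dist_real_def)
  qed
  then show "\<alpha> < 0" using d(1) by (simp add: zero_ereal_def order.strict_trans1)
  have "ereal d \<le> \<omega>" unfolding \<omega>_def
  proof (rule Inf_greatest)
    fix x assume "x \<in> ereal ` {t. t > 0 \<and> q t \<in> B}"
    then obtain t where t: "x = ereal t" "t > 0" "q t \<in> B" by auto
    then have "q t \<notin> U" using not_U by blast
    then have "t \<notin> ball 0 d" using d(2) by auto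
    then show "ereal d \<le> x" using t by (simp add: dist_real_def)
  qed
  then show "\<omega> > 0" using d(1) by (cases \<omega>) (auto simp: zero_ereal_def)
qed

lemma \<alpha>_less_\<omega>: "\<alpha> < \<omega>" using \<alpha>_neg \<omega>_pos by (rule less_trans)

lemma open_J: "open J" unfolding J_def by (rule open_einterval)

lemma zero_in_J: "0 \<in> J" using \<alpha>_neg \<omega>_pos by (simp add: J_def einterval_iff zero_ereal_def)

lemma neg_in_J: "\<alpha> = -\<infinity> \<Longrightarrow> t \<le> 0 \<Longrightarrow> t \<in> J"
  using \<omega>_pos by (cases \<omega>) (auto simp: J_def einterval_iff zero_ereal_def)

lemma pos_in_J: "\<omega> = \<infinity> \<Longrightarrow> 0 \<le> t \<Longrightarrow> t \<in> J"
  using \<alpha>_neg by (cases \<alpha>) (auto simp: J_def einterval_iff zero_ereal_def)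

text \<open>A can be met only at negative times, because q does not return to it, and B only at
  positive times, because q is within gap/2 of A up to time 0.\<close>

lemma J_U: assumes "t \<in> J" shows "q t \<in> U"
proof -
  have *: "\<alpha> < ereal t" "ereal t < \<omega>" using assms by (auto simp: J_def einterval_iff)
  have "q t \<notin> A"
  proof
    assume a: "q t \<in> A"
    then have "t < 0" using q_pos_not_A[of t] by (cases "t \<ge> 0") auto
    then have "ereal t \<le> \<alpha>" unfolding \<alpha>_def using a by (intro Sup_upper) auto
    then show False using * by simp
  qed
  moreover have "q t \<notin> B"
  proof
    assume a: "q t \<in> B"
    then have "t > 0" using q_neg_not_B[of t] by (cases "t \<le> 0") auto
    then have "\<omega> \<le> ereal t" unfolding \<omega>_def using a by (intro Inf_lower) auto
    then show False using * by simp
  qed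
  ultimately show ?thesis using not_U by blast
qed

lemma \<alpha>_in_A: assumes a: "\<alpha> = ereal a" shows "q a \<in> A"
proof (rule ccontr)
  assume "q a \<notin> A"
  moreover have "open (q -` (- A))"
    by (rule open_vimage[OF _ q_continuous]) (use A compact_imp_closed in auto)
  ultimately obtain d where d: "d > 0" "ball a d \<subseteq> q -` (- A)" using open_contains_ball by (metis vimageI ComplI)
  have "\<alpha> \<le> ereal (a - d)" unfolding \<alpha>_def
  proof (rule Sup_least)
    fix x assume x: "x \<in> ereal ` {t. t < 0 \<and> q t \<in> A}"
    then obtain t where t: "x = ereal t" "t < 0" "q t \<in> A" by auto
    have "x \<le> \<alpha>" unfolding \<alpha>_def using x by (rule Sup_upper)
    then have "t \<le> a" using t a by simp
    moreover have "t \<notin> ball a d" using d(2) t(3) by auto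
    ultimately show "x \<le> ereal (a - d)" using t by (simp add: dist_real_def)
  qed
  then show False using a d(1) by simp
qed

lemma \<omega>_in_B: assumes b: "\<omega> = ereal b" shows "q b \<in> B"
proof (rule ccontr)
  assume "q b \<notin> B"
  moreover have "open (q -` (- B))" by (rule open_vimage[OF _ q_continuous]) (use B in auto)
  ultimately obtain d where d: "d > 0" "ball b d \<subseteq> q -` (- B)" using open_contains_ball by (metis vimageI ComplI)
  have "ereal (b + d) \<le> \<omega>" unfolding \<omega>_def
  proof (rule Inf_greatest)
    fix x assume x: "x \<in> ereal ` {t. t > 0 \<and> q t \<in> B}"
    then obtain t where t: "x = ereal t" "t > 0" "q t \<in> B" by auto
    have "\<omega> \<le> x" unfolding \<omega>_def using x by (rule Inf_lower)
    then have "b \<le> t" using t b by simp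
    moreover have "t \<notin> ball b d" using d(2) t(3) by auto
    ultimately show "ereal (b + d) \<le> x" using t by (simp add: dist_real_def)
  qed
  then show False using b d(1) by simp
qed

text \<open>After time reversal, -S(-t) is increasing and bounded by 0. Up to time 0 the curve is at
  distance at least gap/2 from B, so being far from A forces a positive lower bound on f.\<close>

lemma lim_A_infinite:
  assumes "\<alpha> = -\<infinity>" shows "((\<lambda>t. infdist (q t) A) \<longlongrightarrow> 0) at_bot"
  unfolding filterlim_at_bot_mirror
proof (rule tendsto_0_at_top_of_bounded_increase[of "\<lambda>t. - S (- t)" 0 L])
  show "mono (\<lambda>t. - S (- t))" using S_mono by (auto simp: mono_def)
  show "- S (- t) \<le> 0" for t using S_nonneg[of "- t"] by simp
  show "\<bar>infdist (q (- t)) A - infdist (q (- s)) A\<bar> \<le> L * \<bar>t - s\<bar>" for s t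
    using infdist_triangle_abs[of "q (- t)" A "q (- s)"] q_lipschitz[of "- t" "- s"]
    by (simp add: dist_norm abs_minus_commute)
  fix \<epsilon> :: real assume "\<epsilon> > 0"
  then have "min \<epsilon> (gap / 2) > 0" using gap_pos by simp
  then obtain \<eta> where eta: "\<eta> > 0" "\<And>x. x \<in> K \<Longrightarrow> infdist x A \<ge> min \<epsilon> (gap / 2) \<Longrightarrow> infdist x B \<ge> min \<epsilon> (gap / 2) \<Longrightarrow> f x \<ge> \<eta>"
    using f_lower_bound by metis
  show "\<exists>\<eta>>0. \<forall>t\<ge>0. \<epsilon> \<le> infdist (q (- t)) A \<longrightarrow> (\<exists>D\<ge>\<eta>. ((\<lambda>t. - S (- t)) has_real_derivative D) (at t))"
  proof (rule exI[of _ \<eta>], intro conjI eta(1) allI impI)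
    fix t :: real assume t: "0 \<le> t" "\<epsilon> \<le> infdist (q (- t)) A"
    have "f (q (- t)) \<ge> \<eta>" using t q_neg_B[of "- t"] by (intro eta q_in_K) auto
    moreover have "- t \<in> J" using t assms by (intro neg_in_J) auto
    note d = S_derivative[OF J_U[OF this]]
    have "((\<lambda>t. - S (- t)) has_real_derivative (Phi \<phi> (norm (vel (p (- t)))) + f (q (- t)))) (at t)"
      by (rule DERIV_minus[OF DERIV_chain2[OF d DERIV_minus[OF DERIV_ident]], THEN DERIV_cong]) simp
    ultimately show "\<exists>D\<ge>\<eta>. ((\<lambda>t. - S (- t)) has_real_derivative D) (at t)"
      using Phi_nonneg[of "norm (vel (p (- t)))"] by (intro exI conjI) (auto intro: order_trans)
  qed
qed (auto simp: L infdist_nonneg)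

text \<open>Symmetric, with the no-return distance \<delta> as lower bound for the distance to
  A.\<close>

lemma lim_B_infinite:
  assumes "\<omega> = \<infinity>" shows "((\<lambda>t. infdist (q t) B) \<longlongrightarrow> 0) at_top"
proof (rule tendsto_0_at_top_of_bounded_increase[of S \<mu> L])
  show "\<bar>infdist (q t) B - infdist (q s) B\<bar> \<le> L * \<bar>t - s\<bar>" for s t
    using infdist_triangle_abs[of "q t" B "q s"] q_lipschitz[of t s] by (simp add: dist_norm)
  show "S t \<le> \<mu>" for t using S_le by (simp add: \<mu>_def)
  fix \<epsilon> :: real assume "\<epsilon> > 0"
  then have "min \<epsilon> \<delta> > 0" using \<delta> by simp
  then obtain \<eta> where eta: "\<eta> > 0" "\<And>x. x \<in> K \<Longrightarrow> infdist x A \<ge> min \<epsilon> \<delta> \<Longrightarrow> infdist x B \<ge> min \<epsilon> \<delta> \<Longrightarrow> f x \<ge> \<eta>"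
    using f_lower_bound by metis
  show "\<exists>\<eta>>0. \<forall>t\<ge>0. \<epsilon> \<le> infdist (q t) B \<longrightarrow> (\<exists>D\<ge>\<eta>. (S has_real_derivative D) (at t))"
  proof (rule exI[of _ \<eta>], intro conjI eta(1) allI impI)
    fix t :: real assume t: "0 \<le> t" "\<epsilon> \<le> infdist (q t) B"
    have "f (q t) \<ge> \<eta>" using t q_pos[of t] by (intro eta q_in_K) auto
    moreover have "t \<in> J" using t assms by (intro pos_in_J) auto
    note d = S_derivative[OF J_U[OF this]]
    ultimately show "\<exists>D\<ge>\<eta>. (S has_real_derivative D) (at t)"
      using Phi_nonneg[of "norm (vel (p t))"] d by (intro exI conjI) (auto intro: order_trans)
  qed
qed (auto simp: L S_mono infdist_nonneg)

section \<open>The limit curve stopped on A and on B\<close>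

definition clamp :: "real \<Rightarrow> real" where "clamp t = real_of_ereal (max \<alpha> (min \<omega> (ereal t)))"

text \<open>Outside J nothing is known about the derivative of q. At rest on A or B the Lagrangian
  is 0, so the stopped curve is a competitor on the whole line whose action is carried by J.\<close>

definition extremal :: "real \<Rightarrow> 'a" where "extremal t = q (clamp t)"

definition D :: "real \<Rightarrow> 'a" where "D t = (if t \<in> J then vel (p t) else 0)"

lemma clamp_J: "t \<in> J \<Longrightarrow> clamp t = t"
  by (auto simp: J_def einterval_iff clamp_def max_def min_def)

lemma clamp_low: "ereal t \<le> \<alpha> \<Longrightarrow> \<alpha> = ereal (clamp t)"
  using \<alpha>_neg \<alpha>_less_\<omega> by (cases \<alpha>; cases \<omega>) (auto simp: clamp_def max_def min_def)

lemma clamp_high: "\<omega> \<le> ereal t \<Longrightarrow> \<omega> = ereal (clamp t)"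
  using \<omega>_pos \<alpha>_less_\<omega> by (cases \<alpha>; cases \<omega>) (auto simp: clamp_def max_def min_def)

lemma not_J: "t \<notin> J \<longleftrightarrow> ereal t \<le> \<alpha> \<or> \<omega> \<le> ereal t"
  by (auto simp: J_def einterval_iff)

lemma clamp_lipschitz: "\<bar>clamp t - clamp s\<bar> \<le> \<bar>t - s\<bar>"
  using \<alpha>_neg \<omega>_pos \<alpha>_less_\<omega> by (cases \<alpha>; cases \<omega>) (auto simp: clamp_def max_def min_def)

lemma extremal_J: "t \<in> J \<Longrightarrow> extremal t = q t" by (simp add: extremal_def clamp_J)

lemma extremal_in_K: "extremal t \<in> K" by (simp add: extremal_def q_in_K)

lemma extremal_low: "ereal t \<le> \<alpha> \<Longrightarrow> extremal t \<in> A"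
  unfolding extremal_def using \<alpha>_in_A clamp_low by blast

lemma extremal_high: "\<omega> \<le> ereal t \<Longrightarrow> extremal t \<in> B"
  unfolding extremal_def using \<omega>_in_B clamp_high by blast

lemma f_extremal_zero: assumes "t \<notin> J" shows "f (extremal t) = 0"
  using assms extremal_low[of t] extremal_high[of t] f_zero[OF extremal_in_K[of t]] by (auto simp: not_J not_U)

lemma f_extremal_pos: "t \<in> J \<Longrightarrow> f (extremal t) > 0"
  using J_U by (simp add: extremal_J U_def)

lemma extremal_continuous: "continuous_on T extremal"
proof (rule continuous_on_subset[of UNIV])
  have "continuous_on UNIV clamp"
    by (rule lipschitz_on_continuous_on[of 1]) (use clamp_lipschitz in \<open>auto intro!: lipschitz_onI simp: dist_real_def\<close>)
  then show "continuous_on UNIV extremal" unfolding extremal_def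
    by (rule continuous_on_compose2[OF q_continuous]) auto
qed simp

lemma vel_p_continuous: "continuous_on T (\<lambda>t. vel (p t))"
  by (rule continuous_on_compose2[of UNIV vel])
    (auto intro: continuous_at_imp_continuous_on isCont_vel continuous_on_subset[OF p_continuous])

lemma J_borel [measurable]: "J \<in> sets borel" using open_J by simp

lemma D_measurable [measurable]: "D \<in> borel_measurable borel"
proof -
  have [measurable]: "(\<lambda>t. vel (p t)) \<in> borel_measurable borel"
    by (rule borel_measurable_continuous_onI[OF vel_p_continuous])
  show ?thesis unfolding D_def by measurable
qed

lemma norm_D: "norm (D t) \<le> R"
proof -
  have "norm (vel (p t)) \<le> flux_inv (flux R)" unfolding norm_vel by (rule flux_inv_mono[OF p_bounded])
  then show ?thesis using R by (simp add: D_def flux_inv_flux)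
qed

text \<open>An infinite end point contributes the default value 0 of \<open>real_of_ereal\<close>,
  which merely adds an exceptional point.\<close>

definition Z :: "real set" where "Z = {real_of_ereal \<alpha>, real_of_ereal \<omega>}"

lemma extremal_derivative: assumes "t \<notin> Z" shows "(extremal has_vector_derivative D t) (at t)"
proof (cases "t \<in> J")
  case True
  have "(q has_vector_derivative D t) (at t)" using q_derivative[OF J_U[OF True]] True by (simp add: D_def)
  then show ?thesis
    by (rule has_vector_derivative_transform_within_open[OF _ open_J True]) (simp add: extremal_J)
next
  case False
  have "ereal t \<noteq> \<alpha>" using assms by (cases \<alpha>) (auto simp: Z_def)
  moreover have "ereal t \<noteq> \<omega>" using assms by (cases \<omega>) (auto simp: Z_def)
  ultimately consider "ereal t < \<alpha>" | "\<omega> < ereal t" using False not_J by fastforce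
  then show ?thesis
  proof cases
    case 1
    have *: "extremal s = extremal t" if "s \<in> einterval (-\<infinity>) \<alpha>" for s
    proof -
      have "\<alpha> = ereal (clamp s)" "\<alpha> = ereal (clamp t)"
        using that 1 by (auto simp: einterval_iff intro!: clamp_low)
      then show ?thesis by (simp add: extremal_def)
    qed
    have "((\<lambda>_. extremal t) has_vector_derivative D t) (at t)" using False by (simp add: D_def)
    then show ?thesis
      by (rule has_vector_derivative_transform_within_open[OF _ open_einterval _ *[symmetric]])
        (use 1 in \<open>auto simp: einterval_iff\<close>)
  next
    case 2
    have *: "extremal s = extremal t" if "s \<in> einterval \<omega> \<infinity>" for s
    proof -
      have "\<omega> = ereal (clamp s)" "\<omega> = ereal (clamp t)"
        using that 2 by (auto simp: einterval_iff intro!: clamp_high)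
      then show ?thesis by (simp add: extremal_def)
    qed
    have "((\<lambda>_. extremal t) has_vector_derivative D t) (at t)" using False by (simp add: D_def)
    then show ?thesis
      by (rule has_vector_derivative_transform_within_open[OF _ open_einterval _ *[symmetric]])
        (use 2 in \<open>auto simp: einterval_iff\<close>)
  qed
qed

lemma lim_extremal_A: "((\<lambda>t. infdist (extremal t) A) \<longlongrightarrow> 0) at_bot"
proof (cases \<alpha>)
  case (real a)
  then have "\<forall>\<^sub>F t in at_bot. infdist (extremal t) A = 0"
    using extremal_low by (auto simp: eventually_at_bot_linorder infdist_A_0 intro!: exI[of _ a])
  then show ?thesis by (rule tendsto_eventually)
next
  case MInf
  have "\<forall>\<^sub>F t in at_bot. infdist (q t) A = infdist (extremal t) A"
    unfolding eventually_at_bot_linorder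
  proof (intro exI allI impI)
    fix t :: real assume "t \<le> 0"
    then have "t \<in> J" using MInf by (intro neg_in_J) auto
    then show "infdist (q t) A = infdist (extremal t) A" by (simp add: extremal_J)
  qed
  then show ?thesis by (rule Lim_transform_eventually[OF lim_A_infinite[OF MInf]])
qed (use \<alpha>_neg in auto)

lemma lim_extremal_B: "((\<lambda>t. infdist (extremal t) B) \<longlongrightarrow> 0) at_top"
proof (cases \<omega>)
  case (real b)
  then have "\<forall>\<^sub>F t in at_top. infdist (extremal t) B = 0"
    using extremal_high by (auto simp: eventually_at_top_linorder infdist_B_0 intro!: exI[of _ b])
  then show ?thesis by (rule tendsto_eventually)
next
  case PInf
  have "\<forall>\<^sub>F t in at_top. infdist (q t) B = infdist (extremal t) B"
    unfolding eventually_at_top_linorder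
  proof (intro exI allI impI)
    fix t :: real assume "t \<ge> 0"
    then have "t \<in> J" using PInf by (intro pos_in_J) auto
    then show "infdist (q t) B = infdist (extremal t) B" by (simp add: extremal_J)
  qed
  then show ?thesis by (rule Lim_transform_eventually[OF lim_B_infinite[OF PInf]])
qed (use \<omega>_pos in auto)

text \<open>The time-scaled curve is again a competitor; substituting k t in its action produces a
  factor 1 / k, moved here to the left-hand side.\<close>

lemma min_action_le_rescaled:
  assumes k: "k > 0"
  shows "ennreal k * ennreal \<mu> \<le> (\<integral>\<^sup>+t. ennreal (Phi \<phi> (k * norm (D t)) + f (extremal t)) \<partial>lborel)"
proof -
  have Pm [measurable]: "(\<lambda>v::'a. Phi \<phi> (norm v)) \<in> borel_measurable borel" by (rule Phi_measurable)
  have [measurable]: "(\<lambda>t. f (extremal t)) \<in> borel_measurable borel"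
    by (intro borel_measurable_continuous_onI continuous_on_compose2[OF continuous_on_f[of UNIV] extremal_continuous]) auto
  have [measurable]: "(\<lambda>t. Phi \<phi> (k * norm (D t))) \<in> borel_measurable borel"
    using measurable_compose[OF _ Pm, of "\<lambda>t. k *\<^sub>R D t" borel] k by simp
  have km: "k * norm (D t) = norm (k *\<^sub>R D t)" for t using k by simp
  have "min_action \<phi> V c A B \<le> (\<integral>\<^sup>+t. ennreal (Phi \<phi> (norm (k *\<^sub>R D (k * t))) + f (extremal (k * t))) \<partial>lborel)"
  proof (rule min_action_le[OF V, of "\<lambda>t. extremal (k * t)" "(\<lambda>z. z / k) ` Z" "\<lambda>t. k *\<^sub>R D (k * t)" "k * R"])
    show "continuous_on UNIV (\<lambda>t. extremal (k * t))"
      by (rule continuous_on_compose2[OF extremal_continuous[of UNIV]]) (auto intro!: continuous_intros)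
    show "norm (k *\<^sub>R D (k * t)) \<le> k * R" for t using norm_D[of "k * t"] k by simp
    show "f (extremal (k * t)) \<ge> 0" for t by (rule f_nonneg[OF extremal_in_K])
    show "((\<lambda>t. infdist (extremal (k * t)) A) \<longlongrightarrow> 0) at_bot"
      by (rule filterlim_compose[OF lim_extremal_A]) (use k in \<open>auto intro!: filterlim_tendsto_pos_mult_at_bot tendsto_const filterlim_ident\<close>)
    show "((\<lambda>t. infdist (extremal (k * t)) B) \<longlongrightarrow> 0) at_top"
      by (rule filterlim_compose[OF lim_extremal_B]) (use k in \<open>auto intro!: filterlim_tendsto_pos_mult_at_top tendsto_const filterlim_ident\<close>)
    show "((\<lambda>t. extremal (k * t)) has_vector_derivative k *\<^sub>R D (k * t)) (at t)" if "t \<notin> (\<lambda>z. z / k) ` Z" for t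
    proof -
      have "k * t \<notin> Z"
      proof
        assume "k * t \<in> Z"
        then have "t \<in> (\<lambda>z. z / k) ` Z" using k by (intro image_eqI[of _ _ "k * t"]) auto
        then show False using that by simp
      qed
      from extremal_derivative[OF this]
      have "(extremal \<circ> (\<lambda>t. k * t) has_vector_derivative k *\<^sub>R D (k * t)) (at t)"
        by (intro vector_diff_chain_at) (auto intro!: derivative_eq_intros)
      then show ?thesis by (simp add: o_def)
    qed
    show "(\<lambda>t. k *\<^sub>R D (k * t)) \<in> borel_measurable borel" by measurable
  qed (simp add: Z_def)
  then have "ennreal k * ennreal \<mu> \<le> ennreal k * (\<integral>\<^sup>+t. ennreal (Phi \<phi> (norm (k *\<^sub>R D (k * t))) + f (extremal (k * t))) \<partial>lborel)"
    unfolding min_action_eq by (rule mult_left_mono) simp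
  also have "\<dots> = (\<integral>\<^sup>+t. ennreal (Phi \<phi> (norm (k *\<^sub>R D t)) + f (extremal t)) \<partial>lborel)"
    using k by (subst nn_integral_real_affine[where c=k and t=0 and f="\<lambda>t. ennreal (Phi \<phi> (norm (k *\<^sub>R D t)) + f (extremal t))"]) auto
  finally show ?thesis using k by (simp add: abs_of_pos)
qed


section \<open>Action and energy of the extremal\<close>

definition lagrangian :: "real \<Rightarrow> real" where "lagrangian t = Phi \<phi> (norm (D t)) + f (extremal t)"

lemma lagrangian_nonneg: "lagrangian t \<ge> 0"
  using Phi_nonneg[of "norm (D t)"] f_nonneg[OF extremal_in_K[of t]] by (simp add: lagrangian_def)

lemma lagrangian_zero: "t \<notin> J \<Longrightarrow> lagrangian t = 0"
  by (simp add: lagrangian_def D_def f_extremal_zero)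

text \<open>These are the boundary limits for the improper fundamental theorem of calculus; at
  infinite ends they exist because S is monotone and bounded.\<close>

lemma S_limits:
  obtains a b where "((S \<circ> real_of_ereal) \<longlongrightarrow> a) (at_right \<alpha>)" "((S \<circ> real_of_ereal) \<longlongrightarrow> b) (at_left \<omega>)"
proof -
  have c: "isCont S t" for t using S_continuous by (simp add: continuous_on_eq_continuous_at)
  have "\<exists>a. ((S \<circ> real_of_ereal) \<longlongrightarrow> a) (at_right \<alpha>)"
  proof (cases \<alpha>)
    case (real r)
    have "(S \<longlongrightarrow> S r) (at_right r)" using c[of r] unfolding isCont_def filterlim_at_split by blast
    then show ?thesis using real by (auto simp: ereal_tendsto_simps)
  next
    case MInf
    then show ?thesis using monotone_tendsto_at_bot[OF S_mono S_nonneg] by (auto simp: ereal_tendsto_simps)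
  qed (use \<alpha>_neg in auto)
  moreover have "\<exists>b. ((S \<circ> real_of_ereal) \<longlongrightarrow> b) (at_left \<omega>)"
  proof (cases \<omega>)
    case (real r)
    have "(S \<longlongrightarrow> S r) (at_left r)" using c[of r] unfolding isCont_def filterlim_at_split by blast
    then show ?thesis using real by (auto simp: ereal_tendsto_simps)
  next
    case PInf
    then show ?thesis using monotone_tendsto_at_top[OF S_mono S_le] by (auto simp: ereal_tendsto_simps)
  qed (use \<omega>_pos in auto)
  ultimately show ?thesis using that by blast
qed

text \<open>The integral is the increase of S over J, at most \<mu> because S stays between 0 and
  \<mu>; it is at least \<mu> because the extremal is a competitor, the case k = 1 of the rescaling
  bound.\<close>

lemma lagrangian_integral: "integrable lborel lagrangian" "integral\<^sup>L lborel lagrangian = \<mu>"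
proof -
  let ?g = "\<lambda>t. Phi \<phi> (norm (vel (p t))) + f (q t)"
  obtain a b where ab: "((S \<circ> real_of_ereal) \<longlongrightarrow> a) (at_right \<alpha>)" "((S \<circ> real_of_ereal) \<longlongrightarrow> b) (at_left \<omega>)"
    by (rule S_limits)
  have cg: "continuous_on UNIV ?g"
    by (intro continuous_on_add continuous_on_compose2[OF continuous_on_Phi_norm[of UNIV] vel_p_continuous]
        continuous_on_compose2[OF continuous_on_f[of UNIV] q_continuous]) auto
  have inJ: "t \<in> J" if "\<alpha> < ereal t" "ereal t < \<omega>" for t using that by (simp add: J_def einterval_iff)
  have d: "(S has_real_derivative ?g t) (at t)" if "\<alpha> < ereal t" "ereal t < \<omega>" for t
    by (rule S_derivative[OF J_U[OF inJ[OF that]]])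
  have ic: "isCont ?g t" for t using cg by (simp add: continuous_on_eq_continuous_at)
  have nonneg: "AE t in lborel. \<alpha> < ereal t \<longrightarrow> ereal t < \<omega> \<longrightarrow> 0 \<le> ?g t"
    by (intro AE_I2 impI add_nonneg_nonneg Phi_nonneg f_nonneg q_in_K) simp
  have "set_integrable lborel (einterval \<alpha> \<omega>) ?g" "(LBINT t=\<alpha>..\<omega>. ?g t) = b - a"
    using interval_integral_FTC_nonneg[OF \<alpha>_less_\<omega> d ic nonneg ab] by blast+
  then have i: "set_integrable lborel J ?g" "(LINT t:J|lborel. ?g t) = b - a"
    using less_imp_le[OF \<alpha>_less_\<omega>] by (auto simp: J_def interval_lebesgue_integral_def)
  have e: "lagrangian t = indicator J t *\<^sub>R ?g t" for t
    using lagrangian_zero[of t] by (cases "t \<in> J") (auto simp: lagrangian_def D_def extremal_J)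
  show int: "integrable lborel lagrangian"
    using i(1) by (simp add: set_integrable_def e[abs_def])
  have "a \<ge> 0"
  proof (rule tendsto_lowerbound[OF ab(1)])
    show "\<forall>\<^sub>F x in at_right \<alpha>. 0 \<le> (S \<circ> real_of_ereal) x" using S_nonneg by simp
    show "at_right \<alpha> \<noteq> bot" using \<alpha>_neg by (cases \<alpha>) (auto simp: at_right_ereal at_right_MInf filtermap_bot_iff)
  qed
  moreover have "b \<le> \<mu>"
  proof (rule tendsto_upperbound[OF ab(2)])
    show "\<forall>\<^sub>F x in at_left \<omega>. (S \<circ> real_of_ereal) x \<le> \<mu>" using S_le by (simp add: \<mu>_def)
    show "at_left \<omega> \<noteq> bot" using \<omega>_pos by (cases \<omega>) (auto simp: at_left_ereal at_left_PInf filtermap_bot_iff)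
  qed
  moreover have I: "integral\<^sup>L lborel lagrangian = b - a"
    using i(2) by (simp add: set_lebesgue_integral_def e[abs_def])
  moreover have "ennreal \<mu> \<le> ennreal (integral\<^sup>L lborel lagrangian)"
    using min_action_le_rescaled[of 1] nn_integral_eq_integral[OF int] lagrangian_nonneg
    by (simp add: lagrangian_def[symmetric])
  then have "\<mu> \<le> integral\<^sup>L lborel lagrangian"
    using lagrangian_nonneg by (subst (asm) ennreal_le_iff) (auto intro: integral_nonneg_AE)
  ultimately show "integral\<^sup>L lborel lagrangian = \<mu>" by linarith
qed

text \<open>As a function of (q, p) the energy is a Hamiltonian, whose derivative along the
  first-order system cancels. Second derivatives of q, not yet available, are avoided.\<close>

lemma energy_constant:
  obtains \<kappa> where "\<And>t. t \<in> J \<Longrightarrow> Gfun \<phi> (norm (D t)) - f (extremal t) = \<kappa>"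
proof -
  have "is_interval J"
    unfolding is_interval_1
  proof (intro ballI allI impI)
    fix a b x assume "a \<in> J" "b \<in> J" "a \<le> x \<and> x \<le> b"
    then have "\<alpha> < ereal a" "ereal a \<le> ereal x" "ereal x \<le> ereal b" "ereal b < \<omega>"
      by (auto simp: J_def einterval_iff)
    then show "x \<in> J" unfolding J_def einterval_iff by (meson less_le_trans le_less_trans)
  qed
  then have cJ: "convex J" by (simp add: is_interval_convex)
  let ?E = "\<lambda>t. Gfun \<phi> (norm (vel (p t))) - f (q t)"
  have "(?E has_derivative (\<lambda>h. 0)) (at t within J)" if t: "t \<in> J" for t
  proof -
    have U: "q t \<in> U" by (rule J_U[OF t])
    have "((\<lambda>t. Gfun \<phi> (norm (vel (p t)))) has_derivative (\<lambda>h. vel (p t) \<bullet> (h *\<^sub>R df (q t)))) (at t)"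
      by (rule has_derivative_compose[OF p_derivative[OF U, unfolded has_vector_derivative_def] Gfun_vel_has_derivative])
    moreover have "((\<lambda>t. f (q t)) has_derivative (\<lambda>h. df (q t) \<bullet> (h *\<^sub>R vel (p t)))) (at t)"
      by (rule has_derivative_compose[OF q_derivative[OF U, unfolded has_vector_derivative_def] f_derivative])
    ultimately have "(?E has_derivative (\<lambda>h. vel (p t) \<bullet> (h *\<^sub>R df (q t)) - df (q t) \<bullet> (h *\<^sub>R vel (p t)))) (at t)"
      by (rule has_derivative_diff)
    then have "(?E has_derivative (\<lambda>h. 0)) (at t)" by (simp add: inner_commute)
    then show ?thesis by (rule has_derivative_at_withinI)
  qed
  from has_derivative_zero_constant[OF cJ this] obtain \<kappa> where "\<And>t. t \<in> J \<Longrightarrow> ?E t = \<kappa>" by blast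
  then show ?thesis by (intro that[of \<kappa>]) (simp add: D_def extremal_J)
qed

text \<open>The action of \<open>t \<mapsto> extremal (k * t)\<close> is minimal at \<open>k = 1\<close>, which forces the constant energy to vanish.
  If it did not, \<open>J\<close> would have finite length because the energy is dominated by the Lagrangian.\<close>

lemma energy_zero: assumes "t \<in> J" shows "Gfun \<phi> (norm (D t)) = f (extremal t)"
proof -
  obtain \<kappa> where kap: "\<And>t. t \<in> J \<Longrightarrow> Gfun \<phi> (norm (D t)) - f (extremal t) = \<kappa>" using energy_constant by blast
  have "\<kappa> = 0"
  proof (rule ccontr)
    assume k0: "\<kappa> \<noteq> 0"
    have mL [measurable]: "lagrangian \<in> borel_measurable borel" using lagrangian_integral(1) by auto
    have m1: "m > 1" using lm by simp
    \<comment> \<open>G \<le> (m - 1) Phi lets the Lagrangian dominate the energy, so |\<kappa>|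
      times the length of J is at most m \<mu>; a constant on J can then serve as dominating
      function.\<close>
    have kb: "\<bar>\<kappa>\<bar> \<le> m * lagrangian t" if t: "t \<in> J" for t
    proof -
      have G: "0 \<le> Gfun \<phi> (norm (D t))" "Gfun \<phi> (norm (D t)) \<le> (m - 1) * Phi \<phi> (norm (D t))"
        by (auto intro: Gfun_nonneg Gfun_le)
      have F: "0 \<le> f (extremal t)" "f (extremal t) \<le> m * f (extremal t)"
        using f_nonneg[OF extremal_in_K[of t]] mult_right_mono[of 1 m "f (extremal t)"] m1 by auto
      have P: "(m - 1) * Phi \<phi> (norm (D t)) \<le> m * Phi \<phi> (norm (D t))"
        using Phi_nonneg[of "norm (D t)"] by (intro mult_right_mono) auto
      have "\<bar>\<kappa>\<bar> \<le> Gfun \<phi> (norm (D t)) + f (extremal t)" using kap[OF t] G(1) F(1) by linarith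
      also have "\<dots> \<le> m * Phi \<phi> (norm (D t)) + m * f (extremal t)" using G(2) F(2) P by linarith
      finally show ?thesis by (simp add: lagrangian_def distrib_left)
    qed
    have "integrable lborel (indicator J :: real \<Rightarrow> real)"
    proof (rule Bochner_Integration.integrable_bound[of _ "\<lambda>t. (m / \<bar>\<kappa>\<bar>) * lagrangian t"])
      show "integrable lborel (\<lambda>t. (m / \<bar>\<kappa>\<bar>) * lagrangian t)" using lagrangian_integral(1) by simp
      show "AE t in lborel. norm (indicator J t :: real) \<le> norm ((m / \<bar>\<kappa>\<bar>) * lagrangian t)"
        using kb k0 m1 lagrangian_nonneg by (intro AE_I2) (auto simp: indicator_def field_simps)
    qed simp
    then have iJ: "integrable lborel (\<lambda>t. C * indicator J t :: real)" for C by simp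
    define w where "w t = norm (D t)" for t
    have w: "0 \<le> w t" "w t \<le> R" for t using norm_D by (auto simp: w_def)
    have w_zero: "w t = 0" if "t \<notin> J" for t using that by (simp add: w_def D_def)
    have mom_m [measurable]: "(mom :: 'a \<Rightarrow> 'a) \<in> borel_measurable borel"
      by (intro borel_measurable_continuous_onI continuous_at_imp_continuous_on ballI isCont_mom)
    have fw: "flux (k * w t) = norm (mom (k *\<^sub>R D t))" if "k > 0" for k t
      using that by (simp add: norm_mom w_def)
    have mW: "(\<lambda>t. w t * flux (k * w t)) \<in> borel_measurable lborel" if "k > 0" for k
      unfolding fw[OF that] unfolding w_def by measurable
    have bW: "norm (w t * flux (k * w t)) \<le> R * flux (2 * R) * indicator J t" if k: "0 < k" "k \<le> 2" for k t
    proof (cases "t \<in> J")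
      case True
      have "flux (k * w t) \<le> flux (2 * R)" using k w[of t] by (intro flux_mono mult_mono) auto
      moreover have "flux (k * w t) \<ge> 0" using k w[of t] by (intro flux_nonneg) auto
      ultimately show ?thesis using True w[of t] by (auto simp: abs_mult intro!: mult_mono)
    qed (simp add: w_zero)
    have iW: "integrable lborel (\<lambda>t. w t * flux (k * w t))" if k: "0 < k" "k \<le> 2" for k
      by (rule Bochner_Integration.integrable_bound[OF iJ[of "R * flux (2 * R)"] mW[OF k(1)]])
        (use bW[OF k] flux_nonneg[of "2 * R"] R in \<open>auto simp: abs_mult indicator_def\<close>)
    \<comment> \<open>The formal derivative of the rescaled kinetic action with respect to
      k.\<close>
    define W where "W k = (LINT t|lborel. w t * flux (k * w t))" for k
    \<comment> \<open>The tangent of Phi at k w, evaluated at w, replaces differentiation under the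
      integral: the rescaling bound becomes k \<mu> \<le> \<mu> + (k - 1) W k.\<close>
    have key: "(k - 1) * (W k - \<mu>) \<ge> 0" if k: "0 < k" "k \<le> 2" for k
    proof -
      let ?h = "\<lambda>t. lagrangian t + (k - 1) * (w t * flux (k * w t))"
      have le: "Phi \<phi> (k * norm (D t)) + f (extremal t) \<le> ?h t" for t
        using Phi_tangent[of "k * w t" "w t"] k w[of t] by (simp add: lagrangian_def w_def algebra_simps)
      have h0: "?h t \<ge> 0" for t
        using le[of t] Phi_nonneg[of "k * norm (D t)"] f_nonneg[OF extremal_in_K[of t]] k by auto
      have ih: "integrable lborel ?h" using lagrangian_integral(1) iW[OF k] by simp
      have "ennreal k * ennreal \<mu> \<le> (\<integral>\<^sup>+t. ennreal (Phi \<phi> (k * norm (D t)) + f (extremal t)) \<partial>lborel)"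
        by (rule min_action_le_rescaled[OF k(1)])
      also have "\<dots> \<le> (\<integral>\<^sup>+t. ennreal (?h t) \<partial>lborel)" by (intro nn_integral_mono ennreal_leI le)
      also have "\<dots> = ennreal (LINT t|lborel. ?h t)" by (rule nn_integral_eq_integral[OF ih]) (use h0 in simp)
      also have "(LINT t|lborel. ?h t) = \<mu> + (k - 1) * W k"
        using lagrangian_integral iW[OF k] by (simp add: W_def)
      finally have "ennreal k * ennreal \<mu> \<le> ennreal (\<mu> + (k - 1) * W k)" .
      moreover have "ennreal (k * \<mu>) = ennreal k * ennreal \<mu>"
        by (rule ennreal_mult) (use k in \<open>auto simp: \<mu>_def\<close>)
      ultimately have "ennreal (k * \<mu>) \<le> ennreal (\<mu> + (k - 1) * W k)" by simp
      moreover have "0 \<le> \<mu> + (k - 1) * W k"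
        using \<open>(LINT t|lborel. ?h t) = \<mu> + (k - 1) * W k\<close> h0 by (metis (no_types, lifting) AE_I2 integral_nonneg_AE)
      ultimately have "k * \<mu> \<le> \<mu> + (k - 1) * W k" by (simp add: ennreal_le_iff)
      then show ?thesis by (simp add: algebra_simps)
    qed
    have limW: "(\<lambda>n. W (k n)) \<longlonglongrightarrow> W 1" if k: "k \<longlonglongrightarrow> 1" "\<And>n::nat. 0 < k n" "\<And>n. k n \<le> 2" for k
      unfolding W_def
    proof (rule integral_dominated_convergence[where w="\<lambda>t. R * flux (2 * R) * indicator J t"])
      show "AE t in lborel. (\<lambda>n. w t * flux (k n * w t)) \<longlonglongrightarrow> w t * flux (1 * w t)"
      proof (rule AE_I2)
        fix t
        have "(\<lambda>n. norm (mom (k n *\<^sub>R D t))) \<longlonglongrightarrow> norm (mom (1 *\<^sub>R D t))"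
          by (intro tendsto_norm isCont_tendsto_compose[OF isCont_mom] tendsto_scaleR k tendsto_const)
        then show "(\<lambda>n. w t * flux (k n * w t)) \<longlonglongrightarrow> w t * flux (1 * w t)"
          unfolding fw[OF k(2)] fw[OF zero_less_one] by (rule tendsto_mult_left)
      qed
      show "AE t in lborel. norm (w t * flux (k n * w t)) \<le> R * flux (2 * R) * indicator J t" for n
        by (rule AE_I2) (rule bW[OF k(2,3)])
      show "(\<lambda>t. w t * flux (1 * w t)) \<in> borel_measurable lborel" by (rule mW) simp
      show "(\<lambda>t. w t * flux (k n * w t)) \<in> borel_measurable lborel" for n by (rule mW[OF k(2)])
    qed (rule iJ)
    \<comment> \<open>Divide by k - 1 > 0 and let k decrease to 1; factors below 1 give the opposite
      inequality, where n + 2 keeps k positive.\<close>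
    have "\<mu> \<le> W 1"
    proof (rule LIMSEQ_le_const[OF limW[of "\<lambda>n. 1 + 1 / (real n + 1)"]])
      show "(\<lambda>n. 1 + 1 / (real n + 1)) \<longlonglongrightarrow> 1" by real_asymp
      show "\<exists>N. \<forall>n\<ge>N. \<mu> \<le> W (1 + 1 / (real n + 1))"
        using key[of "1 + 1 / (real n + 1)" for n] by (auto simp: zero_le_divide_iff zero_le_mult_iff field_simps)
    qed (auto simp: field_simps add_pos_nonneg)
    moreover have "W 1 \<le> \<mu>"
    proof (rule LIMSEQ_le_const2[OF limW[of "\<lambda>n. 1 - 1 / (real n + 2)"]])
      show "(\<lambda>n. 1 - 1 / (real n + 2)) \<longlonglongrightarrow> 1" by real_asymp
      have "W (1 - 1 / (real n + 2)) \<le> \<mu>" for n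
        using key[of "1 - 1 / (real n + 2)"] by (auto simp: zero_le_mult_iff field_simps)
      then show "\<exists>N. \<forall>n\<ge>N. W (1 - 1 / (real n + 2)) \<le> \<mu>" by blast
    qed (auto simp: field_simps)
    ultimately have "W 1 = \<mu>" by simp
    then have "(LINT t|lborel. w t * flux (1 * w t) - lagrangian t) = 0"
      using lagrangian_integral iW[of 1] by (simp add: W_def)
    \<comment> \<open>On J the difference is G - f, the constant energy; its integral vanishes by W
      1 = \<mu>, yet equals \<kappa> times the positive length of J.\<close>
    moreover have "w t * flux (1 * w t) - lagrangian t = \<kappa> * indicator J t" for t
    proof (cases "t \<in> J")
      case True
      then show ?thesis using kap[OF True] Gfun_eq[OF w(1)[of t]] by (simp add: lagrangian_def w_def mult.commute)
    qed (simp add: w_zero lagrangian_zero)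
    ultimately have "measure lborel J = 0" using k0 by simp
    moreover obtain e where e: "e > 0" "cball 0 e \<subseteq> J" using open_J zero_in_J open_contains_cball by blast
    then have "measure lborel {-e..e} \<le> measure lborel J"
      using \<open>integrable lborel (indicator J :: real \<Rightarrow> real)\<close>
      by (intro measure_mono_fmeasurable) (auto simp: integrable_indicator_iff fmeasurable_def cball_def dist_real_def subset_iff abs_le_iff)
    ultimately show False using e(1) by simp
  qed
  then show ?thesis using kap[OF assms] by simp
qed

lemma energy_eq: "Gfun \<phi> (norm (D t)) = f (extremal t)"
  using energy_zero[of t] f_extremal_zero[of t] by (cases "t \<in> J") (auto simp: D_def Gfun_def)

text \<open>The velocity vanishes at the end points of \<open>J\<close>, where \<open>f (extremal t) = 0\<close>.\<close>

lemma D_continuous: "continuous_on T D"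
proof (intro continuous_at_imp_continuous_on ballI)
  fix t
  show "isCont D t"
  proof (cases "t \<in> J")
    case True
    have "isCont (\<lambda>t. vel (p t)) t"
      using vel_p_continuous[of UNIV] by (simp add: continuous_on_eq_continuous_at)
    moreover have "\<forall>\<^sub>F s in nhds t. D s = vel (p s)"
      using eventually_nhds_in_open[OF open_J True] by eventually_elim (simp add: D_def)
    ultimately show ?thesis by (simp add: isCont_cong)
  next
    case False
    have "isCont (\<lambda>t. f (extremal t)) t"
      using continuous_on_compose2[OF continuous_on_f[of UNIV] extremal_continuous[of UNIV]]
      by (simp add: continuous_on_eq_continuous_at)
    then have lim: "((\<lambda>t. f (extremal t)) \<longlongrightarrow> 0) (at t)" using f_extremal_zero[OF False] by (simp add: isCont_def)
    \<comment> \<open>\<open>Gfun\<close> is increasing and positive off 0, so G(|D|) = f tending to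
      0 forces |D| to 0.\<close>
    have "((\<lambda>s. norm (D s)) \<longlongrightarrow> 0) (at t)"
    proof (rule order_tendstoI)
      fix e :: real assume e: "0 < e"
      have "\<forall>\<^sub>F s in at t. f (extremal s) < Gfun \<phi> e" using order_tendstoD(2)[OF lim Gfun_pos[OF e]] .
      then show "\<forall>\<^sub>F s in at t. norm (D s) < e"
      proof eventually_elim
        fix s assume "f (extremal s) < Gfun \<phi> e"
        then show "norm (D s) < e"
          using Gfun_mono[of e "norm (D s)"] e energy_eq[of s] by (cases "norm (D s) < e") auto
      qed
    next
      fix a :: real assume "a < 0"
      then show "\<forall>\<^sub>F s in at t. a < norm (D s)"
        by (intro always_eventually allI less_le_trans[OF _ norm_ge_zero])
    qed
    then have "(D \<longlongrightarrow> 0) (at t)" by (rule tendsto_norm_zero_cancel)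
    then show ?thesis using False by (simp add: isCont_def D_def)
  qed
qed

text \<open>The curve is the integral of its derivative off the finite set Z, and that derivative is
  continuous; so the exceptional points disappear and the curve is C^1 across the end points of
  J.\<close>

lemma extremal_derivative': "(extremal has_vector_derivative D t) (at t)"
proof -
  let ?a = "t - 1" and ?b = "t + 1"
  have hi: "(D has_integral (extremal y - extremal ?a)) {?a..y}" if "?a \<le> y" for y
    by (rule fundamental_theorem_of_calculus_interior_strong[of Z])
      (use that in \<open>auto simp: Z_def intro!: extremal_derivative extremal_continuous[unfolded Z_def]\<close>)
  have "((\<lambda>u. integral {?a..u} D) has_vector_derivative D t) (at t within {?a..?b})"
    by (rule integral_has_vector_derivative[OF D_continuous]) simp
  then have "((\<lambda>u. extremal ?a + integral {?a..u} D) has_vector_derivative D t) (at t within {?a..?b})"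
    by (auto intro!: derivative_eq_intros)
  then have "(extremal has_vector_derivative D t) (at t within {?a..?b})"
    by (rule has_vector_derivative_transform[rotated 2]) (use integral_unique[OF hi] in auto)
  then have "(extremal has_vector_derivative D t) (at t within {?a<..<?b})"
    by (rule has_vector_derivative_within_subset) auto
  then show ?thesis by (subst (asm) at_within_open) auto
qed

lemma velocity_extremal: "velocity extremal t = D t"
  by (rule vector_derivative_at[OF extremal_derivative'])

theorem minimal_connection_exists:
  "\<alpha> < \<omega> \<and> minimal_connection \<phi> V c A B \<alpha> \<omega> extremal \<and> C2_on (einterval \<alpha> \<omega>) extremal \<and>
   C1_within (closure (einterval \<alpha> \<omega>)) extremal \<and> solves_EL \<phi> V (einterval \<alpha> \<omega>) extremal \<and>
   (\<forall>t\<in>einterval \<alpha> \<omega>. energy \<phi> V extremal t = - c)"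
proof -
  have en: "energy \<phi> V extremal t = - c" for t
    unfolding energy_def velocity_extremal energy_eq V by simp
  have C1: "C1_within (closure J) extremal"
    unfolding C1_within_def
    by (intro exI[of _ D] conjI ballI D_continuous has_vector_derivative_at_within[OF extremal_derivative'])
  have DJ: "D t = vel (p t)" if "t \<in> J" for t using that by (simp add: D_def)
  have EL: "solves_EL \<phi> V J extremal"
    unfolding solves_EL_def velocity_extremal
  proof
    fix t assume t: "t \<in> J"
    have "(p has_vector_derivative grad V (extremal t)) (at t)"
      using p_derivative[OF J_U[OF t]] t by (simp add: gradV extremal_J)
    then show "((\<lambda>s. \<phi> (norm (D s)) *\<^sub>R D s) has_vector_derivative grad V (extremal t)) (at t)"
      by (rule has_vector_derivative_transform_within_open[OF _ open_J t])
        (simp add: DJ mom_def[symmetric])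
  qed
  \<comment> \<open>Inside J the kinetic part of the energy equals f > 0, so the momentum does not
    vanish and the velocity inherits its C^1 regularity.\<close>
  have nz: "p t \<noteq> 0" if t: "t \<in> J" for t
  proof
    assume "p t = 0"
    then have "D t = 0" using t by (simp add: D_def)
    then show False using energy_eq[of t] f_extremal_pos[OF t] by (simp add: Gfun_def)
  qed
  have "(\<lambda>t. vel (p t)) C1_differentiable_on J"
    by (rule vel_C1[OF p_derivative[OF J_U]])
      (use nz in \<open>auto intro: continuous_on_compose2[OF df_continuous q_continuous]\<close>)
  then obtain D' where D': "\<And>t. t \<in> J \<Longrightarrow> ((\<lambda>t. vel (p t)) has_vector_derivative D' t) (at t)" "continuous_on J D'"
    by (auto simp: C1_differentiable_on_def)
  have "(D has_vector_derivative D' t) (at t)" if t: "t \<in> J" for t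
    by (rule has_vector_derivative_transform_within_open[OF D'(1)[OF t] open_J t]) (simp add: DJ)
  then have "D C1_differentiable_on J" using D'(2) by (auto simp: C1_differentiable_on_def)
  then have C2: "C2_on J extremal" unfolding C2_on_def using extremal_derivative' by blast
  have "action \<phi> V c J extremal = (\<integral>\<^sup>+t\<in>J. ennreal (Phi \<phi> (norm (D t)) + V (extremal t) - c) \<partial>lebesgue)"
    by (rule action_eq[OF open_J extremal_continuous weak_derivative_piecewise_C1[where Z=Z, OF extremal_continuous _ D_measurable norm_D extremal_derivative]])
      (simp add: Z_def)
  also have "\<dots> = (\<integral>\<^sup>+t. ennreal (lagrangian t) \<partial>lebesgue)"
    by (rule nn_integral_cong) (use lagrangian_zero in \<open>auto simp: lagrangian_def V indicator_def add_diff_eq\<close>)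
  also have "\<dots> = (\<integral>\<^sup>+t. ennreal (lagrangian t) \<partial>lborel)" by (rule nn_integral_completion)
  also have "\<dots> = ennreal \<mu>"
    using nn_integral_eq_integral[OF lagrangian_integral(1)] lagrangian_nonneg lagrangian_integral(2) by simp
  finally have act: "action \<phi> V c J extremal = min_action \<phi> V c A B" by (simp add: min_action_eq)
  have Linf: "extremal \<in> Linfty J"
  proof -
    obtain BK where "\<And>x. x \<in> K \<Longrightarrow> norm x \<le> BK"
      using compact_imp_bounded[OF compact_K] unfolding bounded_iff by blast
    then have "AE t in lebesgue. t \<in> J \<longrightarrow> norm (extremal t) \<le> BK" using extremal_in_K by simp
    moreover have "(\<lambda>t. indicator J t *\<^sub>R extremal t) \<in> borel_measurable borel"
      using borel_measurable_continuous_onI[OF extremal_continuous] by measurable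
    then have "set_borel_measurable lebesgue J extremal"
      unfolding set_borel_measurable_def by (intro measurable_completion) simp
    ultimately show ?thesis by (auto simp: Linfty_def)
  qed
  have cA: "isCont (\<lambda>t. infdist (extremal t) T) t" for T t
    using extremal_continuous[of UNIV] by (intro continuous_infdist) (simp add: continuous_on_eq_continuous_at)
  have "(((\<lambda>t. infdist (extremal t) A) \<circ> real_of_ereal) \<longlongrightarrow> 0) (at_right \<alpha>)"
  proof (cases \<alpha>)
    case (real a)
    then have "infdist (extremal a) A = 0" using extremal_low[of a] by (simp add: infdist_A_0)
    then show ?thesis using cA[of a A] real by (simp add: ereal_tendsto_simps isCont_def filterlim_at_split)
  next
    case MInf then show ?thesis using lim_extremal_A by (simp add: ereal_tendsto_simps)
  qed (use \<alpha>_neg in auto)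
  moreover have "(((\<lambda>t. infdist (extremal t) B) \<circ> real_of_ereal) \<longlongrightarrow> 0) (at_left \<omega>)"
  proof (cases \<omega>)
    case (real b)
    then have "infdist (extremal b) B = 0" using extremal_high[of b] by (simp add: infdist_B_0)
    then show ?thesis using cA[of b B] real by (simp add: ereal_tendsto_simps isCont_def filterlim_at_split)
  next
    case PInf then show ?thesis using lim_extremal_B by (simp add: ereal_tendsto_simps)
  qed (use \<omega>_pos in auto)
  moreover have "V (extremal t) > c" if "t \<in> J" for t using f_extremal_pos[OF that] by (simp add: V)
  ultimately have "minimal_connection \<phi> V c A B \<alpha> \<omega> extremal"
    using Linf C1 C2 EL act en unfolding minimal_connection_def Let_def J_def by blast
  then show ?thesis using \<alpha>_less_\<omega> C1 C2 EL en unfolding J_def by blast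
qed

end

theorem (in well) exists_minimal_connection:
  assumes V: "\<And>x. f x = V x - c" and gradV: "\<And>x. grad V x = df x"
  shows "\<exists>\<alpha> \<omega> :: ereal. \<exists>q. \<alpha> < \<omega> \<and> minimal_connection \<phi> V c A B \<alpha> \<omega> q \<and> C2_on (einterval \<alpha> \<omega>) q \<and>
    C1_within (closure (einterval \<alpha> \<omega>)) q \<and> solves_EL \<phi> V (einterval \<alpha> \<omega>) q \<and>
    (\<forall>t\<in>einterval \<alpha> \<omega>. energy \<phi> V q t = - c)"
proof (rule limit_curve[OF min_action_polygons[OF V]])
  fix q p :: "real \<Rightarrow> 'a" and S :: "real \<Rightarrow> real" and R \<delta> L
  assume *: "0 < R" "0 < \<delta>" "0 < L" "\<And>s t. norm (q t - q s) \<le> L * \<bar>t - s\<bar>"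
    "continuous_on UNIV p" "continuous_on UNIV S" "\<And>t. norm (p t) \<le> flux R"
    "\<And>t. q t \<in> K" "\<And>t. t \<le> 0 \<Longrightarrow> infdist (q t) A \<le> gap / 2" "infdist (q 0) A = gap / 2"
    "\<And>t. 0 \<le> t \<Longrightarrow> \<delta> \<le> infdist (q t) A" "mono S" "\<And>t. 0 \<le> S t"
    "\<And>t. S t \<le> enn2real (min_action \<phi> V c A B)"
    "\<And>t. q t \<in> U \<Longrightarrow> (q has_vector_derivative vel (p t)) (at t)"
    "\<And>t. q t \<in> U \<Longrightarrow> (p has_vector_derivative df (q t)) (at t)"
    "\<And>t. q t \<in> U \<Longrightarrow> (S has_real_derivative Phi \<phi> (norm (vel (p t))) + f (q t)) (at t)"
  interpret minimizer \<phi> l m f df A B V c q p S R \<delta> L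
    by unfold_locales (fact V gradV *)+
  show ?thesis using minimal_connection_exists by blast
qed

section \<open>The potential well\<close>

lemma continuous_on_C1_scalar_field:
  assumes "C1_scalar_field V" shows "continuous_on S V"
  using assms unfolding C1_scalar_field_def gderiv_def
  by (blast intro: continuous_at_imp_continuous_on has_derivative_continuous)

text \<open>Justifies the definite description in \<open>grad\<close>.\<close>

lemma GDERIV_unique: "GDERIV V x :> D \<Longrightarrow> GDERIV V x :> D' \<Longrightarrow> D = (D' :: 'a::real_inner)"
proof -
  assume "GDERIV V x :> D" "GDERIV V x :> D'"
  then have "(\<lambda>h. h \<bullet> D) = (\<lambda>h. h \<bullet> D')" unfolding gderiv_def by (rule has_derivative_unique)
  then have "(D - D') \<bullet> D = (D - D') \<bullet> D'" by (rule fun_cong)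
  then have "(D - D') \<bullet> (D - D') = 0" by (simp add: inner_diff_right)
  then show "D = D'" by simp
qed

lemma GDERIV_grad:
  assumes "C1_scalar_field V" shows "GDERIV V x :> grad V x"
proof -
  obtain D where "GDERIV V x :> D" using assms by (auto simp: C1_scalar_field_def)
  then show ?thesis unfolding grad_def by (metis (mono_tags) GDERIV_unique theI)
qed

lemma infdist_le_norm_add: "infdist 0 T \<le> norm x + infdist x T"
  using infdist_triangle[of 0 T x] by (simp add: add.commute)

theorem proposition4p6:
  fixes \<phi> :: "real \<Rightarrow> real" and l m r0 c :: real and V :: "real ^ 'n \<Rightarrow> real"
  assumes phi_pos: "\<And>s. s > 0 \<Longrightarrow> \<phi> s > 0"
    and phi_C1: "\<phi> C1_differentiable_on {0<..}"
    and lm: "1 < l" "l \<le> m"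
    and phi_incr: "\<And>s. s > 0 \<Longrightarrow> deriv (\<lambda>r. \<phi> r * r) s > 0"
    and phi_growth: "\<And>s. s > 0 \<Longrightarrow> l - 1 \<le> deriv (\<lambda>r. \<phi> r * r) s / \<phi> s \<and>
                                    deriv (\<lambda>r. \<phi> r * r) s / \<phi> s \<le> m - 1"
    and V_C1: "C1_scalar_field V"
    and V_zero: "V 0 = 0"
    and r0: "r0 > 0" "\<And>x. x \<in> ball 0 (4 * r0) - {0} \<Longrightarrow> V x > 0"
    and C0_bounded: "bounded (C0 V)"
    and grad_nonzero: "\<And>x. x \<in> frontier (C0 V) \<Longrightarrow> grad V x \<noteq> 0"
    and c: "0 \<le> c" "c < cstar V"
  shows "\<exists>\<alpha> \<omega> :: ereal. \<exists>q :: real \<Rightarrow> real ^ 'n.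
           \<alpha> < \<omega> \<and>
           minimal_connection \<phi> V c (Vminus V c) (Vplus V c) \<alpha> \<omega> q \<and>
           C2_on (einterval \<alpha> \<omega>) q \<and> C1_within (closure (einterval \<alpha> \<omega>)) q \<and>
           solves_EL \<phi> V (einterval \<alpha> \<omega>) q \<and>
           (\<forall>t\<in>einterval \<alpha> \<omega>. energy \<phi> V q t = - c)"
proof -
  interpret orlicz \<phi> l m by unfold_locales (fact phi_pos phi_C1 lm phi_incr phi_growth)+
  let ?d = "\<lambda>x. infdist x (- C0 V)" and ?r = "rbar V"
  have contV: "continuous_on T V" for T by (rule continuous_on_C1_scalar_field[OF V_C1])
  \<comment> \<open>Near 0 only the origin itself can fail to have V > 0, and it belongs to C0;
    hence C0 is open.\<close>
  have "x \<in> C0 V" if "x \<in> ball 0 (4 * r0)" for x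
    using r0(2)[of x] that by (cases "x = 0") (auto simp: C0_def)
  then have "{x. V x > 0} \<union> ball 0 (4 * r0) \<subseteq> C0 V" unfolding C0_def by blast
  moreover have "C0 V \<subseteq> {x. V x > 0} \<union> ball 0 (4 * r0)" using r0(1) by (auto simp: C0_def)
  ultimately have "C0 V = {x. V x > 0} \<union> ball 0 (4 * r0)" by (rule equalityI[rotated])
  moreover have "open {x. V x > 0}" by (rule open_Collect_less) (auto intro: contV)
  ultimately have openC0: "open (C0 V)" by auto
  have "C0 V \<noteq> UNIV" using C0_bounded not_bounded_UNIV by metis
  then obtain z where z: "z \<notin> C0 V" by blast
  have d_zero: "?d x = 0 \<longleftrightarrow> x \<notin> C0 V" for x
    using in_closed_iff_infdist_zero[of "- C0 V" x] openC0 z by auto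
  have r_eq: "?d 0 = 2 * ?r" by (simp add: rbar_def)
  have "0 \<in> C0 V" by (simp add: C0_def)
  then have r_pos: "?r > 0" using d_zero[of 0] r_eq infdist_nonneg[of 0 "- C0 V"] by simp
  \<comment> \<open>The distance to the complement of C0 is 1-Lipschitz and equals 2 rbar at 0, so
    no point is closer than rbar to both 0 and the complement.\<close>
  have tri: "2 * ?r \<le> norm x + ?d x" for x using infdist_le_norm_add[of "- C0 V" x] r_eq by simp
  \<comment> \<open>A point violating both inequalities belongs to the set that defines
    \<open>cstar\<close>, where V \<ge> cstar > c.\<close>
  have low: "norm x < ?r \<or> ?d x < ?r" if "V x \<le> c" for x
  proof (rule ccontr)
    assume "\<not> ?thesis"
    then have x: "norm x \<ge> ?r" "?d x \<ge> ?r" by auto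
    then have "x \<in> C0 V" using d_zero[of x] r_pos by auto
    have "bdd_below (V ` {x \<in> C0 V. norm x \<ge> ?r \<and> ?d x \<ge> ?r})"
      by (rule bdd_belowI[of _ 0]) (auto simp: C0_def V_zero)
    then have "cstar V \<le> V x" unfolding cstar_def using x \<open>x \<in> C0 V\<close> by (intro cINF_lower) auto
    then show False using that c by simp
  qed
  \<comment> \<open>On the sublevel set norm x = rbar is impossible by \<open>low\<close> and
    \<open>tri\<close>, so the open ball may be replaced by the closed one, which gives compactness;
    the same works for \<open>Vplus\<close>.\<close>
  have A_eq: "Vminus V c = {x. V x \<le> c} \<inter> cball 0 ?r"
  proof -
    have "norm x < ?r" if "V x \<le> c" "norm x \<le> ?r" for x using low[OF that(1)] tri[of x] that(2) by linarith
    then show ?thesis by (force simp: Vminus_def sublevel_def)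
  qed
  have B_eq: "Vplus V c = {x. V x \<le> c} \<inter> {x. ?d x \<le> ?r}"
  proof -
    have "?d x < ?r" if "V x \<le> c" "?d x \<le> ?r" for x using low[OF that(1)] tri[of x] that(2) by linarith
    then show ?thesis by (force simp: Vplus_def sublevel_def)
  qed
  have cl: "closed {x. V x \<le> c}" by (rule closed_Collect_le) (auto intro: contV)
  interpret well \<phi> l m "\<lambda>x. V x - c" "grad V" "Vminus V c" "Vplus V c"
  proof
    show "((\<lambda>x. V x - c) has_derivative (\<lambda>h. grad V x \<bullet> h)) (at x)" for x
      using GDERIV_grad[OF V_C1, of x] unfolding gderiv_def
      by (auto intro!: derivative_eq_intros simp: inner_commute)
    show "continuous_on UNIV (grad V)" using V_C1 by (simp add: C1_scalar_field_def)
    show "bounded {x. 0 < V x - c}"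
      by (rule bounded_subset[OF C0_bounded]) (use c in \<open>auto simp: C0_def\<close>)
    show "{x. V x - c \<le> 0} = Vminus V c \<union> Vplus V c"
    proof (rule set_eqI)
      show "x \<in> {x. V x - c \<le> 0} \<longleftrightarrow> x \<in> Vminus V c \<union> Vplus V c" for x
        using low[of x] by (auto simp: Vminus_def Vplus_def sublevel_def)
    qed
    show "compact (Vminus V c)" unfolding A_eq using closed_Int_compact[OF cl compact_cball] .
    show "closed (Vplus V c)" unfolding B_eq
      by (intro closed_Int cl closed_Collect_le continuous_intros)
    \<comment> \<open>The origin and a point outside C0 witness nonemptiness, as V \<le> 0 \<le> c
      at both.\<close>
    have "0 \<in> Vminus V c" using c r_pos by (simp add: Vminus_def sublevel_def V_zero)
    then show "Vminus V c \<noteq> {}" by blast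
    have "z \<in> Vplus V c" using z c r_pos d_zero[of z] by (auto simp: Vplus_def sublevel_def C0_def)
    then show "Vplus V c \<noteq> {}" by blast
    have "\<not> (norm x < ?r \<and> ?d x < ?r)" for x using tri[of x] by linarith
    then show "Vminus V c \<inter> Vplus V c = {}" by (auto simp: Vminus_def Vplus_def)
  qed
  show ?thesis by (rule exists_minimal_connection) simp_all
qed

end
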